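(* Let $\mathbf D$ be a generalized divergence and let $\Theta_1^k,\Theta_2^k$ be two $k$-combs (quantum networks). For any adaptive network discrimination strategy using $n$ copies of the network, with final decision distributions $p$ (if the network is $\Theta_1^k$) and $q$ (if it is $\Theta_2^k$), one has $$\mathbf D(p\|q)\le n\,\mathbf D^{A^*}(\Theta_1^k\|\Theta_2^k).$$
   Context: All systems are finite-dimensional; channels are completely positive trace-preserving maps; identity maps on systems not acted upon are omitted; $R$ denotes reference systems. Generalized divergence: a function $\mathbf D$ of pairs of states with values in $\mathbb R\cup\{+\infty\}$ satisfying $\mathbf D(\rho\|\sigma)\ge\mathbf D(\mathcal N(\rho)\|\mathcal N(\sigma))$ for all states and channels. Probability distributions are viewed as diagonal states. Amortized channel divergence: $\mathbf D^A(\mathcal N\|\mathcal M)=\sup_{\rho,\tau}[\mathbf D((\mathcal N\otimes\mathrm{id}_R)(\rho)\|(\mathcal M\otimes\mathrm{id}_R)(\tau))-\mathbf D(\rho\|\tau)]$, over states $\rho,\tau$ of input plus reference. $k$-comb: a sequence of channels $\Theta^k=(\mathcal N^1_{C\to A_1S_1},\mathcal N^2_{B_1S_1\to A_2S_2},\dots,\mathcal N^k_{B_{k-1}S_{k-1}\to D})$, called its components, acting on $k-1$ channels $\mathcal A_i$ from $A_i$ to $B_i$ (possibly also acting on a reference system $R$) by $\Theta^k((\mathcal A_i)_{k-1})=\mathcal N^k\circ\mathcal A_{k-1}\circ\mathcal N^{k-1}\circ\cdots\circ\mathcal A_1\circ\mathcal N^1$, where $(\mathcal A_i)_{k-1}=(\mathcal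 A_1,\dots,\mathcal A_{k-1})$. It has $k-1$ access points. Fully-amortized network divergence: $$\mathbf D^{A^*}(\Theta_1^k\|\Theta_2^k)=\sup_{\substack{(\mathcal A_i)_{k-1},(\bar{\mathcal A}_i)_{k-1}\\ \mathcal A_0,\bar{\mathcal A}_0}}\ \inf_{\Omega^{k-1}}\Big[\mathbf D^A\big(\Theta_1^k((\mathcal A_i)_{k-1})\circ\mathcal A_0\big\|\Theta_2^k((\bar{\mathcal A}_i)_{k-1})\circ\bar{\mathcal A}_0\big)-\mathbf D^A\big(\mathcal A_{k-1}\circ\Omega^{k-1}((\mathcal A_i)_{k-2})\circ\mathcal A_0\big\|\bar{\mathcal A}_{k-1}\circ\Omega^{k-1}((\bar{\mathcal A}_i)_{k-2})\circ\bar{\mathcal A}_0\big)\Big],$$ where $\mathcal A_i,\bar{\mathcal A}_i$ ($1\le i\le k-1$) are channels that the $k$-combs act on, $\mathcal A_0,\bar{\mathcal A}_0$ are channels preceding the combs, $(\mathcal A_i)_{k-2}=(\mathcal A_1,\dots,\mathcal A_{k-2})$, and $\Omega^{k-1}$ ranges over $(k-1)$-combs for which the displayed compositions are defined (for $k=2$, $\Omega^{1}$ is a channel from $C$ to $A_1$ together with an additional reference system). Adaptive network discrimination strategy with $n$ copies: arrange the $nk$ components of the $n$ copies (each copy has its own memory systems $S_1,\dots,S_{k-1}$) in any order in which the components of each copy appear in their given order $\mathcal N^1,\dots,\mathcal N^k$. Starting from an input state on $CR$, apply the components in this order, with arbitrary channels, acting on all systems except the memory systems of the copies, applied between consecutive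 components; finally measure with a binary POVM. All choices are the same for both hypotheses; $p$ and $q$ are the resulting binary outcome distributions.
   Formalization: The formal theorem additionally assumes D(ρ‖ρ) ≤ 0 for all states ρ; without it the claim is false (a constant D = 5 satisfies data processing but has fully-amortized divergence 0). It takes k ≥ 2 and n ≥ 1. *)

theory Defs
  imports
    "HOL-Library.Extended_Real"
    "Jordan_Normal_Form.Matrix"
begin

text \<open>
  A finite-dimensional system is represented by its dimension.  The tensor product of systems of
  dimensions \<open>m\<close> and \<open>n\<close> has dimension \<open>m * n\<close>, with the basis vector
  \<open>e\<^sub>u \<otimes> e\<^sub>v\<close> at index \<open>u * n + v\<close>.  This product is strictly associative, and the
  one-dimensional system is a strict unit.
\<close>

section \<open>States and channels\<close>

definition tr :: "complex mat \<Rightarrow> complex" where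
  "tr X = (\<Sum>i<dim_row X. X $$ (i, i))"

text \<open>The order on complex numbers is that of \<^theory>\<open>HOL-Library.Complex_Order\<close>: \<open>0 \<le> z\<close> says
  that \<open>z\<close> is real and nonnegative.\<close>

definition psd :: "nat \<Rightarrow> complex mat \<Rightarrow> bool" where
  "psd m X \<longleftrightarrow> X \<in> carrier_mat m m \<and> (\<forall>v \<in> carrier_vec m. 0 \<le> (X *\<^sub>v v) \<bullet>c v)"

definition state :: "nat \<Rightarrow> complex mat \<Rightarrow> bool" where
  "state m \<rho> \<longleftrightarrow> psd m \<rho> \<and> tr \<rho> = 1"

type_synonym qmap = "complex mat \<Rightarrow> complex mat"

text \<open>
  \<open>tens_id l m n r \<Phi>\<close> is \<open>id\<^sub>l \<otimes> \<Phi> \<otimes> id\<^sub>r\<close> for a linear map \<open>\<Phi>\<close> from \<open>m \<times> m\<close> to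
  \<open>n \<times> n\<close> matrices: for fixed basis indices \<open>p, p'\<close> of the left and \<open>q, q'\<close> of the right factor,
  \<open>\<Phi>\<close> is applied to the block \<open>(u, v) \<mapsto> X (p u q, p' v q')\<close>.
\<close>

definition tens_id :: "nat \<Rightarrow> nat \<Rightarrow> nat \<Rightarrow> nat \<Rightarrow> qmap \<Rightarrow> qmap" where
  "tens_id l m n r \<Phi> X = mat (l * n * r) (l * n * r) (\<lambda>(i, j).
     \<Phi> (mat m m (\<lambda>(u, v).
           X $$ ((i div (n * r) * m + u) * r + i mod r, (j div (n * r) * m + v) * r + j mod r)))
       $$ (i div r mod n, j div r mod n))"

definition channel :: "nat \<Rightarrow> nat \<Rightarrow> qmap \<Rightarrow> bool" where
  "channel m n \<Phi> \<longleftrightarrow> 0 < m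
     \<and> (\<forall>X \<in> carrier_mat m m. \<Phi> X \<in> carrier_mat n n)
     \<and> (\<forall>X \<in> carrier_mat m m. \<forall>Y \<in> carrier_mat m m. \<Phi> (X + Y) = \<Phi> X + \<Phi> Y)
     \<and> (\<forall>c. \<forall>X \<in> carrier_mat m m. \<Phi> (c \<cdot>\<^sub>m X) = c \<cdot>\<^sub>m \<Phi> X)
     \<and> (\<forall>r X. psd (m * r) X \<longrightarrow> psd (n * r) (tens_id 1 m n r \<Phi> X))
     \<and> (\<forall>X \<in> carrier_mat m m. tr (\<Phi> X) = tr X)"

text \<open>The exchange of tensor factors, from operators on dimension \<open>x * y\<close> to operators on
  dimension \<open>y * x\<close>.\<close>

definition swap_op :: "nat \<Rightarrow> nat \<Rightarrow> qmap" where
  "swap_op x y X = mat (y * x) (y * x) (\<lambda>(i, j).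
     X $$ (i mod x * y + i div x, j mod x * y + j div x))"

section \<open>Generalized and amortized divergences\<close>

definition generalized_divergence :: "(complex mat \<Rightarrow> complex mat \<Rightarrow> ereal) \<Rightarrow> bool" where
  "generalized_divergence D \<longleftrightarrow>
     (\<forall>m \<rho> \<sigma>. state m \<rho> \<and> state m \<sigma> \<longrightarrow> D \<rho> \<sigma> \<noteq> -\<infinity>)
     \<and> (\<forall>m n \<rho> \<sigma> \<N>. state m \<rho> \<and> state m \<sigma> \<and> channel m n \<N> \<longrightarrow> D (\<N> \<rho>) (\<N> \<sigma>) \<le> D \<rho> \<sigma>)"

text \<open>
  The difference of two divergences, where a difference with subtrahend \<open>\<infinity>\<close> does not contribute
  to a supremum, even if it reads \<open>\<infinity> - \<infinity>\<close>.  The library's \<open>\<infinity> - \<infinity> = \<infinity>\<close> would make the suprema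
  below infinite for divergences such as the relative entropy.
\<close>

definition gap :: "ereal \<Rightarrow> ereal \<Rightarrow> ereal" where
  "gap x y = (if y = \<infinity> then -\<infinity> else x - y)"

text \<open>The amortized channel divergence of channels from dimension \<open>m\<close> to dimension \<open>n\<close>; \<open>d\<close> is the
  dimension of the reference.\<close>

definition amortized ::
    "(complex mat \<Rightarrow> complex mat \<Rightarrow> ereal) \<Rightarrow> nat \<Rightarrow> nat \<Rightarrow> qmap \<Rightarrow> qmap \<Rightarrow> ereal" where
  "amortized D m n \<N> \<M> =
     (SUP (d, \<rho>, \<tau>) \<in> {(d, \<rho>, \<tau>). state (m * d) \<rho> \<and> state (m * d) \<tau>}.
        gap (D (tens_id 1 m n d \<N> \<rho>) (tens_id 1 m n d \<M> \<tau>)) (D \<rho> \<tau>))"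

section \<open>Combs\<close>

text \<open>
  The interface of a \<open>k\<close>-comb is given by functions \<open>a, b\<close>: \<open>a i\<close> is the dimension of \<open>A\<^sub>i\<close> and
  \<open>b i\<close> that of \<open>B\<^sub>i\<close> for \<open>0 < i < k\<close>, while \<open>b 0\<close> is the dimension of \<open>C\<close> and \<open>a k\<close> that of
  \<open>D\<close>.  \<open>comb_mem i\<close> is the dimension of the memory \<open>S\<^sub>i\<close>, with \<open>S\<^sub>0\<close> and \<open>S\<^sub>k\<close> trivial, and
  \<open>comb_chan i\<close> is the component from \<open>S\<^bsub>i-1\<^esub> \<otimes> B\<^bsub>i-1\<^esub>\<close> to \<open>S\<^sub>i \<otimes> A\<^sub>i\<close>, for \<open>1 \<le> i \<le> k\<close>.
\<close>

record qcomb =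
  comb_mem :: "nat \<Rightarrow> nat"
  comb_chan :: "nat \<Rightarrow> qmap"

text \<open>An \<open>m\<close>-comb whose final output is \<open>S\<^sub>m \<otimes> A\<^sub>m\<close>, with \<open>S\<^sub>m\<close> an arbitrary additional
  reference system.\<close>

definition open_comb :: "nat \<Rightarrow> (nat \<Rightarrow> nat) \<Rightarrow> (nat \<Rightarrow> nat) \<Rightarrow> qcomb \<Rightarrow> bool" where
  "open_comb m a b \<Theta> \<longleftrightarrow> comb_mem \<Theta> 0 = 1
     \<and> (\<forall>i<m. channel (comb_mem \<Theta> i * b i) (comb_mem \<Theta> (Suc i) * a (Suc i))
                 (comb_chan \<Theta> (Suc i)))"

definition comb :: "nat \<Rightarrow> (nat \<Rightarrow> nat) \<Rightarrow> (nat \<Rightarrow> nat) \<Rightarrow> qcomb \<Rightarrow> bool" where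
  "comb k a b \<Theta> \<longleftrightarrow> open_comb k a b \<Theta> \<and> comb_mem \<Theta> k = 1"

text \<open>
  A choice of channels for a \<open>k\<close>-comb: \<open>A 0\<close> goes from the system of dimension \<open>x\<close> to
  \<open>C \<otimes> R\<^sub>0\<close>, and \<open>A i\<close> from \<open>A\<^sub>i \<otimes> R\<^bsub>i-1\<^esub>\<close> to \<open>B\<^sub>i \<otimes> R\<^sub>i\<close>, where \<open>r i\<close> is the dimension
  of the reference \<open>R\<^sub>i\<close>.
\<close>

definition slot_channels ::
    "nat \<Rightarrow> (nat \<Rightarrow> nat) \<Rightarrow> (nat \<Rightarrow> nat) \<Rightarrow> nat \<Rightarrow> (nat \<Rightarrow> nat) \<Rightarrow> (nat \<Rightarrow> qmap) \<Rightarrow> bool" where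
  "slot_channels k a b x r A \<longleftrightarrow> channel x (b 0 * r 0) (A 0)
     \<and> (\<forall>i \<in> {1..<k}. channel (a i * r (i - 1)) (b i * r i) (A i))"

definition slot_apply ::
    "(nat \<Rightarrow> nat) \<Rightarrow> (nat \<Rightarrow> nat) \<Rightarrow> qcomb \<Rightarrow> (nat \<Rightarrow> nat) \<Rightarrow> (nat \<Rightarrow> qmap) \<Rightarrow> nat \<Rightarrow> qmap" where
  "slot_apply a b \<Theta> r A i =
     tens_id (comb_mem \<Theta> i) (a i * r (i - 1)) (b i * r i) 1 (A i)"

text \<open>\<open>comb_apply a b \<Theta> r A k\<close> is
  \<open>\<Theta>\<^sup>k((\<A>\<^sub>i)\<^bsub>k-1\<^esub>) = \<N>\<^sup>k \<circ> \<A>\<^bsub>k-1\<^esub> \<circ> \<dots> \<circ> \<A>\<^sub>1 \<circ> \<N>\<^sup>1\<close>; it does not involve \<open>A 0\<close>.\<close>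

primrec comb_apply ::
    "(nat \<Rightarrow> nat) \<Rightarrow> (nat \<Rightarrow> nat) \<Rightarrow> qcomb \<Rightarrow> (nat \<Rightarrow> nat) \<Rightarrow> (nat \<Rightarrow> qmap) \<Rightarrow> nat \<Rightarrow> qmap" where
  "comb_apply a b \<Theta> r A 0 = id"
| "comb_apply a b \<Theta> r A (Suc i) =
     tens_id 1 (comb_mem \<Theta> i * b i) (comb_mem \<Theta> (Suc i) * a (Suc i)) (r i)
         (comb_chan \<Theta> (Suc i))
       \<circ> (if i = 0 then id else slot_apply a b \<Theta> r A i)
       \<circ> comb_apply a b \<Theta> r A i"

text \<open>
  The fully-amortized network divergence, for \<open>k \<ge> 2\<close>.  The two tuples of channels may use
  different intermediate references; only the systems that are compared, the first input and the
  last reference \<open>R\<^bsub>k-1\<^esub>\<close>, have to agree.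
\<close>

definition network_divergence ::
    "(complex mat \<Rightarrow> complex mat \<Rightarrow> ereal) \<Rightarrow> nat \<Rightarrow> (nat \<Rightarrow> nat) \<Rightarrow> (nat \<Rightarrow> nat)
       \<Rightarrow> qcomb \<Rightarrow> qcomb \<Rightarrow> ereal" where
  "network_divergence D k a b \<Theta>\<^sub>1 \<Theta>\<^sub>2 =
     (SUP (x, r, A, r', A') \<in> {(x, r, A, r', A').
            slot_channels k a b x r A \<and> slot_channels k a b x r' A' \<and> r (k - 1) = r' (k - 1)}.
      INF \<Omega> \<in> {\<Omega>. open_comb (k - 1) a b \<Omega>}.
        gap
          (amortized D x (a k * r (k - 1))
             (comb_apply a b \<Theta>\<^sub>1 r A k \<circ> A 0)
             (comb_apply a b \<Theta>\<^sub>2 r' A' k \<circ> A' 0))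
          (amortized D x (comb_mem \<Omega> (k - 1) * (b (k - 1) * r (k - 1)))
             (slot_apply a b \<Omega> r A (k - 1) \<circ> comb_apply a b \<Omega> r A (k - 1) \<circ> A 0)
             (slot_apply a b \<Omega> r' A' (k - 1) \<circ> comb_apply a b \<Omega> r' A' (k - 1) \<circ> A' 0)))"

section \<open>Adaptive network discrimination\<close>

text \<open>
  The order in which the components are applied is a list \<open>sched\<close> of copies: step \<open>t\<close> applies the
  next component of copy \<open>sched ! t\<close>.  At every time the total system is
  \<open>M\<^sub>0 \<otimes> \<dots> \<otimes> M\<^bsub>n-1\<^esub> \<otimes> W\<close>, where \<open>M\<^sub>j\<close> is the current memory of copy \<open>j\<close> (trivial before the
  first and after the last component of that copy) and \<open>W\<close> collects all other systems.  Step \<open>t\<close>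
  takes \<open>W = B\<^bsub>i-1\<^esub> \<otimes> R\<close> to \<open>A\<^sub>i \<otimes> R\<close>, where \<open>R\<close> has dimension \<open>rdim t\<close>; it is followed by the
  channel \<open>link t\<close> on \<open>W\<close>.  The final binary POVM is \<open>effect 0, effect 1\<close>.
\<close>

record qstrategy =
  sched :: "nat list"
  rdim :: "nat \<Rightarrow> nat"
  input :: "complex mat"
  link :: "nat \<Rightarrow> qmap"
  effect :: "nat \<Rightarrow> complex mat"

text \<open>The number of components of copy \<open>j\<close> applied in the first \<open>t\<close> steps.\<close>

definition used :: "qstrategy \<Rightarrow> nat \<Rightarrow> nat \<Rightarrow> nat" where
  "used S t j = count_list (take t (sched S)) j"

text \<open>The component applied in step \<open>t\<close> is number \<open>Suc (pos S t)\<close> of its copy.\<close>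

definition pos :: "qstrategy \<Rightarrow> nat \<Rightarrow> nat" where
  "pos S t = used S t (sched S ! t)"

definition adaptive_strategy ::
    "nat \<Rightarrow> nat \<Rightarrow> (nat \<Rightarrow> nat) \<Rightarrow> (nat \<Rightarrow> nat) \<Rightarrow> qstrategy \<Rightarrow> bool" where
  "adaptive_strategy n k a b S \<longleftrightarrow>
     length (sched S) = n * k \<and> set (sched S) \<subseteq> {..<n} \<and> (\<forall>j<n. count_list (sched S) j = k)
     \<and> state (b 0 * rdim S 0) (input S)
     \<and> (\<forall>t. Suc t < n * k \<longrightarrow>
          channel (a (Suc (pos S t)) * rdim S t) (b (pos S (Suc t)) * rdim S (Suc t)) (link S t))
     \<and> psd (a k * rdim S (n * k - 1)) (effect S 0) \<and> psd (a k * rdim S (n * k - 1)) (effect S 1)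
     \<and> effect S 0 + effect S 1 = 1\<^sub>m (a k * rdim S (n * k - 1))"

definition mem_dim :: "qcomb \<Rightarrow> qstrategy \<Rightarrow> nat \<Rightarrow> nat set \<Rightarrow> nat" where
  "mem_dim \<Theta> S t J = (\<Prod>j \<in> J. comb_mem \<Theta> (used S t j))"

text \<open>The memory of the acting copy, of dimension \<open>s\<close>, is moved next to \<open>W\<close>, past the memories of
  the later copies, and the new memory, of dimension \<open>s'\<close>, is moved back.\<close>

definition component_step ::
    "nat \<Rightarrow> (nat \<Rightarrow> nat) \<Rightarrow> (nat \<Rightarrow> nat) \<Rightarrow> qcomb \<Rightarrow> qstrategy \<Rightarrow> nat \<Rightarrow> qmap" where
  "component_step n a b \<Theta> S t =
     (let j = sched S ! t; i = pos S t; r = rdim S t;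
          P = mem_dim \<Theta> S t {..<j}; Q = mem_dim \<Theta> S t {j<..<n};
          s = comb_mem \<Theta> i; s' = comb_mem \<Theta> (Suc i)
      in tens_id P (Q * s') (s' * Q) (a (Suc i) * r) (swap_op Q s')
         \<circ> tens_id (P * Q) (s * b i) (s' * a (Suc i)) r (comb_chan \<Theta> (Suc i))
         \<circ> tens_id P (s * Q) (Q * s) (b i * r) (swap_op s Q))"

text \<open>The total state immediately before step \<open>t\<close>.\<close>

primrec run :: "nat \<Rightarrow> (nat \<Rightarrow> nat) \<Rightarrow> (nat \<Rightarrow> nat) \<Rightarrow> qcomb \<Rightarrow> qstrategy \<Rightarrow> nat \<Rightarrow> complex mat" where
  "run n a b \<Theta> S 0 = input S"
| "run n a b \<Theta> S (Suc t) =
     tens_id (mem_dim \<Theta> S (Suc t) {..<n}) (a (Suc (pos S t)) * rdim S t)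
         (b (pos S (Suc t)) * rdim S (Suc t)) 1 (link S t)
       (component_step n a b \<Theta> S t (run n a b \<Theta> S t))"

definition final_state ::
    "nat \<Rightarrow> nat \<Rightarrow> (nat \<Rightarrow> nat) \<Rightarrow> (nat \<Rightarrow> nat) \<Rightarrow> qcomb \<Rightarrow> qstrategy \<Rightarrow> complex mat" where
  "final_state n k a b \<Theta> S =
     component_step n a b \<Theta> S (n * k - 1) (run n a b \<Theta> S (n * k - 1))"

text \<open>The distribution of the binary outcome, as a diagonal state.\<close>

definition decision ::
    "nat \<Rightarrow> nat \<Rightarrow> (nat \<Rightarrow> nat) \<Rightarrow> (nat \<Rightarrow> nat) \<Rightarrow> qcomb \<Rightarrow> qstrategy \<Rightarrow> complex mat" where
  "decision n k a b \<Theta> S = mat_diag 2 (\<lambda>i. tr (effect S i * final_state n k a b \<Theta> S))"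

end

(*
  A run with several copies is compared under the two hypotheses by the amortized divergence of the
  channels it induces from the initial to the final system.  At the last component of the copy that
  finishes last, the run is an application of this copy to the channels formed by everything in
  between, including the other copies.  By the definition of the network divergence, replacing this
  copy by some comb Omega under both hypotheses costs at most one network divergence.  Omega, being
  known, is absorbed into the common channels, which leaves a run with one copy less; common channels
  at the end are removed by data processing.  When no copy is left, the two channels coincide and
  their amortized divergence is at most 0.
*)

theory Submission
  imports Defs
begin

section \<open>Tensor factors and swaps\<close>

text \<open>The slots of one copy contain components of the other copies, so the channels inserted
  into it differ between the two hypotheses, and so do their references, which hold the memories of
  the other copies. The two tuples in the network divergence leave room for this; only the last
  references have to agree. They do for the copy that finishes last, because the memories of the
  other copies are trivial by then.

  Absorbing \<Omega> does not produce a strategy for fewer copies, since the components of \<Omega>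
  remain in the run as links. The induction therefore speaks of general processes with common links;
  it is over time and never changes the schedule. The infimum over \<Omega> does no harm because the
  bound for the remaining copies holds for every \<Omega>.

  Tensor factors are ordered, so regrouping systems costs swaps. Most of these are handled
  algebraically, by naturality and the hexagon identities. Only the order of the copies is changed
  by comparing matrix entries.\<close>

lemma digit_less: "p * n + u < l * n" if "p < l" "u < n" for p u l n :: nat
proof -
  have "p * n + u < Suc p * n" using that by simp
  also have "\<dots> \<le> l * n" using that by (intro mult_le_mono1) simp
  finally show ?thesis .
qed

lemma digit_cases:
  fixes i :: nat
  assumes "i < l * n"
  obtains p u where "p < l" "u < n" "i = p * n + u"
proof
  have "0 < n" using assms by (cases n) auto
  then show "i div n < l" "i mod n < n" "i = i div n * n + i mod n"
    using assms by (auto simp: less_mult_imp_div_less)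
qed

lemma digit3_less: "(p * n + u) * r + q < l * n * r"
  if "p < l" "u < n" "q < r" for p u q l n r :: nat
  using that by (intro digit_less)

text \<open>At indices written in mixed-radix form the \<open>div\<close> and \<open>mod\<close> in
  \<open>tens_id\<close> and \<open>swap_op\<close> evaluate to digits. Identities between such maps
  are proved entrywise at these indices.\<close>

lemma mat_digits_eqI:
  assumes A: "A \<in> carrier_mat (l * n * r) (l * n * r)"
    and B: "B \<in> carrier_mat (l * n * r) (l * n * r)"
    and eq: "\<And>p u q p' u' q'. p < l \<Longrightarrow> u < n \<Longrightarrow> q < r \<Longrightarrow> p' < l \<Longrightarrow> u' < n \<Longrightarrow> q' < r \<Longrightarrow>
      A $$ ((p * n + u) * r + q, (p' * n + u') * r + q') =
      B $$ ((p * n + u) * r + q, (p' * n + u') * r + q')"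
  shows "A = B"
proof (rule eq_matI)
  fix i j assume "i < dim_row B" "j < dim_col B"
  then have "i < l * n * r" "j < l * n * r" using B by auto
  then show "A $$ (i, j) = B $$ (i, j)"
    by (elim digit_cases) (simp add: eq)
qed (use A B in auto)

lemma mat_digits2_eqI:
  assumes A: "A \<in> carrier_mat (l * n) (l * n)"
    and B: "B \<in> carrier_mat (l * n) (l * n)"
    and eq: "\<And>p u p' u'. p < l \<Longrightarrow> u < n \<Longrightarrow> p' < l \<Longrightarrow> u' < n \<Longrightarrow>
      A $$ (p * n + u, p' * n + u') = B $$ (p * n + u, p' * n + u')"
  shows "A = B"
proof (rule mat_digits_eqI[where l = 1 and n = l and r = n])
  fix p u q p' u' q' assume "p < (1::nat)" "u < l" "q < n" "p' < (1::nat)" "u' < l" "q' < n"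
  then show "A $$ ((p * l + u) * n + q, (p' * l + u') * n + q') =
        B $$ ((p * l + u) * n + q, (p' * l + u') * n + q')"
    using eq by simp
qed (use A B in auto)

lemma digit3_simps:
  fixes p u q n r :: nat
  assumes "u < n" "q < r"
  shows "((p * n + u) * r + q) div (n * r) = p"
    and "((p * n + u) * r + q) div r mod n = u"
    and "((p * n + u) * r + q) mod r = q"
  using assms by (simp_all add: div_mult2_eq mult.commute[of n r])

lemma tens_id_carrier: "tens_id l m n r \<Phi> X \<in> carrier_mat (l * n * r) (l * n * r)"
  by (simp add: tens_id_def)

lemma tens_id_index:
  assumes "p < l" "u < n" "q < r" "p' < l" "u' < n" "q' < r"
  shows "tens_id l m n r \<Phi> X $$ ((p * n + u) * r + q, (p' * n + u') * r + q') =
    \<Phi> (mat m m (\<lambda>(v, v'). X $$ ((p * m + v) * r + q, (p' * m + v') * r + q'))) $$ (u, u')"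
  using assms by (simp add: tens_id_def digit3_simps digit3_less)

text \<open>The outer map reads blocks of size \<open>n\<close> from the intermediate matrix. Such a
  block is the whole output of \<open>\<Phi>\<close> only if this output is an \<open>n\<close> by
  \<open>n\<close> matrix.\<close>

lemma tens_id_comp:
  assumes "\<And>X. X \<in> carrier_mat m m \<Longrightarrow> \<Phi> X \<in> carrier_mat n n"
  shows "tens_id l n n' r \<Psi> (tens_id l m n r \<Phi> X) = tens_id l m n' r (\<Psi> \<circ> \<Phi>) X"
proof (rule mat_digits_eqI)
  fix p u q p' u' q' assume *: "p < l" "u < n'" "q < r" "p' < l" "u' < n'" "q' < r"
  let ?B = "mat m m (\<lambda>(v, v'). X $$ ((p * m + v) * r + q, (p' * m + v') * r + q'))"
  have "mat n n (\<lambda>(v, v'). tens_id l m n r \<Phi> X $$ ((p * n + v) * r + q, (p' * n + v') * r + q')) = \<Phi> ?B"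
    using * assms[of ?B] by (intro eq_matI) (auto simp: tens_id_index)
  then show "tens_id l n n' r \<Psi> (tens_id l m n r \<Phi> X) $$ ((p * n' + u) * r + q, (p' * n' + u') * r + q') =
    tens_id l m n' r (\<Psi> \<circ> \<Phi>) X $$ ((p * n' + u) * r + q, (p' * n' + u') * r + q')"
    using * by (simp add: tens_id_index)
qed (rule tens_id_carrier)+

text \<open>Both sides apply \<open>\<Phi>\<close> to the same block of \<open>X\<close>, because
  the index encoding is strictly associative; \<open>idx\<close> is the corresponding identity of
  indices.\<close>

lemma tens_id_nest:
  "tens_id l' (l * m * r) (l * n * r) r' (tens_id l m n r \<Phi>) X = tens_id (l' * l) m n (r * r') \<Phi> X"
proof (rule mat_digits_eqI)
  show "tens_id l' (l * m * r) (l * n * r) r' (tens_id l m n r \<Phi>) X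
      \<in> carrier_mat (l' * l * n * (r * r')) (l' * l * n * (r * r'))"
    using tens_id_carrier[of l' "l * m * r" "l * n * r" r' "tens_id l m n r \<Phi>" X]
    by (simp add: mult.assoc)
  show "tens_id (l' * l) m n (r * r') \<Phi> X \<in> carrier_mat (l' * l * n * (r * r')) (l' * l * n * (r * r'))"
    by (rule tens_id_carrier)
  fix g u h g' u' h'
  assume "g < l' * l" "h < r * r'" "g' < l' * l" "h' < r * r'" and u: "u < n" "u' < n"
  then obtain o1 p q o2 o1' p' q' o2' where g: "o1 < l'" "p < l" "g = o1 * l + p"
    "q < r" "o2 < r'" "h = q * r' + o2"
    "o1' < l'" "p' < l" "g' = o1' * l + p'" "q' < r" "o2' < r'" "h' = q' * r' + o2'"
    by (metis digit_cases)
  have idx: "((o1 * l + p) * n + u) * (r * r') + (q * r' + o2) =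
      (o1 * (l * n * r) + ((p * n + u) * r + q)) * r' + o2" for o1 p u q o2 n
    by (simp add: algebra_simps)
  have less: "(p * n + v) * r + q < l * n * r" if "p < l" "v < n" "q < r" for p v q n
    using that by (rule digit3_less)
  show "tens_id l' (l * m * r) (l * n * r) r' (tens_id l m n r \<Phi>) X
      $$ ((g * n + u) * (r * r') + h, (g' * n + u') * (r * r') + h') =
    tens_id (l' * l) m n (r * r') \<Phi> X $$ ((g * n + u) * (r * r') + h, (g' * n + u') * (r * r') + h')"
  proof -
    have L: "tens_id l' (l * m * r) (l * n * r) r' (tens_id l m n r \<Phi>) X
      $$ ((g * n + u) * (r * r') + h, (g' * n + u') * (r * r') + h') =
      \<Phi> (mat m m (\<lambda>(v, v'). X $$ ((o1 * (l * m * r) + ((p * m + v) * r + q)) * r' + o2,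
          (o1' * (l * m * r) + ((p' * m + v') * r + q')) * r' + o2'))) $$ (u, u')"
      unfolding g idx
      apply (subst tens_id_index)
      using g u apply (auto intro!: less)
      apply (subst tens_id_index)
      using g u apply auto
      apply (rule arg_cong[where f = "\<lambda>M. \<Phi> M $$ (u, u')"])
      by (rule eq_matI) (auto simp: less)
    have R: "tens_id (l' * l) m n (r * r') \<Phi> X $$ ((g * n + u) * (r * r') + h, (g' * n + u') * (r * r') + h') =
      \<Phi> (mat m m (\<lambda>(v, v'). X $$ (((o1 * l + p) * m + v) * (r * r') + (q * r' + o2),
          ((o1' * l + p') * m + v') * (r * r') + (q' * r' + o2')))) $$ (u, u')"
      unfolding g using g u by (subst tens_id_index) (auto intro!: digit_less)
    show ?thesis unfolding L R idx ..
  qed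
qed

section \<open>The exchange of tensor factors and its coherence laws\<close>

lemma swap_op_carrier: "swap_op x y X \<in> carrier_mat (y * x) (y * x)"
  by (simp add: swap_op_def)

lemma swap_op_index:
  assumes "v < y" "u < x" "v' < y" "u' < x"
  shows "swap_op x y X $$ (v * x + u, v' * x + u') = X $$ (u * y + v, u' * y + v')"
  using assms by (simp add: swap_op_def digit_less)

lemma tens_id_swap_index:
  assumes "p < l" "v < y" "u < x" "q < r" "p' < l" "v' < y" "u' < x" "q' < r"
  shows "tens_id l (x * y) (y * x) r (swap_op x y) X
      $$ ((p * (y * x) + (v * x + u)) * r + q, (p' * (y * x) + (v' * x + u')) * r + q') =
    X $$ ((p * (x * y) + (u * y + v)) * r + q, (p' * (x * y) + (u' * y + v')) * r + q')"
  using assms by (simp add: tens_id_index digit_less swap_op_index)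

lemma swap_op_swap_op:
  assumes "X \<in> carrier_mat (x * y) (x * y)"
  shows "swap_op y x (swap_op x y X) = X"
  by (rule mat_digits2_eqI[where l = x and n = y])
    (use assms in \<open>auto simp: swap_op_index swap_op_carrier mult.commute\<close>)

text \<open>Naturality of the swap. Together with the hexagon identities it carries out the
  reorderings in \<open>conjugate_by_swap\<close> and \<open>proc_run_absorb\<close>.\<close>

lemma swap_op_tens_id_right:
  "swap_op y n (tens_id y m n 1 \<Phi> X) = tens_id 1 m n y \<Phi> (swap_op y m X)"
proof (rule mat_digits2_eqI[where l = n and n = y])
  fix u v u' v' assume *: "v < y" "u < n" "v' < y" "u' < n"
  have "swap_op y n (tens_id y m n 1 \<Phi> X) $$ (u * y + v, u' * y + v') =
    tens_id y m n 1 \<Phi> X $$ ((v * n + u) * 1 + 0, (v' * n + u') * 1 + 0)"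
    using * by (simp add: swap_op_index)
  also have "\<dots> = \<Phi> (mat m m (\<lambda>(w, w'). X $$ ((v * m + w) * 1 + 0, (v' * m + w') * 1 + 0))) $$ (u, u')"
    using * by (intro tens_id_index) auto
  also have "mat m m (\<lambda>(w, w'). X $$ ((v * m + w) * 1 + 0, (v' * m + w') * 1 + 0)) =
    mat m m (\<lambda>(w, w'). swap_op y m X $$ ((0 * m + w) * y + v, (0 * m + w') * y + v'))"
    using * by (intro eq_matI) (auto simp: swap_op_index)
  also have "\<Phi> \<dots> $$ (u, u') = tens_id 1 m n y \<Phi> (swap_op y m X) $$ ((0 * n + u) * y + v, (0 * n + u') * y + v')"
    using * by (intro tens_id_index[symmetric]) auto
  finally show "swap_op y n (tens_id y m n 1 \<Phi> X) $$ (u * y + v, u' * y + v') =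
    tens_id 1 m n y \<Phi> (swap_op y m X) $$ (u * y + v, u' * y + v')" by simp
qed (auto simp: swap_op_carrier intro: tens_id_carrier[of 1 m n y, simplified])

text \<open>Hexagon identity: a factor passes a product one factor at a time. Both sides pick the
  same entry of \<open>X\<close>, and the intermediate indices differ only in their
  bracketing.\<close>

lemma swap_op_hexagon_right:
  "swap_op x (y * z) X =
    tens_id y (x * z) (z * x) 1 (swap_op x z) (tens_id 1 (x * y) (y * x) z (swap_op x y) X)"
proof (rule mat_digits_eqI[where l = y and n = z and r = x])
  fix v w u v' w' u' assume *: "v < y" "w < z" "u < x" "v' < y" "w' < z" "u' < x"
  have "tens_id y (x * z) (z * x) 1 (swap_op x z) (tens_id 1 (x * y) (y * x) z (swap_op x y) X)
      $$ ((v * (z * x) + (w * x + u)) * 1 + 0, (v' * (z * x) + (w' * x + u')) * 1 + 0) =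
    tens_id 1 (x * y) (y * x) z (swap_op x y) X
      $$ ((v * (x * z) + (u * z + w)) * 1 + 0, (v' * (x * z) + (u' * z + w')) * 1 + 0)"
    using * by (intro tens_id_swap_index) auto
  also have "\<dots> = tens_id 1 (x * y) (y * x) z (swap_op x y) X
      $$ ((0 * (y * x) + (v * x + u)) * z + w, (0 * (y * x) + (v' * x + u')) * z + w')"
    by (simp add: algebra_simps)
  also have "\<dots> = X $$ ((0 * (x * y) + (u * y + v)) * z + w, (0 * (x * y) + (u' * y + v')) * z + w')"
    using * by (intro tens_id_swap_index) auto
  also have "\<dots> = X $$ (u * (y * z) + (v * z + w), u' * (y * z) + (v' * z + w'))"
    by (simp add: algebra_simps)
  also have "\<dots> = swap_op x (y * z) X $$ ((v * z + w) * x + u, (v' * z + w') * x + u')"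
    using * by (intro swap_op_index[symmetric]) (auto intro: digit_less)
  finally show "swap_op x (y * z) X $$ ((v * z + w) * x + u, (v' * z + w') * x + u') =
    tens_id y (x * z) (z * x) 1 (swap_op x z) (tens_id 1 (x * y) (y * x) z (swap_op x y) X)
      $$ ((v * z + w) * x + u, (v' * z + w') * x + u')"
    by (simp add: algebra_simps)
qed (simp_all add: swap_op_def tens_id_def mult.assoc)

lemma swap_op_hexagon_left:
  "swap_op (x * y) z X =
    tens_id 1 (x * z) (z * x) y (swap_op x z) (tens_id x (y * z) (z * y) 1 (swap_op y z) X)"
proof (rule mat_digits_eqI[where l = z and n = x and r = y])
  fix w u v w' u' v' assume *: "v < y" "w < z" "u < x" "v' < y" "w' < z" "u' < x"
  have "tens_id 1 (x * z) (z * x) y (swap_op x z) (tens_id x (y * z) (z * y) 1 (swap_op y z) X)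
      $$ ((0 * (z * x) + (w * x + u)) * y + v, (0 * (z * x) + (w' * x + u')) * y + v') =
     tens_id x (y * z) (z * y) 1 (swap_op y z) X
      $$ ((0 * (x * z) + (u * z + w)) * y + v, (0 * (x * z) + (u' * z + w')) * y + v')"
    using * by (intro tens_id_swap_index) auto
  also have "\<dots> = tens_id x (y * z) (z * y) 1 (swap_op y z) X
      $$ ((u * (z * y) + (w * y + v)) * 1 + 0, (u' * (z * y) + (w' * y + v')) * 1 + 0)"
    by (simp add: algebra_simps)
  also have "\<dots> = X $$ ((u * (y * z) + (v * z + w)) * 1 + 0, (u' * (y * z) + (v' * z + w')) * 1 + 0)"
    using * by (intro tens_id_swap_index) auto
  also have "\<dots> = X $$ ((u * y + v) * z + w, (u' * y + v') * z + w')"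
    by (simp add: algebra_simps)
  also have "\<dots> = swap_op (x * y) z X $$ (w * (x * y) + (u * y + v), w' * (x * y) + (u' * y + v'))"
    using * by (intro swap_op_index[symmetric]) (auto intro: digit_less)
  finally show "swap_op (x * y) z X $$ ((w * x + u) * y + v, (w' * x + u') * y + v') =
    tens_id 1 (x * z) (z * x) y (swap_op x z) (tens_id x (y * z) (z * y) 1 (swap_op y z) X)
      $$ ((w * x + u) * y + v, (w' * x + u') * y + v')"
    by (simp add: algebra_simps)
qed (simp_all add: swap_op_def tens_id_def mult.assoc)

lemma tens_id_id:
  assumes "X \<in> carrier_mat (l * m * r) (l * m * r)"
  shows "tens_id l m m r id X = X"
  by (rule mat_digits_eqI) (use assms in \<open>auto simp: tens_id_carrier tens_id_index\<close>)

lemma tens_id_cong: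
  assumes "\<And>Y. Y \<in> carrier_mat m m \<Longrightarrow> \<Phi> Y = \<Psi> Y"
  shows "tens_id l m n r \<Phi> X = tens_id l m n r \<Psi> X"
  unfolding tens_id_def by (rule cong_mat) (auto simp: assms)

lemma tens_id_trivial:
  assumes "X \<in> carrier_mat m m" "\<Phi> X \<in> carrier_mat n n"
  shows "tens_id 1 m n 1 \<Phi> X = \<Phi> X"
proof -
  have "mat m m (\<lambda>(u, v). X $$ (u, v)) = X" using assms by (intro eq_matI) auto
  then show ?thesis unfolding tens_id_def using assms
    by (intro eq_matI) auto
qed

lemma swap_op_trivial:
  assumes "X \<in> carrier_mat m m"
  shows "swap_op 1 m X = X" "swap_op m 1 X = X"
  using assms by (auto simp: swap_op_def intro!: eq_matI)

lemma tens_id_swap_swap: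
  assumes "X \<in> carrier_mat (l * (x * y) * r) (l * (x * y) * r)"
  shows "tens_id l (y * x) (x * y) r (swap_op y x) (tens_id l (x * y) (y * x) r (swap_op x y) X) = X"
proof -
  have "tens_id l (y * x) (x * y) r (swap_op y x) (tens_id l (x * y) (y * x) r (swap_op x y) X) =
    tens_id l (x * y) (x * y) r (swap_op y x \<circ> swap_op x y) X"
    by (rule tens_id_comp) (rule swap_op_carrier)
  also have "\<dots> = tens_id l (x * y) (x * y) r id X"
    by (rule tens_id_cong) (simp add: swap_op_swap_op)
  finally show ?thesis using assms by (simp add: tens_id_id)
qed

text \<open>Dimensions occur in several bracketings and orders that agree only by arithmetic, so
  they are matched by equations instead of syntactically.\<close>

lemma tens_id_nest':
  assumes "M = l * m * r" "N = l * n * r" "L = l' * l" "R = r * r'"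
  shows "tens_id l' M N r' (tens_id l m n r \<Phi>) X = tens_id L m n R \<Phi> X"
  unfolding assms by (rule tens_id_nest)

section \<open>Positivity and channels\<close>

lemma sum_digits: "(\<Sum>i<l * n. f i) = (\<Sum>p<l. \<Sum>u<n. f (p * n + u))" for l n :: nat and f :: "nat \<Rightarrow> 'a::comm_monoid_add"
proof -
  have "sum f {p * n..<p * n + n} = (\<Sum>u<n. f (p * n + u))" for p
    using sum.shift_bounds_nat_ivl[of f 0 "p * n" n] by (simp add: add.commute atLeast0LessThan)
  then show ?thesis by (simp flip: sum.nat_group)
qed

text \<open>With test vectors as functions, the quadratic form can be reindexed along a bijection
  and split into digits by \<open>sum_digits\<close>.\<close>

lemma psd_iff:
  "psd m X \<longleftrightarrow> X \<in> carrier_mat m m \<and>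
    (\<forall>v :: nat \<Rightarrow> complex. 0 \<le> (\<Sum>i<m. \<Sum>j<m. X $$ (i, j) * v j * cnj (v i)))"
proof -
  have eq: "(X *\<^sub>v v) \<bullet>c v = (\<Sum>i<m. \<Sum>j<m. X $$ (i, j) * v $ j * cnj (v $ i))"
    if "X \<in> carrier_mat m m" "v \<in> carrier_vec m" for v :: "complex vec"
    using that by (auto simp: scalar_prod_def sum_distrib_right atLeast0LessThan intro!: sum.cong)
  have "0 \<le> (\<Sum>i<m. \<Sum>j<m. X $$ (i, j) * v j * cnj (v i))"
    if "psd m X" for v :: "nat \<Rightarrow> complex"
  proof -
    have "(\<Sum>i<m. \<Sum>j<m. X $$ (i, j) * v j * cnj (v i)) = (X *\<^sub>v vec m v) \<bullet>c vec m v"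
      using that by (subst eq) (auto simp: psd_def)
    then show ?thesis using that by (auto simp: psd_def)
  qed
  then show ?thesis by (auto simp: psd_def eq)
qed

lemma psd_reindex:
  assumes X: "psd m X" and bij: "bij_betw f {..<n} {..<m}"
    and Y: "Y \<in> carrier_mat n n" "\<And>i j. i < n \<Longrightarrow> j < n \<Longrightarrow> Y $$ (i, j) = X $$ (f i, f j)"
  shows "psd n Y"
  unfolding psd_iff
proof (intro conjI allI)
  fix v :: "nat \<Rightarrow> complex"
  let ?g = "inv_into {..<n} f"
  have inv: "?g (f i) = i" if "i < n" for i
    using bij that by (simp add: bij_betw_def)
  have "0 \<le> (\<Sum>i<m. \<Sum>j<m. X $$ (i, j) * v (?g j) * cnj (v (?g i)))"
    using X unfolding psd_iff by (elim conjE allE)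
  also have "\<dots> = (\<Sum>i<n. \<Sum>j<n. X $$ (f i, f j) * v (?g (f j)) * cnj (v (?g (f i))))"
    by (simp only: sum.reindex_bij_betw[OF bij, symmetric])
  also have "\<dots> = (\<Sum>i<n. \<Sum>j<n. Y $$ (i, j) * v j * cnj (v i))"
    by (intro sum.cong) (auto simp: inv Y)
  finally show "0 \<le> (\<Sum>i<n. \<Sum>j<n. Y $$ (i, j) * v j * cnj (v i))" .
qed (use Y in auto)

text \<open>A single permutation \<open>f\<close> of the basis serves for all \<open>X\<close>.
  Positivity and trace preservation of the swap thereby reduce to reindexing sums.\<close>

lemma tens_id_swap_bij:
  obtains f where "bij_betw f {..<y * x * r} {..<x * y * r}"
    "\<And>i j X. i < y * x * r \<Longrightarrow> j < y * x * r \<Longrightarrow>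
      tens_id 1 (x * y) (y * x) r (swap_op x y) X $$ (i, j) = X $$ (f i, f j)"
proof
  let ?f = "\<lambda>x y i. (i div r mod x * y + i div r div x) * r + i mod r"
  have f: "?f x y ((v * x + u) * r + q) = (u * y + v) * r + q" if "u < x" "q < r" for v u q x y
    using that by simp
  show "bij_betw (?f x y) {..<y * x * r} {..<x * y * r}"
  proof (rule bij_betw_byWitness[where f' = "?f y x"])
    show "\<forall>i\<in>{..<y * x * r}. ?f y x (?f x y i) = i"
      by (auto elim!: digit_cases simp: f)
    show "\<forall>i\<in>{..<x * y * r}. ?f x y (?f y x i) = i"
      by (auto elim!: digit_cases simp: f)
    show "?f x y ` {..<y * x * r} \<subseteq> {..<x * y * r}" "?f y x ` {..<x * y * r} \<subseteq> {..<y * x * r}"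
      by (auto elim!: digit_cases simp: f digit3_less)
  qed
  fix i j X assume "i < y * x * r" "j < y * x * r"
  then obtain v u q v' u' q' where *: "v < y" "u < x" "q < r" "i = (v * x + u) * r + q"
    "v' < y" "u' < x" "q' < r" "j = (v' * x + u') * r + q'"
    by (metis digit_cases)
  show "tens_id 1 (x * y) (y * x) r (swap_op x y) X $$ (i, j) = X $$ (?f x y i, ?f x y j)"
    unfolding * using tens_id_swap_index[of 0 1 v y u x q r 0 v' u' q' X] *(1-3,5-7) by (simp add: f)
qed

lemma psd_tens_id_swap:
  assumes "psd (x * y * r) X"
  shows "psd (y * x * r) (tens_id 1 (x * y) (y * x) r (swap_op x y) X)"
  by (rule tens_id_swap_bij, rule psd_reindex[OF assms])
    (use tens_id_carrier[of 1 "x * y" "y * x" r] in auto)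

lemma psd_swap_op:
  assumes "psd (x * y) X"
  shows "psd (y * x) (swap_op x y X)"
  using psd_tens_id_swap[of x y 1 X] assms tens_id_trivial[of X "x * y" "swap_op x y" "y * x"]
  by (simp add: psd_def swap_op_carrier)

lemma channel_swap_op:
  assumes "0 < x" "0 < y"
  shows "channel (x * y) (y * x) (swap_op x y)"
  unfolding channel_def
proof (intro conjI ballI allI impI)
  fix X :: "complex mat" assume X: "X \<in> carrier_mat (x * y) (x * y)"
  obtain f where f: "bij_betw f {..<y * x * 1} {..<x * y * 1}"
    "\<And>i j X. i < y * x * 1 \<Longrightarrow> j < y * x * 1 \<Longrightarrow>
      tens_id 1 (x * y) (y * x) 1 (swap_op x y) X $$ (i, j) = X $$ (f i, f j)"
    by (rule tens_id_swap_bij[of y x 1]) blast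
  have f2: "swap_op x y X $$ (i, i) = X $$ (f i, f i)" if "i < y * x" for i
    using f(2)[of i i X, unfolded tens_id_trivial[where \<Phi> = "swap_op x y", OF X swap_op_carrier]] that by simp
  have "tr (swap_op x y X) = (\<Sum>i<y * x. X $$ (f i, f i))"
    unfolding tr_def using f2 swap_op_carrier[of x y X] by (intro sum.cong) auto
  also have "\<dots> = (\<Sum>i<x * y. X $$ (i, i))"
    using f(1) by (intro sum.reindex_bij_betw) auto
  finally show "tr (swap_op x y X) = tr X" using X by (simp add: tr_def)
next
  fix X Y :: "complex mat" assume XY: "X \<in> carrier_mat (x * y) (x * y)" "Y \<in> carrier_mat (x * y) (x * y)"
  show "swap_op x y (X + Y) = swap_op x y X + swap_op x y Y"
    by (rule mat_digits2_eqI[of _ y x])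
      (use XY in \<open>auto simp: swap_op_carrier swap_op_index digit_less, auto simp: swap_op_def digit_less\<close>)
next
  fix c :: complex and X :: "complex mat" assume X: "X \<in> carrier_mat (x * y) (x * y)"
  show "swap_op x y (c \<cdot>\<^sub>m X) = c \<cdot>\<^sub>m swap_op x y X"
    by (rule mat_digits2_eqI[of _ y x])
      (use X in \<open>auto simp: swap_op_carrier swap_op_index digit_less, auto simp: swap_op_def digit_less\<close>)
qed (use assms in \<open>auto simp: swap_op_carrier psd_tens_id_swap[simplified]\<close>)

lemma channelD:
  assumes "channel m n \<Phi>"
  shows "0 < m" "\<And>X. X \<in> carrier_mat m m \<Longrightarrow> \<Phi> X \<in> carrier_mat n n"
    "\<And>X Y. X \<in> carrier_mat m m \<Longrightarrow> Y \<in> carrier_mat m m \<Longrightarrow> \<Phi> (X + Y) = \<Phi> X + \<Phi> Y"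
    "\<And>c X. X \<in> carrier_mat m m \<Longrightarrow> \<Phi> (c \<cdot>\<^sub>m X) = c \<cdot>\<^sub>m \<Phi> X"
    "\<And>r X. psd (m * r) X \<Longrightarrow> psd (n * r) (tens_id 1 m n r \<Phi> X)"
    "\<And>X. X \<in> carrier_mat m m \<Longrightarrow> tr (\<Phi> X) = tr X"
  using assms unfolding channel_def by blast+

text \<open>The image of the identity has trace \<open>m > 0\<close>, which is impossible in
  dimension zero.\<close>

lemma channel_pos:
  assumes "channel m n \<Phi>"
  shows "0 < m" "0 < n"
proof -
  show "0 < m" using channelD(1)[OF assms] .
  have "tr (\<Phi> (1\<^sub>m m)) = of_nat m" "\<Phi> (1\<^sub>m m) \<in> carrier_mat n n"
    using channelD(6)[OF assms, of "1\<^sub>m m"] channelD(2)[OF assms, of "1\<^sub>m m"] by (auto simp: tr_def)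
  then show "0 < n" using \<open>0 < m\<close> by (cases n) (auto simp: tr_def)
qed

lemma channel_comp:
  assumes "channel m n \<Phi>" "channel n l \<Psi>"
  shows "channel m l (\<Psi> \<circ> \<Phi>)"
  unfolding channel_def
proof (intro conjI ballI allI impI)
  fix r X assume "psd (m * r) X"
  then have "psd (l * r) (tens_id 1 n l r \<Psi> (tens_id 1 m n r \<Phi> X))"
    using assms by (auto dest: channelD(5))
  then show "psd (l * r) (tens_id 1 m l r (\<Psi> \<circ> \<Phi>) X)"
    using channelD(2)[OF assms(1)] by (simp add: tens_id_comp)
qed (use channelD[OF assms(1)] channelD[OF assms(2)] in auto)

lemma channel_cong:
  assumes "channel m n \<Phi>" "\<And>X. X \<in> carrier_mat m m \<Longrightarrow> \<Psi> X = \<Phi> X"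
  shows "channel m n \<Psi>"
proof -
  have "tens_id 1 m n r \<Psi> X = tens_id 1 m n r \<Phi> X" for r X
    using assms(2) by (rule tens_id_cong)
  then show ?thesis using assms unfolding channel_def by simp
qed

lemma channel_id: "0 < m \<Longrightarrow> channel m m id"
  unfolding channel_def by (auto simp: psd_def tens_id_id[of _ 1 m, simplified])

text \<open>Complete positivity in \<open>channel\<close> is stated for a reference on the right. A
  left reference is swapped to the right end, and swapped back afterwards.\<close>

lemma psd_tens_id:
  assumes \<Phi>: "channel m n \<Phi>" and X: "psd (l * m * r) X"
  shows "psd (l * n * r) (tens_id l m n r \<Phi> X)"
proof -
  let ?Y = "tens_id l m n r \<Phi> X"
  have "psd (m * (r * l)) (swap_op l (m * r) X)"
    using psd_swap_op[of l "m * r" X] X by (simp add: mult.assoc)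
  then have "psd (n * r * l) (tens_id 1 m n (r * l) \<Phi> (swap_op l (m * r) X))"
    using channelD(5)[OF \<Phi>] by (simp add: mult.assoc)
  also have "tens_id 1 m n (r * l) \<Phi> (swap_op l (m * r) X) =
      tens_id 1 (m * r) (n * r) l (tens_id 1 m n r \<Phi>) (swap_op l (m * r) X)"
    using tens_id_nest[of 1 1 m r n l \<Phi>] by simp
  also have "\<dots> = swap_op l (n * r) (tens_id l (m * r) (n * r) 1 (tens_id 1 m n r \<Phi>) X)"
    by (rule swap_op_tens_id_right[symmetric])
  also have "tens_id l (m * r) (n * r) 1 (tens_id 1 m n r \<Phi>) X = ?Y"
    using tens_id_nest[of l 1 m r n 1 \<Phi>] by simp
  finally have "psd (l * (n * r)) (swap_op (n * r) l (swap_op l (n * r) ?Y))"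
    by (rule psd_swap_op)
  then show ?thesis
    using swap_op_swap_op[of ?Y l "n * r"] tens_id_carrier[of l m n r \<Phi> X] by (simp add: mult.assoc)
qed

lemma tr_digits3:
  assumes "X \<in> carrier_mat (l * n * r) (l * n * r)"
  shows "tr X = (\<Sum>p<l. \<Sum>q<r. \<Sum>u<n. X $$ ((p * n + u) * r + q, (p * n + u) * r + q))"
proof -
  have "tr X = (\<Sum>p<l. \<Sum>u<n. \<Sum>q<r. X $$ ((p * n + u) * r + q, (p * n + u) * r + q))"
    using assms by (simp add: tr_def sum_digits)
  also have "\<dots> = (\<Sum>p<l. \<Sum>q<r. \<Sum>u<n. X $$ ((p * n + u) * r + q, (p * n + u) * r + q))"
    by (intro sum.cong refl sum.swap)
  finally show ?thesis .
qed

text \<open>Every block of the output is the image under \<open>\<Phi>\<close> of a block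
  \<open>?B\<close> of the input; this gives linearity and, for the diagonal blocks, the trace. For
  complete positivity the two right references are merged, and \<open>psd_tens_id\<close>
  applies.\<close>

lemma channel_tens_id:
  assumes \<Phi>: "channel m n \<Phi>" and pos: "0 < l" "0 < r"
  shows "channel (l * m * r) (l * n * r) (tens_id l m n r \<Phi>)"
  unfolding channel_def
proof (intro conjI ballI allI impI)
  show "0 < l * m * r" using pos channelD(1)[OF \<Phi>] by simp
  show "tens_id l m n r \<Phi> X \<in> carrier_mat (l * n * r) (l * n * r)" for X
    by (rule tens_id_carrier)
  fix X :: "complex mat" assume X: "X \<in> carrier_mat (l * m * r) (l * m * r)"
  let ?B = "\<lambda>X p q p' q'. mat m m (\<lambda>(v, v'). X $$ ((p * m + v) * r + q, (p' * m + v') * r + q')) :: complex mat"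
  have B: "?B X p q p' q' \<in> carrier_mat m m" for X p q p' q' by simp
  have \<Phi>B: "dim_row (\<Phi> (?B X p q p' q')) = n" "dim_col (\<Phi> (?B X p q p' q')) = n" for X p q p' q'
    using channelD(2)[OF \<Phi> B[of X p q p' q']] by auto
  show "tr (tens_id l m n r \<Phi> X) = tr X"
  proof -
    have "(\<Sum>u<n. tens_id l m n r \<Phi> X $$ ((p * n + u) * r + q, (p * n + u) * r + q)) =
        (\<Sum>u<m. X $$ ((p * m + u) * r + q, (p * m + u) * r + q))" if "p < l" "q < r" for p q
    proof -
      have "(\<Sum>u<n. tens_id l m n r \<Phi> X $$ ((p * n + u) * r + q, (p * n + u) * r + q)) =
          tr (\<Phi> (?B X p q p q))"
        using that by (simp add: tens_id_index tr_def \<Phi>B)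
      also have "\<dots> = tr (?B X p q p q)" by (rule channelD(6)[OF \<Phi> B])
      finally show ?thesis by (simp add: tr_def)
    qed
    then show ?thesis by (simp add: tr_digits3[OF X] tr_digits3[OF tens_id_carrier])
  qed
  show "tens_id l m n r \<Phi> (c \<cdot>\<^sub>m X) = c \<cdot>\<^sub>m tens_id l m n r \<Phi> X" for c
  proof (rule mat_digits_eqI)
    fix p u q p' u' q' assume *: "p < l" "u < n" "q < r" "p' < l" "u' < n" "q' < r"
    have "?B (c \<cdot>\<^sub>m X) p q p' q' = c \<cdot>\<^sub>m ?B X p q p' q'"
      using * X by (intro eq_matI) (auto simp: digit3_less)
    then have "tens_id l m n r \<Phi> (c \<cdot>\<^sub>m X) $$ ((p * n + u) * r + q, (p' * n + u') * r + q') =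
        (c \<cdot>\<^sub>m \<Phi> (?B X p q p' q')) $$ (u, u')"
      using * by (simp add: tens_id_index channelD(4)[OF \<Phi> B])
    also have "\<dots> = (c \<cdot>\<^sub>m tens_id l m n r \<Phi> X) $$ ((p * n + u) * r + q, (p' * n + u') * r + q')"
      using * tens_id_carrier[of l m n r \<Phi> X] by (simp add: digit3_less tens_id_index \<Phi>B carrier_matD)
    finally show "tens_id l m n r \<Phi> (c \<cdot>\<^sub>m X) $$ ((p * n + u) * r + q, (p' * n + u') * r + q') =
       (c \<cdot>\<^sub>m tens_id l m n r \<Phi> X) $$ ((p * n + u) * r + q, (p' * n + u') * r + q')" .
  qed (simp_all add: tens_id_carrier)
  fix Y :: "complex mat" assume Y: "Y \<in> carrier_mat (l * m * r) (l * m * r)"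
  show "tens_id l m n r \<Phi> (X + Y) = tens_id l m n r \<Phi> X + tens_id l m n r \<Phi> Y"
  proof (rule mat_digits_eqI)
    fix p u q p' u' q' assume *: "p < l" "u < n" "q < r" "p' < l" "u' < n" "q' < r"
    have "?B (X + Y) p q p' q' = ?B X p q p' q' + ?B Y p q p' q'"
      using * X Y by (intro eq_matI) (auto simp: digit3_less)
    then have "tens_id l m n r \<Phi> (X + Y) $$ ((p * n + u) * r + q, (p' * n + u') * r + q') =
        (\<Phi> (?B X p q p' q') + \<Phi> (?B Y p q p' q')) $$ (u, u')"
      using * by (simp add: tens_id_index channelD(3)[OF \<Phi> B B])
    also have "\<dots> = (tens_id l m n r \<Phi> X + tens_id l m n r \<Phi> Y) $$ ((p * n + u) * r + q, (p' * n + u') * r + q')"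
      using * tens_id_carrier[of l m n r \<Phi> X] tens_id_carrier[of l m n r \<Phi> Y]
      by (simp add: digit3_less tens_id_index \<Phi>B carrier_matD)
    finally show "tens_id l m n r \<Phi> (X + Y) $$ ((p * n + u) * r + q, (p' * n + u') * r + q') =
       (tens_id l m n r \<Phi> X + tens_id l m n r \<Phi> Y) $$ ((p * n + u) * r + q, (p' * n + u') * r + q')" .
  qed (simp_all add: tens_id_carrier)
next
  fix r' X assume "psd (l * m * r * r') X"
  then have "psd (l * n * (r * r')) (tens_id l m n (r * r') \<Phi> X)"
    by (intro psd_tens_id[OF \<Phi>]) (simp add: mult.assoc)
  then show "psd (l * n * r * r') (tens_id 1 (l * m * r) (l * n * r) r' (tens_id l m n r \<Phi>) X)"
    using tens_id_nest[of 1 l m r n r' \<Phi> X] by (simp add: mult.assoc)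
qed

lemma state_channel:
  assumes "channel m n \<Phi>" "state m \<rho>"
  shows "state n (\<Phi> \<rho>)"
proof -
  have "\<rho> \<in> carrier_mat m m" using assms by (simp add: state_def psd_def)
  note \<rho> = this
  have "tens_id 1 m n 1 \<Phi> \<rho> = \<Phi> \<rho>"
    using \<rho> channelD(2)[OF assms(1) \<rho>] by (rule tens_id_trivial)
  moreover have "tr (\<Phi> \<rho>) = tr \<rho>"
    using channelD(6)[OF assms(1) \<rho>] .
  ultimately show ?thesis using channelD(5)[OF assms(1), of 1 \<rho>] assms(2) by (simp add: state_def)
qed

section \<open>Rank-one decomposition and complete positivity of a binary measurement\<close>

lemma psd_pivot:
  fixes E :: "nat \<Rightarrow> nat \<Rightarrow> complex"
  assumes psd: "\<And>v :: nat \<Rightarrow> complex. 0 \<le> (\<Sum>i<n. \<Sum>j<n. E i j * v j * cnj (v i))"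
    and ij: "i < n" "j < n"
  shows "0 \<le> E i i" "E j i = cnj (E i j)" "E i i = 0 \<Longrightarrow> E j i = 0"
proof -
  have single: "(\<Sum>x<n. \<Sum>y<n. E x y * (if y = k then d else 0) * cnj (if x = l then e else 0)) = E l k * d * cnj e"
    if "k < n" "l < n" for k l d e
  proof -
    have "(\<Sum>x<n. \<Sum>y<n. E x y * (if y = k then d else 0) * cnj (if x = l then e else 0)) =
      (\<Sum>x<n. \<Sum>y<n. if y = k then (if x = l then E x y * d * cnj e else 0) else 0)"
      by (intro sum.cong) auto
    also have "\<dots> = E l k * d * cnj e" using that by simp
    finally show ?thesis .
  qed
  have diag: "0 \<le> E i i" if "i < n" for i
    using psd[of "\<lambda>k. if k = i then 1 else 0"] single[OF that that, of 1 1] by simp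
  show "0 \<le> E i i" using ij by (intro diag)
  \<comment> \<open>The form is tested at \<open>e_j + c e_i\<close>. The values 1 and \<i> of
    \<open>c\<close> show that \<open>E\<close> is Hermitian, and multiples of \<open>E i j\<close>
    show that a zero on the diagonal makes its column vanish.\<close>
  have two: "0 \<le> E j j + E j i * c + E i j * cnj c + E i i * c * cnj c" for c
  proof -
    have "(\<Sum>x<n. \<Sum>y<n. E x y * ((if y = j then 1 else 0) + (if y = i then c else 0)) *
        cnj ((if x = j then 1 else 0) + (if x = i then c else 0))) =
      (\<Sum>x<n. \<Sum>y<n. E x y * (if y = j then 1 else 0) * cnj (if x = j then 1 else 0)) +
      (\<Sum>x<n. \<Sum>y<n. E x y * (if y = i then c else 0) * cnj (if x = j then 1 else 0)) +
      (\<Sum>x<n. \<Sum>y<n. E x y * (if y = j then 1 else 0) * cnj (if x = i then c else 0)) +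
      (\<Sum>x<n. \<Sum>y<n. E x y * (if y = i then c else 0) * cnj (if x = i then c else 0))"
      by (simp only: distrib_left distrib_right complex_cnj_add sum.distrib add_ac)
    also have "\<dots> = E j j + E j i * c + E i j * cnj c + E i i * c * cnj c"
      using ij by (simp only: single) simp
    finally show ?thesis
      using psd[of "\<lambda>y. (if y = j then 1 else 0) + (if y = i then c else 0)"] by simp
  qed
  have im: "Im (E i i) = 0" "Im (E j j) = 0" using diag[of i] diag[of j] ij by (auto simp: less_eq_complex_def)
  show herm: "E j i = cnj (E i j)"
    using two[of 1] two[of \<i>] im by (auto simp: less_eq_complex_def complex_eq_iff)
  assume zero: "E i i = 0"
  define s where "s = (Re (E i j))\<^sup>2 + (Im (E i j))\<^sup>2"
  have "0 \<le> Re (E j j) - 2 * t * s" for t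
    using two[of "- (complex_of_real t) * E i j"] unfolding herm zero s_def
    by (simp add: less_eq_complex_def power2_eq_square algebra_simps)
  \<comment> \<open>For nonzero \<open>s\<close> this value of \<open>t\<close> would turn the
    nonnegative expression into -1.\<close>
  from this[of "(Re (E j j) + 1) / (2 * s)"] have "s = 0" by (cases "s = 0") auto
  then have "E i j = 0" by (simp add: s_def complex_eq_iff sum_power2_eq_zero_iff)
  then show "E j i = 0" by (simp add: herm)
qed

text \<open>Cholesky factorisation, with one rank-one term for each index eliminated. It is applied
  to the effects of a POVM in \<open>channel_measurement\<close>.\<close>

lemma psd_sum_rank_one:
  fixes E :: "nat \<Rightarrow> nat \<Rightarrow> complex"
  assumes "\<And>v :: nat \<Rightarrow> complex. 0 \<le> (\<Sum>i<n. \<Sum>j<n. E i j * v j * cnj (v i))"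
  shows "\<exists>y. \<forall>i<n. \<forall>j<n. E i j = (\<Sum>l<n. y l i * cnj (y l j))"
  using assms
proof (induction n arbitrary: E)
  case (Suc n)
  \<comment> \<open>Eliminates the last index as in the Cholesky factorisation; if \<open>d = 0\<close>, then the last row and
    column vanish and the division by \<open>d\<close> yields \<open>E' = E\<close>.\<close>
  define d where "d = E n n"
  define E' where "E' i j = E i j - E i n * E n j / d" for i j
  have d: "0 \<le> d" unfolding d_def by (rule psd_pivot(1)[OF Suc.prems, of n n]) auto
  have herm: "cnj (E n i) = E i n" if "i \<le> n" for i
    by (rule psd_pivot(2)[OF Suc.prems, of n i, symmetric]) (use that in auto)
  have zero: "E i n = 0" if "i \<le> n" "d = 0" for i
    by (rule psd_pivot(3)[OF Suc.prems, of n i]) (use that in \<open>auto simp: d_def\<close>)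
  have herm': "cnj (E i n) = E n i" if "i \<le> n" for i
    using herm[OF that] by (metis complex_cnj_cnj)
  have zero': "E n i = 0" if "i \<le> n" "d = 0" for i
    using herm'[OF that(1)] zero[OF that] by simp
  have cd: "cnj d = d" using d by (simp add: less_eq_complex_def complex_eq_iff)
  have "0 \<le> (\<Sum>i<n. \<Sum>j<n. E' i j * v j * cnj (v i))" for v :: "nat \<Rightarrow> complex"
  proof -
    define s where "s = (\<Sum>j<n. E n j * v j)"
    have cs: "cnj s = (\<Sum>i<n. E i n * cnj (v i))" unfolding s_def by (simp add: herm)
    \<comment> \<open>The last coordinate completes the square, so that the form of \<open>E\<close>
      at \<open>w\<close> becomes the form of the Schur complement \<open>E'\<close> at
      \<open>v\<close>.\<close>
    define w where "w = v(n := - s / d)"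
    have "(\<Sum>i<Suc n. \<Sum>j<Suc n. E i j * w j * cnj (w i)) =
      (\<Sum>i<n. (\<Sum>j<n. E i j * v j * cnj (v i)) + E i n * (- s / d) * cnj (v i)) +
        ((\<Sum>j<n. E n j * v j * cnj (- s / d)) + d * (- s / d) * cnj (- s / d))"
      by (simp add: w_def d_def)
    also have "\<dots> = (\<Sum>i<n. \<Sum>j<n. E i j * v j * cnj (v i)) + cnj s * (- s / d) +
       (s * cnj (- s / d) + d * (- s / d) * cnj (- s / d))"
    proof -
      have "(\<Sum>i<n. E i n * (- s / d) * cnj (v i)) = cnj s * (- s / d)"
        unfolding cs sum_distrib_right by (intro sum.cong) auto
      moreover have "(\<Sum>j<n. E n j * v j * c) = s * c" for c
        unfolding s_def sum_distrib_right ..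
      ultimately show ?thesis by (simp only: sum.distrib)
    qed
    also have "\<dots> = (\<Sum>i<n. \<Sum>j<n. E i j * v j * cnj (v i)) - cnj s * s / d"
      by (cases "d = 0") (simp_all add: cd)
    also have "cnj s * s / d = (\<Sum>i<n. \<Sum>j<n. E i n * E n j / d * v j * cnj (v i))"
      unfolding cs unfolding s_def sum_product sum_divide_distrib by (intro sum.cong) auto
    also have "(\<Sum>i<n. \<Sum>j<n. E i j * v j * cnj (v i)) - \<dots> = (\<Sum>i<n. \<Sum>j<n. E' i j * v j * cnj (v i))"
      by (simp add: E'_def left_diff_distrib sum_subtractf)
    finally show ?thesis using Suc.prems[of w] by simp
  qed
  then obtain y where y: "\<And>i j. i < n \<Longrightarrow> j < n \<Longrightarrow> E' i j = (\<Sum>l<n. y l i * cnj (y l j))"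
    using Suc.IH[of E'] by blast
  \<comment> \<open>The new vector is the last column of \<open>E\<close> scaled by the root of the
    pivot, and the old vectors are extended by 0. If \<open>d = 0\<close>, division by zero makes
    the new vector vanish.\<close>
  define z where "z l i = (if l = n then E i n / csqrt d else if i = n then 0 else y l i)" for l i
  have csq: "csqrt d * cnj (csqrt d) = d"
  proof -
    obtain x where x: "d = complex_of_real x" "0 \<le> x"
      using d by (intro that[of "Re d"]) (auto simp: less_eq_complex_def complex_eq_iff)
    then have "csqrt d = complex_of_real (sqrt x)" by simp
    then show ?thesis using x by (simp flip: of_real_mult)
  qed
  have "E i j = (\<Sum>l<Suc n. z l i * cnj (z l j))" if "i < Suc n" "j < Suc n" for i j
  proof -
    have top: "z n i * cnj (z n j) = E i n * E n j / d"
    proof -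
      have "z n i * cnj (z n j) = E i n * cnj (E j n) / (csqrt d * cnj (csqrt d))"
        by (simp add: z_def)
      then show ?thesis using herm'[of j] that by (simp only: csq less_Suc_eq_le)
    qed
    show ?thesis
    proof (cases "i < n \<and> j < n")
      case True
      then have "(\<Sum>l<n. z l i * cnj (z l j)) = E' i j" by (auto simp: y z_def)
      then show ?thesis by (simp add: top E'_def)
    next
      case False
      then have n: "i = n \<or> j = n" using that by auto
      then have "(\<Sum>l<n. z l i * cnj (z l j)) = 0" by (intro sum.neutral) (auto simp: z_def)
      moreover have "E i j = E i n * E n j / d"
      proof (cases "d = 0")
        case True
        have "E i j = 0"
          using n
        proof
          assume "i = n" then show ?thesis using zero'[of j] True that by simp
        next
          assume "j = n" then show ?thesis using zero[of i] True that by simp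
        qed
        then show ?thesis using zero[of i] True that by simp
      next
        case False
        show ?thesis
          using n
        proof
          assume "i = n" then show ?thesis using False by (simp flip: d_def)
        next
          assume "j = n" then show ?thesis using False by (simp flip: d_def)
        qed
      qed
      ultimately show ?thesis by (simp add: top)
    qed
  qed
  then show ?case by blast
qed simp

lemma channel_measurement:
  assumes E: "psd m (E 0)" "psd m (E 1)" and sum: "E 0 + E 1 = 1\<^sub>m m" and m: "0 < m"
  shows "channel m 2 (\<lambda>X. mat_diag 2 (\<lambda>e. tr (E e * X)))"
  unfolding channel_def
proof (intro conjI ballI allI impI)
  have EC: "E e \<in> carrier_mat m m" if "e < 2" for e
    using E that by (auto simp: psd_def less_2_cases_iff)
  have trE: "tr (E e * X) = (\<Sum>i<m. \<Sum>j<m. E e $$ (i, j) * X $$ (j, i))"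
    if "e < 2" "X \<in> carrier_mat m m" for e X
    using EC[OF that(1)] that(2) by (auto simp: tr_def scalar_prod_def atLeast0LessThan intro!: sum.cong)
  fix X :: "complex mat" assume X: "X \<in> carrier_mat m m"
  have dg: "mat_diag 2 f = mat_diag 2 g" if "\<And>e. e < 2 \<Longrightarrow> f e = g e" for f g :: "nat \<Rightarrow> complex"
    using that unfolding mat_diag_def by (intro cong_mat) auto
  show "mat_diag 2 (\<lambda>e. tr (E e * (c \<cdot>\<^sub>m X))) = c \<cdot>\<^sub>m mat_diag 2 (\<lambda>e. tr (E e * X))" for c
  proof -
    have "tr (E e * (c \<cdot>\<^sub>m X)) = c * tr (E e * X)" if "e < 2" for e
      using X that by (simp add: trE sum_distrib_left ac_simps)
    then show ?thesis by (auto simp: mat_diag_def intro!: eq_matI)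
  qed
  have tr_mat_diag: "tr (mat_diag 2 f) = f 0 + f 1" for f :: "nat \<Rightarrow> complex"
    by (simp add: tr_def mat_diag_def numeral_2_eq_2)
  have "E 0 $$ (i, j) + E 1 $$ (i, j) = (if i = j then 1 else 0)" if "i < m" "j < m" for i j
  proof -
    have "(E 0 + E 1) $$ (i, j) = (if i = j then 1 else 0)" unfolding sum using that by simp
    then show ?thesis using EC[of 1] that by simp
  qed
  then have "tr (E 0 * X) + tr (E 1 * X) = (\<Sum>i<m. \<Sum>j<m. (if i = j then 1 else 0) * X $$ (j, i))"
    using X by (simp add: trE flip: sum.distrib distrib_right)
  also have "\<dots> = (\<Sum>i<m. \<Sum>j<m. if i = j then X $$ (j, i) else 0)"
    by (intro sum.cong) auto
  also have "\<dots> = tr X" using X by (simp add: tr_def)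
  finally show "tr (mat_diag 2 (\<lambda>e. tr (E e * X))) = tr X" by (simp add: tr_mat_diag)
  fix Y :: "complex mat" assume Y: "Y \<in> carrier_mat m m"
  have "tr (E e * (X + Y)) = tr (E e * X) + tr (E e * Y)" if "e < 2" for e
    using X Y that by (simp add: trE sum.distrib distrib_left)
  then show "mat_diag 2 (\<lambda>e. tr (E e * (X + Y))) = mat_diag 2 (\<lambda>e. tr (E e * X)) + mat_diag 2 (\<lambda>e. tr (E e * Y))"
    by (auto simp: mat_diag_def intro!: eq_matI)
next
  let ?M = "\<lambda>X. mat_diag 2 (\<lambda>e. tr (E e * X))"
  fix r X assume X: "psd (m * r) X"
  have EC: "E e \<in> carrier_mat m m" if "e < 2" for e
    using E that by (auto simp: psd_def less_2_cases_iff)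
  have psdE: "psd m (E e)" if "e < 2" for e using E that by (auto simp: less_2_cases_iff)
  show "psd (2 * r) (tens_id 1 m 2 r ?M X)"
    unfolding psd_iff
  proof (intro conjI allI)
    fix v :: "nat \<Rightarrow> complex"
    let ?x = "\<lambda>i q j q'. X $$ (i * r + q, j * r + q')"
    \<comment> \<open>Blocks belonging to different outcomes vanish, so positivity can be checked
      for each outcome separately.\<close>
    have entry: "tens_id 1 m 2 r ?M X $$ (e * r + q, e' * r + q') =
        (if e = e' then \<Sum>i<m. \<Sum>j<m. E e $$ (i, j) * ?x j q i q' else 0)"
      if "e < 2" "e' < 2" "q < r" "q' < r" for e e' q q'
    proof -
      let ?B = "mat m m (\<lambda>(u, u'). X $$ (u * r + q, u' * r + q'))"
      have "tens_id 1 m 2 r ?M X $$ (e * r + q, e' * r + q') = (if e = e' then tr (E e * ?B) else 0)"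
        using tens_id_index[of 0 1 e 2 q r 0 e' q' m ?M X] that by (simp add: mat_diag_def)
      also have "tr (E e * ?B) = (\<Sum>i<m. \<Sum>j<m. E e $$ (i, j) * ?x j q i q')"
        using EC[OF that(1)] by (auto simp: tr_def scalar_prod_def atLeast0LessThan intro!: sum.cong)
      finally show ?thesis .
    qed
    have nonneg: "0 \<le> (\<Sum>q<r. \<Sum>q'<r. (\<Sum>i<m. \<Sum>j<m. E e $$ (i, j) * ?x j q i q') * v (e * r + q') * cnj (v (e * r + q)))"
      if e: "e < 2" for e
    proof -
      obtain y where y: "\<And>i j. i < m \<Longrightarrow> j < m \<Longrightarrow> E e $$ (i, j) = (\<Sum>l<m. y l i * cnj (y l j))"
        using psd_sum_rank_one[where n = m and E = "\<lambda>i j. E e $$ (i, j)"] psdE[OF e] unfolding psd_iff by blast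
      let ?g = "\<lambda>l q q' i j. (y l i * cnj (y l j)) * ?x j q i q' * v (e * r + q') * cnj (v (e * r + q))"
      have "(\<Sum>q<r. \<Sum>q'<r. (\<Sum>i<m. \<Sum>j<m. E e $$ (i, j) * ?x j q i q') * v (e * r + q') * cnj (v (e * r + q))) =
        (\<Sum>q<r. \<Sum>q'<r. \<Sum>i<m. \<Sum>j<m. \<Sum>l<m. ?g l q q' i j)"
        by (simp add: sum_distrib_right y)
      \<comment> \<open>The new order pairs \<open>j\<close> with \<open>q\<close> and
        \<open>i\<close> with \<open>q'\<close>, which are the digits of the row and the column
        index of \<open>X\<close>. For fixed \<open>l\<close> the sum is then the quadratic form of
        \<open>X\<close> at the product of \<open>y l\<close> with the part of \<open>v\<close> that
        belongs to outcome \<open>e\<close>.\<close>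
      also have "\<dots> = (\<Sum>l<m. \<Sum>j<m. \<Sum>q<r. \<Sum>i<m. \<Sum>q'<r. ?g l q q' i j)"
      proof -
        have "(\<Sum>q<r. \<Sum>q'<r. \<Sum>i<m. \<Sum>j<m. \<Sum>l<m. ?g l q q' i j) =
          (\<Sum>(q,q',i,j,l)\<in>{..<r}\<times>{..<r}\<times>{..<m}\<times>{..<m}\<times>{..<m}. ?g l q q' i j)"
          by (simp add: sum.cartesian_product split_def)
        also have "\<dots> = (\<Sum>(l,j,q,i,q')\<in>{..<m}\<times>{..<m}\<times>{..<r}\<times>{..<m}\<times>{..<r}. ?g l q q' i j)"
          by (rule sum.reindex_bij_witness[where i = "\<lambda>(l,j,q,i,q'). (q,q',i,j,l)" and j = "\<lambda>(q,q',i,j,l). (l,j,q,i,q')"]) auto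
        also have "\<dots> = (\<Sum>l<m. \<Sum>j<m. \<Sum>q<r. \<Sum>i<m. \<Sum>q'<r. ?g l q q' i j)"
          by (simp add: sum.cartesian_product split_def)
        finally show ?thesis .
      qed
      also have "\<dots> = (\<Sum>l<m. \<Sum>j<m * r. \<Sum>i<m * r. X $$ (j, i) *
          (y l (i div r) * v (e * r + i mod r)) * cnj (y l (j div r) * v (e * r + j mod r)))"
        unfolding sum_digits by (intro sum.cong refl) (simp add: ac_simps)
      also have "\<dots> \<ge> 0"
      proof (rule sum_nonneg)
        fix l
        show "0 \<le> (\<Sum>j<m * r. \<Sum>i<m * r. X $$ (j, i) *
          (y l (i div r) * v (e * r + i mod r)) * cnj (y l (j div r) * v (e * r + j mod r)))"
          by (rule X[unfolded psd_iff, THEN conjunct2, THEN spec])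
      qed
      finally show ?thesis .
    qed
    have "(\<Sum>i<2 * r. \<Sum>j<2 * r. tens_id 1 m 2 r ?M X $$ (i, j) * v j * cnj (v i)) =
      (\<Sum>e<2. \<Sum>q<r. \<Sum>e'<2. \<Sum>q'<r. if e' = e then (\<Sum>i<m. \<Sum>j<m. E e $$ (i, j) * ?x j q i q') * v (e' * r + q') * cnj (v (e * r + q)) else 0)"
      unfolding sum_digits by (intro sum.cong refl) (auto simp: entry simp del: One_nat_def)
    also have "\<dots> = (\<Sum>e<2. \<Sum>q<r. \<Sum>e'<2. if e' = e then (\<Sum>q'<r. (\<Sum>i<m. \<Sum>j<m. E e $$ (i, j) * ?x j q i q') * v (e * r + q') * cnj (v (e * r + q))) else 0)"
      by (intro sum.cong refl) auto
    also have "\<dots> = (\<Sum>e<2. \<Sum>q<r. \<Sum>q'<r. (\<Sum>i<m. \<Sum>j<m. E e $$ (i, j) * ?x j q i q') * v (e * r + q') * cnj (v (e * r + q)))"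
      by simp
    also have "\<dots> \<ge> 0" by (intro sum_nonneg nonneg) auto
    finally show "0 \<le> (\<Sum>i<2 * r. \<Sum>j<2 * r. tens_id 1 m 2 r ?M X $$ (i, j) * v j * cnj (v i))" .
  qed (use tens_id_carrier[of 1 m 2 r] in simp)
qed (use m in auto)

section \<open>Runs with several copies\<close>

text \<open>Decodes a basis index of the joint memory, first copy most significant. The result is a
  function of the copy and not of its position, so that it can be compared between different orders
  of the copies.\<close>

primrec digits :: "(nat \<Rightarrow> nat) \<Rightarrow> nat list \<Rightarrow> nat \<Rightarrow> nat \<Rightarrow> nat" where
  "digits d [] m = (\<lambda>_. 0)"
| "digits d (j # js) m =
     (digits d js (m mod prod_list (map d js)))(j := m div prod_list (map d js))"

lemma digits_cong: "(\<And>j. j \<in> set js \<Longrightarrow> d j = d' j) \<Longrightarrow> digits d js m = digits d' js m"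
proof (induction js arbitrary: m)
  case (Cons j js)
  then have "map d js = map d' js" by simp
  moreover have "digits d js m = digits d' js m" for m using Cons by simp
  ultimately show ?case by (simp only: digits.simps)
qed simp

lemma digits_append:
  assumes "p < prod_list (map d ps)" "q < prod_list (map d qs)"
  shows "digits d (ps @ qs) (p * prod_list (map d qs) + q) =
    (\<lambda>y. if y \<in> set ps then digits d ps p y else digits d qs q y)"
  using assms(1)
proof (induction ps arbitrary: p)
  case (Cons j ps)
  then have "0 < prod_list (map d ps)" by (cases "prod_list (map d ps)") auto
  let ?Q = "prod_list (map d qs)" and ?P = "prod_list (map d ps)"
  have "(p * ?Q + q) div (?P * ?Q) = p div ?P" "(p * ?Q + q) mod (?P * ?Q) = (p mod ?P) * ?Q + q"
    using assms(2) by (simp_all add: mult.commute[of ?P] div_mult2_eq mod_mult2_eq)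
  then show ?case using \<open>0 < ?P\<close> by (auto simp: Cons.IH)
qed simp

lemma digits_split:
  assumes "p < prod_list (map d ps)" "x < d j" "q < prod_list (map d qs)"
  shows "digits d (ps @ j # qs) ((p * d j + x) * prod_list (map d qs) + q) =
    (\<lambda>y. if y \<in> set ps then digits d ps p y else if y = j then x else digits d qs q y)"
proof -
  let ?Q = "prod_list (map d qs)"
  have "digits d (ps @ j # qs) (p * prod_list (map d (j # qs)) + (x * ?Q + q)) =
    (\<lambda>y. if y \<in> set ps then digits d ps p y else digits d (j # qs) (x * ?Q + q) y)"
    using assms digit_less[OF assms(2,3)] by (intro digits_append) auto
  then show ?thesis using assms by (auto simp: algebra_simps fun_eq_iff)
qed

text \<open>The counterpart of \<open>used\<close> for a schedule given as a function of time; the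
  recursion fits inductions over time.\<close>

primrec count_upto :: "(nat \<Rightarrow> nat) \<Rightarrow> nat \<Rightarrow> nat \<Rightarrow> nat" where
  "count_upto c 0 j = 0"
| "count_upto c (Suc t) j = count_upto c t j + (if c t = j then 1 else 0)"

lemma count_upto_mono: "t \<le> T \<Longrightarrow> count_upto c t j \<le> count_upto c T j"
  by (induction T) (auto simp: le_Suc_eq)

text \<open>A discrimination run in which the copies in a list \<open>js\<close> are still unknown and all other copies
  have become part of the channels \<open>step_link\<close>, which are the same for both hypotheses.  The total
  system is \<open>M \<otimes> W\<close>, where \<open>M\<close> consists of the memories of \<open>js\<close>, in this order, and \<open>work_dim t\<close> is
  the dimension of \<open>W\<close> before step \<open>t\<close>; the component of a copy in \<open>js\<close> acts with the reference
  \<open>ref_dim t\<close> before \<open>step_link t\<close> does.\<close>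

record process =
  work_dim :: "nat \<Rightarrow> nat"
  ref_dim :: "nat \<Rightarrow> nat"
  step_link :: "nat \<Rightarrow> qmap"

lemma open_comb_le: "open_comb n a b \<Theta> \<Longrightarrow> m \<le> n \<Longrightarrow> open_comb m a b \<Theta>"
  by (auto simp: open_comb_def)

text \<open>\<open>c t\<close> is the copy scheduled in step \<open>t\<close>. A scheduled copy
  outside the current list has been absorbed, and its step then consists of the link alone; hence
  \<open>c\<close> stays fixed when copies are removed.\<close>

locale interleaving =
  fixes a b :: "nat \<Rightarrow> nat" and c :: "nat \<Rightarrow> nat"
begin

text \<open>The combs form a family indexed by the copies, because one copy is replaced by \<Omega>
  while the others keep their comb.\<close>

definition cur_mem :: "(nat \<Rightarrow> qcomb) \<Rightarrow> nat \<Rightarrow> nat \<Rightarrow> nat" where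
  "cur_mem \<theta> t j = comb_mem (\<theta> j) (count_upto c t j)"

definition mems :: "(nat \<Rightarrow> qcomb) \<Rightarrow> nat \<Rightarrow> nat list \<Rightarrow> nat" where
  "mems \<theta> t js = prod_list (map (cur_mem \<theta> t) js)"

text \<open>The analogue of \<open>component_step\<close> for the memory order given by
  \<open>js\<close>: the list is cut at the acting copy into the copies before and after it.\<close>

definition comp_step :: "(nat \<Rightarrow> qcomb) \<Rightarrow> nat list \<Rightarrow> nat \<Rightarrow> nat \<Rightarrow> qmap" where
  "comp_step \<theta> js r t X =
    (let j = c t; i = count_upto c t j;
         P = mems \<theta> t (takeWhile (\<lambda>x. x \<noteq> j) js); Q = mems \<theta> t (tl (dropWhile (\<lambda>x. x \<noteq> j) js));
         s = comb_mem (\<theta> j) i; s' = comb_mem (\<theta> j) (Suc i)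
     in tens_id P (Q * s') (s' * Q) (a (Suc i) * r) (swap_op Q s')
          (tens_id (P * Q) (s * b i) (s' * a (Suc i)) r (comb_chan (\<theta> j) (Suc i))
            (tens_id P (s * Q) (Q * s) (b i * r) (swap_op s Q) X)))"

text \<open>The dimension of \<open>W\<close> between the component and the link of step
  \<open>t\<close>.\<close>

definition mid_dim :: "nat list \<Rightarrow> process \<Rightarrow> nat \<Rightarrow> nat" where
  "mid_dim js p t =
    (if c t \<in> set js then a (Suc (count_upto c t (c t))) * ref_dim p t else work_dim p t)"

definition proc_step :: "(nat \<Rightarrow> qcomb) \<Rightarrow> nat list \<Rightarrow> process \<Rightarrow> nat \<Rightarrow> qmap" where
  "proc_step \<theta> js p t X =
    tens_id (mems \<theta> (Suc t) js) (mid_dim js p t) (work_dim p (Suc t)) 1 (step_link p t)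
      ((if c t \<in> set js then comp_step \<theta> js (ref_dim p t) t else id) X)"

primrec proc_run :: "(nat \<Rightarrow> qcomb) \<Rightarrow> nat list \<Rightarrow> process \<Rightarrow> nat \<Rightarrow> qmap" where
  "proc_run \<theta> js p 0 X = X"
| "proc_run \<theta> js p (Suc t) X = proc_step \<theta> js p t (proc_run \<theta> js p t X)"

definition valid_at :: "nat list \<Rightarrow> process \<Rightarrow> nat \<Rightarrow> bool" where
  "valid_at js p t \<longleftrightarrow> 0 < work_dim p t \<and>
    (c t \<in> set js \<longrightarrow> work_dim p t = b (count_upto c t (c t)) * ref_dim p t) \<and>
    channel (mid_dim js p t) (work_dim p (Suc t)) (step_link p t)"

definition valid_process :: "nat list \<Rightarrow> process \<Rightarrow> nat \<Rightarrow> bool" where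
  "valid_process js p T \<longleftrightarrow> 0 < work_dim p 0 \<and> (\<forall>t<T. valid_at js p t)"

text \<open>Only components applied before time \<open>T\<close> have to be channels. This admits
  \<Omega>, which has \<open>k - 1\<close> components, up to the last component of its copy.\<close>

definition valid_combs :: "(nat \<Rightarrow> qcomb) \<Rightarrow> nat list \<Rightarrow> nat \<Rightarrow> bool" where
  "valid_combs \<theta> js T \<longleftrightarrow> (\<forall>j\<in>set js. open_comb (count_upto c T j) a b (\<theta> j))"

lemma valid_combs_le: "valid_combs \<theta> js T \<Longrightarrow> t \<le> T \<Longrightarrow> valid_combs \<theta> js t"
  unfolding valid_combs_def using count_upto_mono open_comb_le by blast

lemma valid_process_le: "valid_process js p T \<Longrightarrow> t \<le> T \<Longrightarrow> valid_process js p t"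
  by (auto simp: valid_process_def)

lemma cur_mem_Suc:
  "cur_mem \<theta> (Suc t) j = (if c t = j then comb_mem (\<theta> j) (Suc (count_upto c t j)) else cur_mem \<theta> t j)"
  by (simp add: cur_mem_def)

lemma mems_simps [simp]:
  "mems \<theta> t [] = 1" "mems \<theta> t (j # js) = cur_mem \<theta> t j * mems \<theta> t js"
  "mems \<theta> t (ps @ qs) = mems \<theta> t ps * mems \<theta> t qs"
  by (simp_all add: mems_def)

lemma mems_Suc_idle: "c t \<notin> set js \<Longrightarrow> mems \<theta> (Suc t) js = mems \<theta> t js"
  by (induction js) (auto simp: cur_mem_Suc)

lemma mems_0: "valid_combs \<theta> js T \<Longrightarrow> mems \<theta> 0 js = 1"
  by (induction js) (auto simp: valid_combs_def cur_mem_def open_comb_def)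

lemma cur_mem_pos:
  assumes "open_comb (count_upto c t j) a b (\<theta> j)"
  shows "0 < cur_mem \<theta> t j"
proof (cases "count_upto c t j")
  case 0
  then show ?thesis using assms by (simp add: cur_mem_def open_comb_def)
next
  case (Suc i)
  then have "channel (comb_mem (\<theta> j) i * b i) (comb_mem (\<theta> j) (Suc i) * a (Suc i)) (comb_chan (\<theta> j) (Suc i))"
    using assms by (auto simp: open_comb_def)
  from channel_pos(2)[OF this] show ?thesis using Suc by (simp add: cur_mem_def)
qed

lemma mems_pos: "valid_combs \<theta> js t \<Longrightarrow> 0 < mems \<theta> t js"
  by (induction js) (auto simp: valid_combs_def cur_mem_pos)

lemma comp_step_split:
  assumes "c t \<notin> set ps" "js = ps @ c t # qs"
  shows "comp_step \<theta> js r t X =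
    (let j = c t; i = count_upto c t j; P = mems \<theta> t ps; Q = mems \<theta> t qs;
         s = comb_mem (\<theta> j) i; s' = comb_mem (\<theta> j) (Suc i)
     in tens_id P (Q * s') (s' * Q) (a (Suc i) * r) (swap_op Q s')
          (tens_id (P * Q) (s * b i) (s' * a (Suc i)) r (comb_chan (\<theta> j) (Suc i))
            (tens_id P (s * Q) (Q * s) (b i * r) (swap_op s Q) X)))"
proof -
  have "takeWhile (\<lambda>x. x \<noteq> c t) js = ps" "tl (dropWhile (\<lambda>x. x \<noteq> c t) js) = qs"
    using assms by (auto simp: takeWhile_append dropWhile_append)
  then show ?thesis by (simp add: comp_step_def)
qed

section \<open>Entries of a run, and independence of the order of the copies\<close>

lemma comp_step_index:
  fixes \<theta> t X
  defines "j \<equiv> c t"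
  defines "i \<equiv> count_upto c t j"
  defines "s \<equiv> comb_mem (\<theta> j) i" and "s' \<equiv> comb_mem (\<theta> j) (Suc i)"
  assumes js: "js = ps @ j # qs" "j \<notin> set ps"
    and Q: "Q = mems \<theta> t qs" and Pl: "p < mems \<theta> t ps" "p' < mems \<theta> t ps"
    and less: "x < s'" "q < Q" "u < a (Suc i)" "v < r"
      "x' < s'" "q' < Q" "u' < a (Suc i)" "v' < r"
  shows "comp_step \<theta> js r t X $$ (((p * s' + x) * Q + q) * (a (Suc i) * r) + (u * r + v),
      ((p' * s' + x') * Q + q') * (a (Suc i) * r) + (u' * r + v')) =
    comb_chan (\<theta> j) (Suc i) (mat (s * b i) (s * b i) (\<lambda>(y, y').
      X $$ (((p * s + y div b i) * Q + q) * (b i * r) + (y mod b i * r + v),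
            ((p' * s + y' div b i) * Q + q') * (b i * r) + (y' mod b i * r + v'))))
      $$ (x * a (Suc i) + u, x' * a (Suc i) + u')"
proof -
  let ?P = "mems \<theta> t ps" and ?A = "a (Suc i)" and ?B = "b i"
  let ?Z = "tens_id ?P (s * Q) (Q * s) (?B * r) (swap_op s Q) X"
  let ?Y = "tens_id (?P * Q) (s * ?B) (s' * ?A) r (comb_chan (\<theta> j) (Suc i)) ?Z"
  have step: "comp_step \<theta> js r t X = tens_id ?P (Q * s') (s' * Q) (?A * r) (swap_op Q s') ?Y"
    using comp_step_split[of t ps js qs \<theta> r X] js unfolding Q s_def s'_def i_def j_def Let_def by simp
  have ur: "u * r + v < ?A * r" "u' * r + v' < ?A * r" using less by (auto intro: digit_less)
  have i1: "((p * s' + x) * Q + q) * k + z = (p * (s' * Q) + (x * Q + q)) * k + z" for p x q k z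
    by (simp add: algebra_simps)
  have i2: "(p * (Q * s') + (q * s' + x)) * (k * r) + (u * r + v) =
      ((p * Q + q) * (s' * k) + (x * k + u)) * r + v" for p q x u v k
    by (simp add: algebra_simps)
  \<comment> \<open>The index \<open>y\<close> runs over memory and input of the component:
    \<open>y div ?B\<close> is the digit of the memory and \<open>y mod ?B\<close> that of the
    input.\<close>
  have i3: "((p * Q + q) * (s * ?B) + y) * r + v =
      (p * (Q * s) + (q * s + y div ?B)) * (?B * r) + (y mod ?B * r + v)" for p q y v
  proof -
    have "((p * Q + q) * (s * ?B) + y) * r + v = ((p * Q + q) * (s * ?B) + (y div ?B * ?B + y mod ?B)) * r + v"
      by simp
    also have "\<dots> = (p * (Q * s) + (q * s + y div ?B)) * (?B * r) + (y mod ?B * r + v)"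
      by (simp only: algebra_simps)
    finally show ?thesis .
  qed
  have "comp_step \<theta> js r t X $$ (((p * s' + x) * Q + q) * (?A * r) + (u * r + v),
      ((p' * s' + x') * Q + q') * (?A * r) + (u' * r + v')) =
    ?Y $$ ((p * (Q * s') + (q * s' + x)) * (?A * r) + (u * r + v), (p' * (Q * s') + (q' * s' + x')) * (?A * r) + (u' * r + v'))"
    unfolding step i1 by (rule tens_id_swap_index) (use less Pl ur in auto)
  also have "\<dots> = comb_chan (\<theta> j) (Suc i) (mat (s * ?B) (s * ?B) (\<lambda>(y, y').
      ?Z $$ (((p * Q + q) * (s * ?B) + y) * r + v, ((p' * Q + q') * (s * ?B) + y') * r + v'))) $$ (x * ?A + u, x' * ?A + u')"
    unfolding i2 by (rule tens_id_index) (use less Pl in \<open>auto intro: digit_less\<close>)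
  also have "mat (s * ?B) (s * ?B) (\<lambda>(y, y').
      ?Z $$ (((p * Q + q) * (s * ?B) + y) * r + v, ((p' * Q + q') * (s * ?B) + y') * r + v')) =
    mat (s * ?B) (s * ?B) (\<lambda>(y, y').
      X $$ (((p * s + y div b i) * Q + q) * (b i * r) + (y mod b i * r + v),
            ((p' * s + y' div b i) * Q + q') * (b i * r) + (y' mod b i * r + v')))"
  proof (rule cong_mat)
    fix y y' assume y: "y < s * ?B" "y' < s * ?B"
    then have dB: "y div ?B < s" "y' div ?B < s" and "0 < ?B"
      by (auto simp: less_mult_imp_div_less intro: Nat.gr0I)
    then have mB: "y mod ?B * r + v < ?B * r" "y' mod ?B * r + v' < ?B * r"
      using less by (auto intro!: digit_less)
    have "?Z $$ ((p * (Q * s) + (q * s + y div ?B)) * (?B * r) + (y mod ?B * r + v),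
         (p' * (Q * s) + (q' * s + y' div ?B)) * (?B * r) + (y' mod ?B * r + v')) =
       X $$ ((p * (s * Q) + (y div ?B * Q + q)) * (?B * r) + (y mod ?B * r + v),
         (p' * (s * Q) + (y' div ?B * Q + q')) * (?B * r) + (y' mod ?B * r + v'))"
      by (rule tens_id_swap_index) (use less Pl dB mB in auto)
    then show "(\<lambda>(y, y'). ?Z $$ (((p * Q + q) * (s * ?B) + y) * r + v, ((p' * Q + q') * (s * ?B) + y') * r + v')) (y, y') =
      (\<lambda>(y, y'). X $$ (((p * s + y div b i) * Q + q) * (b i * r) + (y mod b i * r + v),
            ((p' * s + y' div b i) * Q + q') * (b i * r) + (y' mod b i * r + v'))) (y, y')"
      by (simp only: case_prod_conv i3) (simp add: algebra_simps)
  qed simp_all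
  finally show ?thesis .
qed

text \<open>The entries of the run, indexed by an assignment of a basis index to the memory of every copy;
  in this form the order of the copies is irrelevant.\<close>

primrec run_entry :: "(nat \<Rightarrow> qcomb) \<Rightarrow> nat set \<Rightarrow> process \<Rightarrow> complex mat \<Rightarrow> nat \<Rightarrow>
    (nat \<Rightarrow> nat) \<Rightarrow> nat \<Rightarrow> (nat \<Rightarrow> nat) \<Rightarrow> nat \<Rightarrow> complex" where
  "run_entry \<theta> J p X 0 \<mu> z \<mu>' z' = X $$ (z, z')"
| "run_entry \<theta> J p X (Suc t) \<mu> z \<mu>' z' =
    (let j = c t; i = count_upto c t j; r = ref_dim p t; s = comb_mem (\<theta> j) i;
         n = (if j \<in> J then a (Suc i) * r else work_dim p t)
     in step_link p t (mat n n (\<lambda>(w, w').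
       if j \<in> J
       then comb_chan (\<theta> j) (Suc i) (mat (s * b i) (s * b i) (\<lambda>(y, y').
           run_entry \<theta> J p X t (\<mu>(j := y div b i)) (y mod b i * r + w mod r)
              (\<mu>'(j := y' div b i)) (y' mod b i * r + w' mod r)))
         $$ (\<mu> j * a (Suc i) + w div r, \<mu>' j * a (Suc i) + w' div r)
       else run_entry \<theta> J p X t \<mu> w \<mu>' w')) $$ (z, z'))"

text \<open>An idle step changes neither memories nor digits. In an active step the memory index is
  split at the acting copy, whose digit is the only one that the component touches; the other
  memories are spectators by \<open>comp_step_index\<close>.\<close>

lemma proc_run_index:
  assumes vp: "valid_process js p T" and vc: "valid_combs \<theta> js T" and "distinct js"
    and "t \<le> T" "m < mems \<theta> t js" "z < work_dim p t" "m' < mems \<theta> t js" "z' < work_dim p t"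
  shows "proc_run \<theta> js p t X $$ (m * work_dim p t + z, m' * work_dim p t + z') =
    run_entry \<theta> (set js) p X t (digits (cur_mem \<theta> t) js m) z (digits (cur_mem \<theta> t) js m') z'"
  using assms(4-)
proof (induction t arbitrary: m z m' z')
  case 0
  then show ?case using mems_0[OF vc] by simp
next
  case (Suc t)
  let ?M = "mems \<theta> (Suc t) js" and ?n = "mid_dim js p t" and ?w = "work_dim p t"
  let ?C = "(if c t \<in> set js then comp_step \<theta> js (ref_dim p t) t else id) (proc_run \<theta> js p t X)"
  have "t < T" using Suc.prems by simp
  have L: "proc_run \<theta> js p (Suc t) X $$ (m * work_dim p (Suc t) + z, m' * work_dim p (Suc t) + z') =
    step_link p t (mat ?n ?n (\<lambda>(v, v'). ?C $$ (m * ?n + v, m' * ?n + v'))) $$ (z, z')"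
    using tens_id_index[of m ?M z "work_dim p (Suc t)" 0 1 m' z' 0 ?n "step_link p t" ?C] Suc.prems by (simp add: proc_step_def)
  show ?case
  proof (cases "c t \<in> set js")
    case False
    have M: "?M = mems \<theta> t js" by (rule mems_Suc_idle[OF False])
    have dig: "digits (cur_mem \<theta> (Suc t)) js = digits (cur_mem \<theta> t) js"
      using False by (intro ext digits_cong) (auto simp: cur_mem_Suc fun_eq_iff intro: digits_cong)
    have n: "?n = ?w" using False by (simp add: mid_dim_def)
    have "mat ?n ?n (\<lambda>(v, v'). ?C $$ (m * ?n + v, m' * ?n + v')) =
      mat ?w ?w (\<lambda>(w, w'). run_entry \<theta> (set js) p X t (digits (cur_mem \<theta> t) js m) w (digits (cur_mem \<theta> t) js m') w')"
      unfolding n using Suc.prems False by (intro cong_mat) (auto simp: M Suc.IH)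
    then show ?thesis unfolding L dig using False by (simp add: Let_def)
  next
    case True
    then obtain ps qs where js: "js = ps @ c t # qs" by (auto dest: split_list)
    define j i where "j = c t" and "i = count_upto c t j"
    define s s' r Q where "s = comb_mem (\<theta> j) i" and "s' = comb_mem (\<theta> j) (Suc i)"
      and "r = ref_dim p t" and "Q = mems \<theta> t qs"
    have notin: "j \<notin> set ps" "j \<notin> set qs" using \<open>distinct js\<close> js by (auto simp: j_def)
    have w: "?w = b i * r" using vp True \<open>t < T\<close> by (auto simp: valid_process_def valid_at_def i_def j_def r_def)
    have n: "?n = a (Suc i) * r" using True by (simp add: mid_dim_def i_def j_def r_def)
    have ms: "cur_mem \<theta> t j = s" "cur_mem \<theta> (Suc t) j = s'"
      "mems \<theta> (Suc t) ps = mems \<theta> t ps" "mems \<theta> (Suc t) qs = Q"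
      using notin by (auto simp: mems_Suc_idle j_def cur_mem_def s_def s'_def i_def Q_def)
    have dq: "prod_list (map (cur_mem \<theta> (Suc t)) qs) = Q" "prod_list (map (cur_mem \<theta> t) qs) = Q"
      using ms(4) by (simp_all add: mems_def Q_def)
    have M: "?M = mems \<theta> t ps * s' * Q" "mems \<theta> t js = mems \<theta> t ps * s * Q"
      using js by (simp_all add: ms flip: j_def Q_def)
    obtain g x q where m: "g < mems \<theta> t ps" "x < s'" "q < Q" "m = (g * s' + x) * Q + q"
      using Suc.prems(2) unfolding M by (metis digit_cases)
    obtain g' x' q' where m': "g' < mems \<theta> t ps" "x' < s'" "q' < Q" "m' = (g' * s' + x') * Q + q'"
      using Suc.prems(4) unfolding M by (metis digit_cases)
    have dg: "digits (cur_mem \<theta> (Suc t)) ps = digits (cur_mem \<theta> t) ps"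
      "digits (cur_mem \<theta> (Suc t)) qs = digits (cur_mem \<theta> t) qs"
      using notin by (auto intro!: ext digits_cong simp: fun_eq_iff cur_mem_Suc j_def intro: digits_cong[THEN fun_cong])
    have D: "digits (cur_mem \<theta> (Suc t)) js ((g * s' + x) * Q + q) =
       (\<lambda>y. if y \<in> set ps then digits (cur_mem \<theta> t) ps g y else if y = j then x else digits (cur_mem \<theta> t) qs q y)"
      if "g < mems \<theta> t ps" "x < s'" "q < Q" for g x q
      using digits_split[of g "cur_mem \<theta> (Suc t)" ps x j q qs] that ms(3)
      by (simp add: dq ms(1,2) dg js mems_def cong: if_cong flip: j_def)
    have D0: "digits (cur_mem \<theta> t) js ((g * s + x) * Q + q) =
       (\<lambda>y. if y \<in> set ps then digits (cur_mem \<theta> t) ps g y else if y = j then x else digits (cur_mem \<theta> t) qs q y)"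
      if "g < mems \<theta> t ps" "x < s" "q < Q" for g x q
      using digits_split[of g "cur_mem \<theta> t" ps x j q qs] that
      by (simp add: dq ms(1,2) js mems_def flip: j_def)
    \<comment> \<open>The acting memory has dimension \<open>s\<close> before and \<open>s'\<close>
      after the step, so the two indices use different radices. As assignments to copies they differ
      only at \<open>j\<close>.\<close>
    have upd: "digits (cur_mem \<theta> t) js ((g * s + k) * Q + q) = (digits (cur_mem \<theta> (Suc t)) js ((g * s' + x) * Q + q))(j := k)"
      if "g < mems \<theta> t ps" "x < s'" "q < Q" "k < s" for g x q k
      using that notin by (auto simp: D D0 fun_eq_iff)
    have dj: "digits (cur_mem \<theta> (Suc t)) js ((g * s' + x) * Q + q) j = x" if "g < mems \<theta> t ps" "x < s'" "q < Q" for g x q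
      using that notin by (simp add: D)
    have "mat ?n ?n (\<lambda>(v, v'). ?C $$ (m * ?n + v, m' * ?n + v')) =
      mat ?n ?n (\<lambda>(w, w'). comb_chan (\<theta> j) (Suc i) (mat (s * b i) (s * b i) (\<lambda>(y, y').
           run_entry \<theta> (set js) p X t ((digits (cur_mem \<theta> (Suc t)) js m)(j := y div b i)) (y mod b i * r + w mod r)
              ((digits (cur_mem \<theta> (Suc t)) js m')(j := y' div b i)) (y' mod b i * r + w' mod r)))
         $$ (digits (cur_mem \<theta> (Suc t)) js m j * a (Suc i) + w div r, digits (cur_mem \<theta> (Suc t)) js m' j * a (Suc i) + w' div r))"
    proof (rule cong_mat)
      fix v v' assume "v < ?n" "v' < ?n"
      then obtain u h u' h' where v: "u < a (Suc i)" "h < r" "v = u * r + h" "u' < a (Suc i)" "h' < r" "v' = u' * r + h'"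
        unfolding n by (metis digit_cases)
      have "?C $$ (m * ?n + v, m' * ?n + v') =
        comp_step \<theta> js r t (proc_run \<theta> js p t X) $$ (((g * s' + x) * Q + q) * (a (Suc i) * r) + (u * r + h),
          ((g' * s' + x') * Q + q') * (a (Suc i) * r) + (u' * r + h'))"
        using True unfolding n m(4) m'(4) v by (simp add: r_def)
      also have "\<dots> = comb_chan (\<theta> j) (Suc i) (mat (s * b i) (s * b i) (\<lambda>(y, y').
        proc_run \<theta> js p t X $$ (((g * s + y div b i) * Q + q) * (b i * r) + (y mod b i * r + h),
            ((g' * s + y' div b i) * Q + q') * (b i * r) + (y' mod b i * r + h'))))
        $$ (x * a (Suc i) + u, x' * a (Suc i) + u')"
        unfolding s_def s'_def i_def j_def
        by (rule comp_step_index)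
          (use js notin m m' v in \<open>auto simp: Q_def s_def s'_def i_def j_def\<close>)
      also have "mat (s * b i) (s * b i) (\<lambda>(y, y').
        proc_run \<theta> js p t X $$ (((g * s + y div b i) * Q + q) * (b i * r) + (y mod b i * r + h),
            ((g' * s + y' div b i) * Q + q') * (b i * r) + (y' mod b i * r + h'))) =
        mat (s * b i) (s * b i) (\<lambda>(y, y').
           run_entry \<theta> (set js) p X t ((digits (cur_mem \<theta> (Suc t)) js m)(j := y div b i)) (y mod b i * r + h)
              ((digits (cur_mem \<theta> (Suc t)) js m')(j := y' div b i)) (y' mod b i * r + h'))"
      proof (rule cong_mat)
        fix y y' assume y: "y < s * b i" "y' < s * b i"
        then have dB: "y div b i < s" "y' div b i < s" and "0 < b i"
          by (auto simp: less_mult_imp_div_less intro: Nat.gr0I)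
        then have mB: "y mod b i * r + h < b i * r" "y' mod b i * r + h' < b i * r"
          using v by (auto intro!: digit_less)
        have "proc_run \<theta> js p t X $$ (((g * s + y div b i) * Q + q) * (b i * r) + (y mod b i * r + h),
            ((g' * s + y' div b i) * Q + q') * (b i * r) + (y' mod b i * r + h')) =
          run_entry \<theta> (set js) p X t (digits (cur_mem \<theta> t) js ((g * s + y div b i) * Q + q)) (y mod b i * r + h)
            (digits (cur_mem \<theta> t) js ((g' * s + y' div b i) * Q + q')) (y' mod b i * r + h')"
          using mB dB m m' \<open>t < T\<close> unfolding w[symmetric]
          by (intro Suc.IH) (auto simp: M intro!: digit_less)
        then show "(\<lambda>(y, y'). proc_run \<theta> js p t X $$ (((g * s + y div b i) * Q + q) * (b i * r) + (y mod b i * r + h),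
            ((g' * s + y' div b i) * Q + q') * (b i * r) + (y' mod b i * r + h'))) (y, y') =
          (\<lambda>(y, y'). run_entry \<theta> (set js) p X t ((digits (cur_mem \<theta> (Suc t)) js m)(j := y div b i)) (y mod b i * r + h)
              ((digits (cur_mem \<theta> (Suc t)) js m')(j := y' div b i)) (y' mod b i * r + h')) (y, y')"
          unfolding case_prod_conv m(4) m'(4)
          by (simp only: upd[OF m(1-3) dB(1), symmetric] upd[OF m'(1-3) dB(2), symmetric])
      qed simp_all
      finally show "(\<lambda>(v, v'). ?C $$ (m * ?n + v, m' * ?n + v')) (v, v') =
        (\<lambda>(w, w'). comb_chan (\<theta> j) (Suc i) (mat (s * b i) (s * b i) (\<lambda>(y, y').
           run_entry \<theta> (set js) p X t ((digits (cur_mem \<theta> (Suc t)) js m)(j := y div b i)) (y mod b i * r + w mod r)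
              ((digits (cur_mem \<theta> (Suc t)) js m')(j := y' div b i)) (y' mod b i * r + w' mod r)))
         $$ (digits (cur_mem \<theta> (Suc t)) js m j * a (Suc i) + w div r, digits (cur_mem \<theta> (Suc t)) js m' j * a (Suc i) + w' div r)) (v, v')"
        using v by (simp add: m(4) m'(4) dj[OF m(1-3)] dj[OF m'(1-3)])
    qed simp_all
    then show ?thesis unfolding L using True
      by (simp add: Let_def n flip: j_def i_def s_def r_def)
  qed
qed

lemma channel_proc_step:
  assumes v: "valid_at js p t" and vc: "valid_combs \<theta> js (Suc t)" and "distinct js"
  shows "channel (mems \<theta> t js * work_dim p t) (mems \<theta> (Suc t) js * work_dim p (Suc t)) (proc_step \<theta> js p t)"
proof -
  have pos0: "0 < mems \<theta> t js * work_dim p t"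
    using v mems_pos[OF valid_combs_le[OF vc]] by (simp add: valid_at_def)
  have lk: "channel (mid_dim js p t) (work_dim p (Suc t)) (step_link p t)"
    using v by (simp add: valid_at_def)
  have "0 < mems \<theta> (Suc t) js" using mems_pos vc by blast
  then have lk': "channel (mems \<theta> (Suc t) js * mid_dim js p t) (mems \<theta> (Suc t) js * work_dim p (Suc t))
      (tens_id (mems \<theta> (Suc t) js) (mid_dim js p t) (work_dim p (Suc t)) 1 (step_link p t))"
    using channel_tens_id[OF lk, of "mems \<theta> (Suc t) js" 1] by simp
  let ?C = "if c t \<in> set js then comp_step \<theta> js (ref_dim p t) t else id"
  have "channel (mems \<theta> t js * work_dim p t) (mems \<theta> (Suc t) js * mid_dim js p t) ?C"
  proof (cases "c t \<in> set js")
    case False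
    then show ?thesis
      using pos0 by (simp add: channel_id mems_Suc_idle mid_dim_def)
  next
    case True
    then obtain ps qs where js: "js = ps @ c t # qs" by (auto dest: split_list)
    define j i where "j = c t" and "i = count_upto c t j"
    define s s' r Q P where "s = comb_mem (\<theta> j) i" and "s' = comb_mem (\<theta> j) (Suc i)"
      and "r = ref_dim p t" and "Q = mems \<theta> t qs" and "P = mems \<theta> t ps"
    have notin: "j \<notin> set ps" "j \<notin> set qs" using \<open>distinct js\<close> js by (auto simp: j_def)
    have w: "work_dim p t = b i * r" using v True by (auto simp: valid_at_def i_def j_def r_def)
    have n: "mid_dim js p t = a (Suc i) * r" using True by (simp add: mid_dim_def i_def j_def r_def)
    have ms: "cur_mem \<theta> t j = s" "cur_mem \<theta> (Suc t) j = s'"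
      "mems \<theta> (Suc t) ps = P" "mems \<theta> (Suc t) qs = Q" "mems \<theta> t ps = P" "mems \<theta> t qs = Q"
      using notin by (auto simp: mems_Suc_idle j_def cur_mem_def s_def s'_def i_def Q_def P_def)
    have M: "mems \<theta> (Suc t) js = P * s' * Q" "mems \<theta> t js = P * s * Q"
      using js by (simp_all add: ms flip: j_def)
    have "open_comb (Suc i) a b (\<theta> j)"
      using vc True by (auto simp: valid_combs_def j_def i_def)
    then have N: "channel (s * b i) (s' * a (Suc i)) (comb_chan (\<theta> j) (Suc i))"
      by (simp add: open_comb_def s_def s'_def)
    have pos: "0 < P" "0 < Q" "0 < s" "0 < s'" "0 < b i" "0 < r" "0 < a (Suc i)"
      using pos0 channel_pos[OF N] unfolding M w by auto
    have "channel (P * (s * Q) * (b i * r)) (P * (Q * s) * (b i * r)) (tens_id P (s * Q) (Q * s) (b i * r) (swap_op s Q))"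
      using pos by (intro channel_tens_id channel_swap_op) auto
    moreover have "channel (P * Q * (s * b i) * r) (P * Q * (s' * a (Suc i)) * r)
        (tens_id (P * Q) (s * b i) (s' * a (Suc i)) r (comb_chan (\<theta> j) (Suc i)))"
      using pos N by (intro channel_tens_id) auto
    moreover have "channel (P * (Q * s') * (a (Suc i) * r)) (P * (s' * Q) * (a (Suc i) * r))
        (tens_id P (Q * s') (s' * Q) (a (Suc i) * r) (swap_op Q s'))"
      using pos by (intro channel_tens_id channel_swap_op) auto
    ultimately have "channel (P * (s * Q) * (b i * r)) (P * (s' * Q) * (a (Suc i) * r))
       (tens_id P (Q * s') (s' * Q) (a (Suc i) * r) (swap_op Q s') \<circ>
         (tens_id (P * Q) (s * b i) (s' * a (Suc i)) r (comb_chan (\<theta> j) (Suc i)) \<circ>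
          tens_id P (s * Q) (Q * s) (b i * r) (swap_op s Q)))"
      by (intro channel_comp) (auto simp: mult_ac)
    then have "channel (P * (s * Q) * (b i * r)) (P * (s' * Q) * (a (Suc i) * r)) (comp_step \<theta> js r t)"
      by (rule channel_cong) (use js notin in \<open>simp add: comp_step_split Let_def ms flip: j_def i_def s_def s'_def\<close>)
    then show ?thesis using True by (simp add: M n w mult_ac r_def)
  qed
  from channel_comp[OF this lk'] show ?thesis
    by (rule channel_cong) (simp add: proc_step_def)
qed

lemma channel_proc_run:
  assumes vp: "valid_process js p T" and vc: "valid_combs \<theta> js T" and "distinct js"
  shows "channel (work_dim p 0) (mems \<theta> T js * work_dim p T) (proc_run \<theta> js p T)"
  using vp vc
proof (induction T)
  case 0
  then show ?case
    using mems_0[of \<theta> js 0] channel_id[of "work_dim p 0"] by (simp add: valid_process_def id_def)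
next
  case (Suc t)
  have IH: "channel (work_dim p 0) (mems \<theta> t js * work_dim p t) (proc_run \<theta> js p t)"
    using Suc.IH valid_process_le[OF Suc.prems(1)] valid_combs_le[OF Suc.prems(2)] by simp
  have "channel (mems \<theta> t js * work_dim p t) (mems \<theta> (Suc t) js * work_dim p (Suc t)) (proc_step \<theta> js p t)"
    using Suc.prems \<open>distinct js\<close> by (intro channel_proc_step) (auto simp: valid_process_def)
  from channel_comp[OF IH this] show ?case by (rule channel_cong) simp
qed

text \<open>The entries \<open>run_entry\<close> do not refer to the order of the copies; the order
  enters only through the decoding of the memory index. With all memories trivial at time
  \<open>T\<close>, this index is 0 in either order.\<close>

lemma proc_run_permute:
  assumes js: "valid_process js p T" "valid_combs \<theta> js T" "distinct js"
    and js': "distinct js'" "set js' = set js"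
    and triv: "\<And>j. j \<in> set js \<Longrightarrow> cur_mem \<theta> T j = 1"
    and X: "X \<in> carrier_mat (work_dim p 0) (work_dim p 0)"
  shows "proc_run \<theta> js p T X = proc_run \<theta> js' p T X"
proof -
  have mid: "mid_dim js' p t = mid_dim js p t" for t by (simp add: mid_dim_def js')
  have v': "valid_process js' p T" "valid_combs \<theta> js' T"
    using js js' mid by (auto simp: valid_process_def valid_at_def valid_combs_def)
  have one: "mems \<theta> T l = 1" if "set l \<subseteq> set js" for l
    using that by (induction l) (auto simp: triv)
  have dig: "digits (cur_mem \<theta> T) l 0 = (\<lambda>_. 0)" for l by (induction l) auto
  have car: "proc_run \<theta> l p T X \<in> carrier_mat (work_dim p T) (work_dim p T)"
    if "valid_process l p T" "valid_combs \<theta> l T" "distinct l" "set l \<subseteq> set js" for l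
    using channelD(2)[OF channel_proc_run[OF that(1-3)] X] one[OF that(4)] by simp
  have "proc_run \<theta> l p T X $$ (z, z') = run_entry \<theta> (set js) p X T (\<lambda>_. 0) z (\<lambda>_. 0) z'"
    if "valid_process l p T" "valid_combs \<theta> l T" "distinct l" "set l = set js"
      "z < work_dim p T" "z' < work_dim p T" for l z z'
    using proc_run_index[OF that(1-3) le_refl, of 0 z 0 z' X] that one[of l] by (simp add: dig)
  then show ?thesis
    using car[OF js] car[OF v' js'(1)] js v' js' by (intro eq_matI) auto
qed

end

section \<open>The run as an application of one copy\<close>

text \<open>The adaptive strategy moves the memory \<open>s\<close> past the other memories \<open>Q\<close>; from the point of view of
  the comb it is \<open>Q\<close> that moves, to the end of the reference.\<close>

lemma conjugate_by_swap:
  fixes s s' A B Q r :: nat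
  assumes Y: "Y \<in> carrier_mat (s * (Q * (B * r))) (s * (Q * (B * r)))"
  shows "tens_id 1 (Q * s') (s' * Q) (A * r) (swap_op Q s')
      (tens_id Q (s * B) (s' * A) r N (tens_id 1 (s * Q) (Q * s) (B * r) (swap_op s Q) Y)) =
    tens_id s' ((A * r) * Q) (Q * (A * r)) 1 (swap_op (A * r) Q)
      (tens_id 1 (s * B) (s' * A) (r * Q) N (tens_id s (Q * (B * r)) ((B * r) * Q) 1 (swap_op Q (B * r)) Y))"
proof -
  define U where "U = tens_id 1 (s * Q) (Q * s) (B * r) (swap_op s Q) Y"
  define V where "V = tens_id Q (s * B) (s' * A) r N U"
  define W where "W = tens_id 1 (s * B) (s' * A) (r * Q) N (tens_id s (Q * (B * r)) ((B * r) * Q) 1 (swap_op Q (B * r)) Y)"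
  have V': "V = tens_id Q (s * (B * r)) (s' * (A * r)) 1 (tens_id 1 (s * B) (s' * A) r N) U"
    unfolding V_def by (rule tens_id_nest'[symmetric]) auto
  have "swap_op Q (s * (B * r)) U = tens_id s (Q * (B * r)) ((B * r) * Q) 1 (swap_op Q (B * r)) (tens_id 1 (Q * s) (s * Q) (B * r) (swap_op Q s) U)"
    by (rule swap_op_hexagon_right)
  also have "tens_id 1 (Q * s) (s * Q) (B * r) (swap_op Q s) U = Y"
    unfolding U_def using Y by (intro tens_id_swap_swap) (simp add: mult_ac)
  finally have U': "swap_op Q (s * (B * r)) U = tens_id s (Q * (B * r)) ((B * r) * Q) 1 (swap_op Q (B * r)) Y" .
  \<comment> \<open>Naturality with respect to the component carries \<open>Q\<close> from its left
    to its right. The hexagons express the moves of \<open>Q\<close> past memory and work system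
    together through its swaps with each of them.\<close>
  have "swap_op Q (s' * (A * r)) V = tens_id 1 (s * (B * r)) (s' * (A * r)) Q (tens_id 1 (s * B) (s' * A) r N) (swap_op Q (s * (B * r)) U)"
    unfolding V' by (rule swap_op_tens_id_right)
  also have "\<dots> = W" unfolding U' W_def by (rule tens_id_nest') auto
  finally have VW: "swap_op (s' * (A * r)) Q W = V"
    using swap_op_swap_op[of V Q "s' * (A * r)"] tens_id_carrier[of Q "s' * (A * r)" "s' * (A * r)" 1]
    by (metis V' mult.right_neutral tens_id_carrier)
  let ?T = "tens_id s' ((A * r) * Q) (Q * (A * r)) 1 (swap_op (A * r) Q) W"
  have "V = tens_id 1 (s' * Q) (Q * s') (A * r) (swap_op s' Q) ?T"
    unfolding VW[symmetric] by (rule swap_op_hexagon_left)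
  then have "tens_id 1 (Q * s') (s' * Q) (A * r) (swap_op Q s') V = ?T"
    using tens_id_carrier[of s' "(A * r) * Q" "Q * (A * r)" 1 "swap_op (A * r) Q" W]
    by (simp only:) (intro tens_id_swap_swap, simp add: mult_ac)
  then show ?thesis unfolding V_def U_def W_def .
qed

context interleaving
begin

section \<open>Single steps in the presence of spectator systems\<close>

lemma mems_cong: "(\<And>j. j \<in> set js \<Longrightarrow> \<theta> j = \<theta>' j) \<Longrightarrow> mems \<theta> t js = mems \<theta>' t js"
  unfolding mems_def cur_mem_def by (intro arg_cong[where f = prod_list] map_cong) auto

lemma comp_step_cong:
  assumes "\<And>j. j \<in> set js \<Longrightarrow> \<theta> j = \<theta>' j" and "c t \<in> set js"
  shows "comp_step \<theta> js r t = comp_step \<theta>' js r t"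
proof -
  have "set (takeWhile (\<lambda>x. x \<noteq> c t) js) \<subseteq> set js" "set (tl (dropWhile (\<lambda>x. x \<noteq> c t) js)) \<subseteq> set js"
    by (auto dest!: set_takeWhileD) (metis list.set_sel(2) set_dropWhileD list.sel(2))
  then have "mems \<theta> t (takeWhile (\<lambda>x. x \<noteq> c t) js) = mems \<theta>' t (takeWhile (\<lambda>x. x \<noteq> c t) js)"
    "mems \<theta> t (tl (dropWhile (\<lambda>x. x \<noteq> c t) js)) = mems \<theta>' t (tl (dropWhile (\<lambda>x. x \<noteq> c t) js))"
    using assms(1) by (auto intro!: mems_cong)
  then show ?thesis using assms by (simp add: comp_step_def fun_eq_iff)
qed

lemma proc_step_cong:
  assumes "\<And>j. j \<in> set js \<Longrightarrow> \<theta> j = \<theta>' j"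
  shows "proc_step \<theta> js p t = proc_step \<theta>' js p t"
  using comp_step_cong[OF assms] mems_cong[OF assms, where t = "Suc t"]
  by (simp add: proc_step_def fun_eq_iff)

lemma proc_run_cong:
  assumes "\<And>j. j \<in> set js \<Longrightarrow> \<theta> j = \<theta>' j"
  shows "proc_run \<theta> js p t X = proc_run \<theta>' js p t X"
  by (induction t) (simp_all add: proc_step_cong[OF assms])

lemma proc_step_active:
  fixes \<theta> t p ps qs
  defines "j \<equiv> c t" and "r \<equiv> ref_dim p t" and "P \<equiv> mems \<theta> t ps" and "Q \<equiv> mems \<theta> t qs"
  defines "i \<equiv> count_upto c t j"
  defines "s \<equiv> comb_mem (\<theta> j) i" and "s' \<equiv> comb_mem (\<theta> j) (Suc i)"
  assumes js: "js = ps @ j # qs" "j \<notin> set ps" "j \<notin> set qs"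
  shows "proc_step \<theta> js p t X =
    tens_id (P * (s' * Q)) (a (Suc i) * r) (work_dim p (Suc t)) 1 (step_link p t)
      (tens_id P (Q * s') (s' * Q) (a (Suc i) * r) (swap_op Q s')
        (tens_id (P * Q) (s * b i) (s' * a (Suc i)) r (comb_chan (\<theta> j) (Suc i))
          (tens_id P (s * Q) (Q * s) (b i * r) (swap_op s Q) X)))"
proof -
  have "mems \<theta> (Suc t) js = P * (s' * Q)"
    using js by (simp add: mems_Suc_idle P_def Q_def s'_def i_def j_def cur_mem_Suc)
  moreover have "mid_dim js p t = a (Suc i) * r"
    using js by (simp add: mid_dim_def j_def i_def r_def)
  moreover have "c t \<in> set js" using js by (simp add: j_def)
  moreover have "comp_step \<theta> js r t X = tens_id P (Q * s') (s' * Q) (a (Suc i) * r) (swap_op Q s')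
        (tens_id (P * Q) (s * b i) (s' * a (Suc i)) r (comb_chan (\<theta> j) (Suc i))
          (tens_id P (s * Q) (Q * s) (b i * r) (swap_op s Q) X))"
    using comp_step_split[of t ps js qs \<theta> r X] js
    by (simp add: Let_def P_def Q_def s_def s'_def i_def j_def)
  ultimately show ?thesis by (simp add: proc_step_def r_def)
qed

lemma proc_step_idle:
  assumes "c t \<notin> set js"
  shows "proc_step \<theta> js p t X =
    tens_id (mems \<theta> t js) (work_dim p t) (work_dim p (Suc t)) 1 (step_link p t) X"
  using assms by (simp add: proc_step_def mid_dim_def mems_Suc_idle)

text \<open>Spectators on both sides merely enlarge the spectators of the four elementary maps. The
  left one is used to put a copy in front of the list, the right one to put an absorbed memory at
  the end of \<open>W\<close>.\<close>

lemma tens_id_proc_step_active: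
  fixes \<theta> t p ps qs
  defines "j \<equiv> c t" and "r \<equiv> ref_dim p t" and "P \<equiv> mems \<theta> t ps" and "Q \<equiv> mems \<theta> t qs"
  defines "i \<equiv> count_upto c t j"
  defines "s \<equiv> comb_mem (\<theta> j) i" and "s' \<equiv> comb_mem (\<theta> j) (Suc i)"
  assumes js: "js = ps @ j # qs" "j \<notin> set ps" "j \<notin> set qs"
    and w: "work_dim p t = b i * r"
  shows "tens_id l (mems \<theta> t js * work_dim p t) (mems \<theta> (Suc t) js * work_dim p (Suc t)) r' (proc_step \<theta> js p t) X =
    tens_id (l * P * (s' * Q)) (a (Suc i) * r) (work_dim p (Suc t)) r' (step_link p t)
      (tens_id (l * P) (Q * s') (s' * Q) (a (Suc i) * (r * r')) (swap_op Q s')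
        (tens_id (l * P * Q) (s * b i) (s' * a (Suc i)) (r * r') (comb_chan (\<theta> j) (Suc i))
          (tens_id (l * P) (s * Q) (Q * s) (b i * (r * r')) (swap_op s Q) X)))"
proof -
  let ?A = "tens_id (P * (s' * Q)) (a (Suc i) * r) (work_dim p (Suc t)) 1 (step_link p t)"
  let ?B = "tens_id P (Q * s') (s' * Q) (a (Suc i) * r) (swap_op Q s')"
  let ?C = "tens_id (P * Q) (s * b i) (s' * a (Suc i)) r (comb_chan (\<theta> j) (Suc i))"
  let ?D = "tens_id P (s * Q) (Q * s) (b i * r) (swap_op s Q)"
  let ?m0 = "P * (s * Q) * (b i * r)" and ?m1 = "P * (Q * s) * (b i * r)"
    and ?m2 = "P * Q * (s' * a (Suc i)) * r" and ?m3 = "P * (s' * Q) * (a (Suc i) * r)"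
    and ?m4 = "P * (s' * Q) * work_dim p (Suc t) * 1"
  have M: "mems \<theta> t js * work_dim p t = ?m0"
    using js by (simp add: w P_def Q_def s_def i_def j_def cur_mem_def)
  have M': "mems \<theta> (Suc t) js * work_dim p (Suc t) = ?m4"
    using js by (simp add: mems_Suc_idle P_def Q_def s'_def i_def j_def cur_mem_Suc)
  have st: "proc_step \<theta> js p t = ?A \<circ> (?B \<circ> (?C \<circ> ?D))"
    unfolding j_def r_def P_def Q_def i_def s_def s'_def
    by (rule ext) (use js in \<open>simp add: proc_step_active j_def\<close>)
  have D: "?D X \<in> carrier_mat ?m1 ?m1" for X by (rule tens_id_carrier)
  have C: "(?C \<circ> ?D) X \<in> carrier_mat ?m2 ?m2" for X by (simp only: o_apply tens_id_carrier)
  have B: "(?B \<circ> (?C \<circ> ?D)) X \<in> carrier_mat ?m3 ?m3" for X by (simp only: o_apply tens_id_carrier)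
  have "tens_id l (mems \<theta> t js * work_dim p t) (mems \<theta> (Suc t) js * work_dim p (Suc t)) r' (proc_step \<theta> js p t) X =
    tens_id l ?m3 ?m4 r' ?A (tens_id l ?m2 ?m3 r' ?B (tens_id l ?m1 ?m2 r' ?C (tens_id l ?m0 ?m1 r' ?D X)))"
    unfolding M M' st by (simp only: tens_id_comp[OF D, symmetric] tens_id_comp[OF C, symmetric] tens_id_comp[OF B, symmetric])
  also have "tens_id l ?m0 ?m1 r' ?D X = tens_id (l * P) (s * Q) (Q * s) (b i * (r * r')) (swap_op s Q) X"
    by (rule tens_id_nest') (simp_all add: mult_ac)
  also have "tens_id l ?m1 ?m2 r' ?C \<dots> = tens_id (l * P * Q) (s * b i) (s' * a (Suc i)) (r * r') (comb_chan (\<theta> j) (Suc i)) \<dots>"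
    by (rule tens_id_nest') (simp_all add: mult_ac)
  also have "tens_id l ?m2 ?m3 r' ?B \<dots> = tens_id (l * P) (Q * s') (s' * Q) (a (Suc i) * (r * r')) (swap_op Q s') \<dots>"
    by (rule tens_id_nest') (simp_all add: mult_ac)
  also have "tens_id l ?m3 ?m4 r' ?A \<dots> = tens_id (l * P * (s' * Q)) (a (Suc i) * r) (work_dim p (Suc t)) r' (step_link p t) \<dots>"
    by (rule tens_id_nest') (simp_all add: mult_ac)
  finally show ?thesis .
qed

lemma tens_id_proc_step_idle:
  assumes "c t \<notin> set js"
  shows "tens_id l (mems \<theta> t js * work_dim p t) (mems \<theta> (Suc t) js * work_dim p (Suc t)) r' (proc_step \<theta> js p t) X =
    tens_id (l * mems \<theta> t js) (work_dim p t) (work_dim p (Suc t)) r' (step_link p t) X"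
proof -
  have "proc_step \<theta> js p t = tens_id (mems \<theta> t js) (work_dim p t) (work_dim p (Suc t)) 1 (step_link p t)"
    using assms by (intro ext) (rule proc_step_idle)
  then show ?thesis using assms by (simp only:) (rule tens_id_nest', simp_all add: mems_Suc_idle)
qed

text \<open>While another copy acts, the memory of \<open>j\<close> at the head of the list is a
  spectator on the left.\<close>

lemma proc_step_Cons:
  assumes "c t \<noteq> j" and v: "valid_at js p t" and "distinct js"
  shows "proc_step \<theta> (j # js) p t X =
    tens_id (cur_mem \<theta> t j) (mems \<theta> t js * work_dim p t) (mems \<theta> (Suc t) js * work_dim p (Suc t)) 1
      (proc_step \<theta> js p t) X"
proof (cases "c t \<in> set js")
  case False
  then show ?thesis
    using assms(1) by (subst tens_id_proc_step_idle[OF False]) (simp add: proc_step_idle)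
next
  case True
  then obtain ps qs where js: "js = ps @ c t # qs" by (auto dest: split_list)
  with \<open>distinct js\<close> have d: "c t \<notin> set ps" "c t \<notin> set qs" by auto
  have w: "work_dim p t = b (count_upto c t (c t)) * ref_dim p t"
    using v True by (simp add: valid_at_def)
  have js': "j # js = (j # ps) @ c t # qs" "c t \<notin> set (j # ps)" using js d assms(1) by auto
  show ?thesis
    unfolding tens_id_proc_step_active[OF js d w] proc_step_active[OF js' d(2)] by simp
qed

section \<open>The channels in the slots of one copy\<close>

text \<open>Everything that happens between two components of copy \<open>j\<close> is the channel inserted into the slot
  between them; the memories of the other copies are part of its reference.\<close>

primrec segment :: "(nat \<Rightarrow> qcomb) \<Rightarrow> nat \<Rightarrow> nat list \<Rightarrow> process \<Rightarrow> nat \<Rightarrow> qmap" where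
  "segment \<theta> j js p 0 X = X"
| "segment \<theta> j js p (Suc t) X =
    (if c t = j
     then tens_id (mems \<theta> t js) (mid_dim (j # js) p t) (work_dim p (Suc t)) 1 (step_link p t)
       (swap_op (mid_dim (j # js) p t) (mems \<theta> t js) X)
     else proc_step \<theta> js p t (segment \<theta> j js p t X))"

text \<open>Slot \<open>i\<close> ends when component \<open>Suc i\<close> of copy \<open>j\<close>
  acts, and this is the time of that step. The count keeps the value \<open>Suc i\<close> until the
  next component, which is why the least time is taken.\<close>

definition slot_time :: "nat \<Rightarrow> nat \<Rightarrow> nat" where
  "slot_time j i = (LEAST t. count_upto c (Suc t) j = Suc i)"

definition slot_ref :: "(nat \<Rightarrow> qcomb) \<Rightarrow> nat \<Rightarrow> nat list \<Rightarrow> process \<Rightarrow> nat \<Rightarrow> nat" where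
  "slot_ref \<theta> j js p i = ref_dim p (slot_time j i) * mems \<theta> (slot_time j i) js"

text \<open>The final swap moves the memories of the other copies behind \<open>W\<close>, since a
  comb expects its input in front and the reference last. The next segment begins by undoing this
  move.\<close>

definition slot_chan :: "(nat \<Rightarrow> qcomb) \<Rightarrow> nat \<Rightarrow> nat list \<Rightarrow> process \<Rightarrow> nat \<Rightarrow> qmap" where
  "slot_chan \<theta> j js p i X = swap_op (mems \<theta> (slot_time j i) js) (work_dim p (slot_time j i))
     (segment \<theta> j js p (slot_time j i) X)"

text \<open>Slot 0 is the channel preceding the comb and starts from the initial system of the run;
  a later slot starts from a comb output together with the previous reference.\<close>

definition source_dim :: "(nat \<Rightarrow> qcomb) \<Rightarrow> nat \<Rightarrow> nat list \<Rightarrow> process \<Rightarrow> nat \<Rightarrow> nat" where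
  "source_dim \<theta> j js p i = (if i = 0 then work_dim p 0 else a i * slot_ref \<theta> j js p (i - 1))"

lemma slot_time_eq: "c t = j \<Longrightarrow> slot_time j (count_upto c t j) = t"
  unfolding slot_time_def
proof (rule Least_equality)
  fix t' assume "c t = j" and *: "count_upto c (Suc t') j = Suc (count_upto c t j)"
  show "t \<le> t'"
  proof (rule ccontr)
    assume "\<not> t \<le> t'"
    then have "count_upto c (Suc t') j \<le> count_upto c t j" by (intro count_upto_mono) simp
    with * show False by simp
  qed
qed simp

lemma slot_time_ex:
  assumes "i < count_upto c T j"
  shows "\<exists>t<T. c t = j \<and> count_upto c t j = i"
  using assms
proof (induction T)
  case (Suc T)
  show ?case
  proof (cases "i < count_upto c T j")
    case True
    with Suc.IH show ?thesis using less_SucI by blast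
  next
    case False
    with Suc.prems have "c T = j" "count_upto c T j = i" by (auto split: if_splits)
    then show ?thesis by blast
  qed
qed simp

lemma segment_cong:
  assumes "\<And>x. x \<in> set js \<Longrightarrow> \<theta> x = \<theta>' x"
  shows "segment \<theta> j js p t X = segment \<theta>' j js p t X"
  by (induction t) (simp_all add: proc_step_cong[OF assms] mems_cong[OF assms])

text \<open>The slots of copy \<open>j\<close> depend only on the combs of the copies in
  \<open>js\<close>. They are therefore unaffected when copy \<open>j\<close> itself is replaced by
  \<Omega>.\<close>

lemma slot_cong:
  assumes "\<And>x. x \<in> set js \<Longrightarrow> \<theta> x = \<theta>' x"
  shows "slot_ref \<theta> j js p = slot_ref \<theta>' j js p" "slot_chan \<theta> j js p = slot_chan \<theta>' j js p"
proof -
  have m: "mems \<theta> t js = mems \<theta>' t js" for t by (rule mems_cong) (rule assms)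
  show "slot_ref \<theta> j js p = slot_ref \<theta>' j js p" by (rule ext) (simp add: slot_ref_def m)
  show "slot_chan \<theta> j js p = slot_chan \<theta>' j js p"
    by (intro ext) (simp add: slot_chan_def m segment_cong[OF assms])
qed

lemma valid_at_tl: "valid_at (j # js) p t \<Longrightarrow> c t \<noteq> j \<Longrightarrow> valid_at js p t"
  by (auto simp: valid_at_def mid_dim_def split: if_splits)

context
  fixes \<theta> :: "nat \<Rightarrow> qcomb" and j :: nat and js :: "nat list" and p :: process and T :: nat
  assumes vp: "valid_process (j # js) p T" and vc: "valid_combs \<theta> js T" and dist: "distinct (j # js)"
begin

lemma valid_at_process: "t < T \<Longrightarrow> valid_at (j # js) p t"
  using vp by (simp add: valid_process_def)

text \<open>The current segment started at the latest component of \<open>j\<close>, so its source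
  is determined by the number of components of \<open>j\<close> applied so far.\<close>

lemma channel_segment:
  assumes "t \<le> T"
  shows "channel (source_dim \<theta> j js p (count_upto c t j)) (mems \<theta> t js * work_dim p t) (segment \<theta> j js p t)"
  using assms
proof (induction t)
  case 0
  then show ?case
    using mems_0[OF vc] channel_id[of "work_dim p 0"] vp by (simp add: valid_process_def id_def source_dim_def)
next
  case (Suc t)
  have v: "valid_at (j # js) p t" using valid_at_process Suc.prems by simp
  have vc': "valid_combs \<theta> js (Suc t)" using valid_combs_le[OF vc] Suc.prems by simp
  show ?case
  proof (cases "c t = j")
    case False
    have "channel (mems \<theta> t js * work_dim p t) (mems \<theta> (Suc t) js * work_dim p (Suc t)) (proc_step \<theta> js p t)"
      using channel_proc_step[OF valid_at_tl[OF v False] vc'] dist by simp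
    from channel_comp[OF Suc.IH this] show ?thesis
      using Suc.prems by - (rule channel_cong, use False in \<open>auto simp: o_def\<close>)
  next
    case True
    let ?i = "count_upto c t j" and ?Q = "mems \<theta> t js" and ?n = "mid_dim (j # js) p t"
    have L: "channel ?n (work_dim p (Suc t)) (step_link p t)" using v by (simp add: valid_at_def)
    have Q: "0 < ?Q" using mems_pos[OF valid_combs_le[OF vc]] Suc.prems by simp
    have Q': "mems \<theta> (Suc t) js = ?Q" using dist True by (intro mems_Suc_idle) auto
    have n: "?n = a (Suc ?i) * ref_dim p t" using True by (simp add: mid_dim_def)
    have "source_dim \<theta> j js p (count_upto c (Suc t) j) = ?n * ?Q"
      using True slot_time_eq[OF True] by (simp add: source_dim_def slot_ref_def n)
    moreover have "channel (?n * ?Q) (?Q * ?n) (swap_op ?n ?Q)"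
      using channel_pos(1)[OF L] Q by (rule channel_swap_op)
    moreover have "channel (?Q * ?n) (?Q * work_dim p (Suc t)) (tens_id ?Q ?n (work_dim p (Suc t)) 1 (step_link p t))"
      using channel_tens_id[OF L Q, of 1] by simp
    ultimately have "channel (source_dim \<theta> j js p (count_upto c (Suc t) j)) (mems \<theta> (Suc t) js * work_dim p (Suc t))
        (tens_id ?Q ?n (work_dim p (Suc t)) 1 (step_link p t) \<circ> swap_op ?n ?Q)"
      unfolding Q' by (metis channel_comp)
    then show ?thesis by (rule channel_cong) (use True in simp)
  qed
qed

lemma channel_slot:
  assumes "i < count_upto c T j"
  shows "channel (source_dim \<theta> j js p i) (b i * slot_ref \<theta> j js p i) (slot_chan \<theta> j js p i)"
proof -
  obtain t where t: "t < T" "c t = j" "count_upto c t j = i" using slot_time_ex[OF assms] by blast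
  have st: "slot_time j i = t" using slot_time_eq[OF t(2)] t(3) by simp
  have v: "valid_at (j # js) p t" using valid_at_process t by simp
  have seg: "channel (source_dim \<theta> j js p i) (mems \<theta> t js * work_dim p t) (segment \<theta> j js p t)"
    using channel_segment[of t] t by simp
  have "work_dim p t = b i * ref_dim p t" "0 < work_dim p t" using v t by (auto simp: valid_at_def)
  moreover have "0 < mems \<theta> t js" using mems_pos[OF valid_combs_le[OF vc]] t by simp
  then have "channel (mems \<theta> t js * work_dim p t) (work_dim p t * mems \<theta> t js) (swap_op (mems \<theta> t js) (work_dim p t))"
    using \<open>0 < work_dim p t\<close> by (rule channel_swap_op)
  from channel_comp[OF seg this]
  have "channel (source_dim \<theta> j js p i) (work_dim p t * mems \<theta> t js) (slot_chan \<theta> j js p i)"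
    by (rule channel_cong) (simp add: slot_chan_def st)
  ultimately show ?thesis by (simp add: slot_ref_def st mult_ac)
qed

context
  assumes mem0: "comb_mem (\<theta> j) 0 = 1"
begin

text \<open>The state right after component \<open>i\<close> of copy \<open>j\<close>, computed from
  the comb. For \<open>i = 0\<close> the state is still the input, as slot 0 is in progress;
  otherwise slot 0 is applied explicitly because \<open>comb_apply\<close> leaves it out.\<close>

definition comb_stage :: "nat \<Rightarrow> qmap" where
  "comb_stage i X = comb_apply a b (\<theta> j) (slot_ref \<theta> j js p) (slot_chan \<theta> j js p) i
     (if i = 0 then X else slot_chan \<theta> j js p 0 X)"

text \<open>When copy \<open>j\<close> is about to act, moving the other memories to the end
  completes the current segment to a slot channel. For slot 0 the memory of \<open>j\<close> is
  trivial, so the channel acts alone.\<close>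

lemma slot_stage:
  fixes t X
  defines "i \<equiv> count_upto c t j" and "Q \<equiv> mems \<theta> t js" and "w \<equiv> work_dim p t"
  assumes t: "t < T" "c t = j" and X: "X \<in> carrier_mat (work_dim p 0) (work_dim p 0)"
    and run: "proc_run \<theta> (j # js) p t X = tens_id (cur_mem \<theta> t j) (source_dim \<theta> j js p i) (Q * w) 1
      (segment \<theta> j js p t) (comb_stage i X)"
  shows "tens_id (cur_mem \<theta> t j) (Q * w) (w * Q) 1 (swap_op Q w) (proc_run \<theta> (j # js) p t X) =
    (if i = 0 then slot_chan \<theta> j js p 0 X
     else slot_apply a b (\<theta> j) (slot_ref \<theta> j js p) (slot_chan \<theta> j js p) i (comb_stage i X))"
proof -
  have st: "slot_time j i = t" using slot_time_eq[OF t(2)] by (simp add: i_def)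
  have seg: "channel (source_dim \<theta> j js p i) (Q * w) (segment \<theta> j js p t)"
    using channel_segment[of t] t by (simp add: i_def Q_def w_def)
  have wQ: "w * Q = b i * slot_ref \<theta> j js p i"
    using valid_at_process[OF t(1)] t(2) by (simp add: valid_at_def slot_ref_def st[unfolded i_def] w_def Q_def i_def)
  have sc: "swap_op Q w \<circ> segment \<theta> j js p t = slot_chan \<theta> j js p i"
    by (rule ext) (simp add: slot_chan_def st Q_def w_def)
  have eq: "tens_id (cur_mem \<theta> t j) (Q * w) (w * Q) 1 (swap_op Q w) (proc_run \<theta> (j # js) p t X) =
    tens_id (cur_mem \<theta> t j) (source_dim \<theta> j js p i) (w * Q) 1 (slot_chan \<theta> j js p i) (comb_stage i X)"
    unfolding run sc[symmetric] by (rule tens_id_comp) (rule channelD(2)[OF seg])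
  show ?thesis
  proof (cases "i = 0")
    case True
    have "cur_mem \<theta> t j = 1" using mem0 True by (simp add: cur_mem_def i_def)
    moreover have "slot_chan \<theta> j js p 0 X \<in> carrier_mat (w * Q) (w * Q)"
      by (simp add: slot_chan_def st[unfolded True] Q_def w_def swap_op_carrier)
    ultimately show ?thesis
      unfolding eq using True X tens_id_trivial[of X "work_dim p 0" "slot_chan \<theta> j js p 0" "w * Q"]
      by (simp add: source_dim_def comb_stage_def)
  next
    case False
    then show ?thesis unfolding eq
      by (simp add: slot_apply_def source_dim_def cur_mem_def i_def[symmetric] wQ)
  qed
qed

lemma proc_step_stage:
  fixes t X
  defines "i \<equiv> count_upto c t j" and "Q \<equiv> mems \<theta> t js" and "r \<equiv> ref_dim p t"
  defines "s' \<equiv> comb_mem (\<theta> j) (Suc i)"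
  assumes t: "t < T" "c t = j" and X: "X \<in> carrier_mat (work_dim p 0) (work_dim p 0)"
    and run: "proc_run \<theta> (j # js) p t X = tens_id (cur_mem \<theta> t j) (source_dim \<theta> j js p i)
      (Q * work_dim p t) 1 (segment \<theta> j js p t) (comb_stage i X)"
  shows "proc_run \<theta> (j # js) p (Suc t) X =
    tens_id (s' * Q) (a (Suc i) * r) (work_dim p (Suc t)) 1 (step_link p t)
      (tens_id s' (a (Suc i) * r * Q) (Q * (a (Suc i) * r)) 1 (swap_op (a (Suc i) * r) Q) (comb_stage (Suc i) X))"
proof -
  let ?Y = "proc_run \<theta> (j # js) p t X" and ?s = "comb_mem (\<theta> j) i"
  have s: "cur_mem \<theta> t j = ?s" by (simp add: cur_mem_def i_def)
  have st: "slot_time j i = t" using slot_time_eq[OF t(2)] by (simp add: i_def)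
  have w: "work_dim p t = b i * r"
    using valid_at_process[OF t(1)] t(2) by (simp add: valid_at_def i_def r_def)
  have Y: "?Y \<in> carrier_mat (?s * (Q * (b i * r))) (?s * (Q * (b i * r)))"
    unfolding run s w using tens_id_carrier[of ?s _ "Q * (b i * r)" 1] by simp
  have stage: "comb_stage (Suc i) X = tens_id 1 (?s * b i) (s' * a (Suc i)) (r * Q) (comb_chan (\<theta> j) (Suc i))
     (tens_id ?s (Q * (b i * r)) (b i * r * Q) 1 (swap_op Q (b i * r)) ?Y)"
    using slot_stage[OF t X] run by (simp add: comb_stage_def s w slot_ref_def st r_def Q_def s'_def flip: i_def)
  have "proc_run \<theta> (j # js) p (Suc t) X =
    tens_id (1 * (s' * Q)) (a (Suc i) * r) (work_dim p (Suc t)) 1 (step_link p t)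
      (tens_id 1 (Q * s') (s' * Q) (a (Suc i) * r) (swap_op Q s')
        (tens_id (1 * Q) (?s * b i) (s' * a (Suc i)) r (comb_chan (\<theta> j) (Suc i))
          (tens_id 1 (?s * Q) (Q * ?s) (b i * r) (swap_op ?s Q) ?Y)))"
    using proc_step_active[of "j # js" "[]" t js \<theta> p ?Y] t dist
    by (simp add: Q_def r_def i_def s'_def)
  then show ?thesis
    using conjugate_by_swap[OF Y, of s' "a (Suc i)" "comb_chan (\<theta> j) (Suc i)"] by (simp add: stage)
qed

text \<open>The invariant that identifies the run with an application of the comb
  \<open>\<theta> j\<close>: the stage reached so far, followed by the unfinished segment. Steps of
  other copies extend the segment; a step of \<open>j\<close> closes the slot, applies the component
  and opens a new segment.\<close>

lemma proc_run_stage: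
  assumes "t \<le> T" and X: "X \<in> carrier_mat (work_dim p 0) (work_dim p 0)"
  shows "proc_run \<theta> (j # js) p t X =
    tens_id (cur_mem \<theta> t j) (source_dim \<theta> j js p (count_upto c t j)) (mems \<theta> t js * work_dim p t) 1
      (segment \<theta> j js p t) (comb_stage (count_upto c t j) X)"
  using assms(1)
proof (induction t)
  case 0
  have "cur_mem \<theta> 0 j = 1" using mem0 by (simp add: cur_mem_def)
  then show ?case
    using mems_0[OF vc] tens_id_id[of X 1 "work_dim p 0" 1] X
    by (simp add: source_dim_def comb_stage_def id_def)
next
  case (Suc t)
  then have IH: "proc_run \<theta> (j # js) p t X =
    tens_id (cur_mem \<theta> t j) (source_dim \<theta> j js p (count_upto c t j)) (mems \<theta> t js * work_dim p t) 1
      (segment \<theta> j js p t) (comb_stage (count_upto c t j) X)" and t: "t < T" by auto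
  have seg: "channel (source_dim \<theta> j js p (count_upto c t j)) (mems \<theta> t js * work_dim p t) (segment \<theta> j js p t)"
    using channel_segment[of t] t by simp
  show ?case
  proof (cases "c t = j")
    case False
    have "proc_run \<theta> (j # js) p (Suc t) X = tens_id (cur_mem \<theta> t j) (mems \<theta> t js * work_dim p t)
        (mems \<theta> (Suc t) js * work_dim p (Suc t)) 1 (proc_step \<theta> js p t) (proc_run \<theta> (j # js) p t X)"
      using proc_step_Cons[OF False valid_at_tl[OF valid_at_process[OF t] False]] dist by simp
    also have "\<dots> = tens_id (cur_mem \<theta> t j) (source_dim \<theta> j js p (count_upto c t j)) (mems \<theta> (Suc t) js * work_dim p (Suc t)) 1
        (proc_step \<theta> js p t \<circ> segment \<theta> j js p t) (comb_stage (count_upto c t j) X)"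
      unfolding IH by (rule tens_id_comp) (rule channelD(2)[OF seg])
    also have "proc_step \<theta> js p t \<circ> segment \<theta> j js p t = segment \<theta> j js p (Suc t)"
      using False by (intro ext) simp
    finally show ?thesis using False by (simp add: cur_mem_Suc)
  next
    case True
    define i Q r s' where "i = count_upto c t j" and "Q = mems \<theta> t js" and "r = ref_dim p t"
      and "s' = comb_mem (\<theta> j) (Suc i)"
    let ?n = "a (Suc i) * r"
    have st: "slot_time j i = t" using slot_time_eq[OF True] by (simp add: i_def)
    have n: "mid_dim (j # js) p t = ?n" using True by (simp add: mid_dim_def i_def r_def)
    have Q': "mems \<theta> (Suc t) js = Q" using dist True mems_Suc_idle[of t js] by (auto simp: Q_def)
    have seg': "tens_id Q ?n (work_dim p (Suc t)) 1 (step_link p t) \<circ> swap_op ?n Q = segment \<theta> j js p (Suc t)"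
      using True by (intro ext) (simp add: n flip: Q_def)
    have src: "source_dim \<theta> j js p (Suc i) = ?n * Q"
      by (simp add: source_dim_def slot_ref_def st r_def Q_def)
    have "proc_run \<theta> (j # js) p (Suc t) X =
      tens_id (s' * Q) ?n (work_dim p (Suc t)) 1 (step_link p t)
        (tens_id s' (?n * Q) (Q * ?n) 1 (swap_op ?n Q) (comb_stage (Suc i) X))"
      using proc_step_stage[OF t True X IH] by (simp only: s'_def i_def Q_def r_def)
    also have "\<dots> = tens_id s' (Q * ?n) (Q * work_dim p (Suc t)) 1
        (tens_id Q ?n (work_dim p (Suc t)) 1 (step_link p t)) (tens_id s' (?n * Q) (Q * ?n) 1 (swap_op ?n Q) (comb_stage (Suc i) X))"
      by (rule tens_id_nest'[symmetric]) auto
    also have "\<dots> = tens_id s' (?n * Q) (Q * work_dim p (Suc t)) 1 (segment \<theta> j js p (Suc t)) (comb_stage (Suc i) X)"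
      unfolding seg'[symmetric] by (rule tens_id_comp) (rule swap_op_carrier)
    finally show ?thesis
      using True by (simp add: Q' src cur_mem_Suc s'_def del: segment.simps flip: i_def)
  qed
qed

end

end

section \<open>Absorption of a known copy into the common links\<close>

text \<open>Once copy \<open>j\<close> is the same comb \<open>\<Omega>\<close> under both hypotheses, its memory joins \<open>W\<close> as the last factor
  and its components join the links.\<close>

definition absorb :: "nat list \<Rightarrow> nat \<Rightarrow> qcomb \<Rightarrow> process \<Rightarrow> process" where
  "absorb js j \<Omega> p = (let m = (\<lambda>t. comb_mem \<Omega> (count_upto c t j)) in
    \<lparr>work_dim = (\<lambda>t. work_dim p t * m t), ref_dim = (\<lambda>t. ref_dim p t * m t),
     step_link = (\<lambda>t.
       if c t = j then
         let i = count_upto c t j; r = ref_dim p t; s = comb_mem \<Omega> i; s' = comb_mem \<Omega> (Suc i)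
         in tens_id 1 (a (Suc i) * r) (work_dim p (Suc t)) s' (step_link p t)
            \<circ> (swap_op s' (a (Suc i) * r) \<circ> (tens_id 1 (s * b i) (s' * a (Suc i)) r (comb_chan \<Omega> (Suc i))
            \<circ> swap_op (b i * r) s))
       else tens_id 1 (mid_dim js p t) (work_dim p (Suc t)) (m t) (step_link p t))\<rparr>)"

context
  fixes \<theta> :: "nat \<Rightarrow> qcomb" and j :: nat and js :: "nat list" and p :: process and T :: nat
  assumes vp: "valid_process (j # js) p T" and vc: "valid_combs \<theta> (j # js) T" and dist: "distinct (j # js)"
begin

private abbreviation (input) p' where "p' \<equiv> absorb js j (\<theta> j) p"

lemma absorb_dims: "work_dim p' t = work_dim p t * cur_mem \<theta> t j" "ref_dim p' t = ref_dim p t * cur_mem \<theta> t j"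
  by (simp_all add: absorb_def cur_mem_def)

lemma absorb_mid:
  assumes "c t \<noteq> j"
  shows "mid_dim js p' t = mid_dim js p t * cur_mem \<theta> t j" "mid_dim (j # js) p t = mid_dim js p t"
  using assms by (simp_all add: mid_dim_def absorb_dims)

lemma cur_mem_head_pos: "t \<le> T \<Longrightarrow> 0 < cur_mem \<theta> t j"
  using valid_combs_le[OF vc] by (intro cur_mem_pos) (simp add: valid_combs_def)

lemma valid_at_absorb:
  assumes t: "t < T"
  shows "valid_at js p' t"
proof -
  have v: "valid_at (j # js) p t" using vp t by (simp add: valid_process_def)
  have m: "0 < cur_mem \<theta> t j" "0 < cur_mem \<theta> (Suc t) j" using cur_mem_head_pos t by simp_all
  have L: "channel (mid_dim (j # js) p t) (work_dim p (Suc t)) (step_link p t)" and w: "0 < work_dim p t"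
    using v by (simp_all add: valid_at_def)
  show ?thesis
  proof (cases "c t = j")
    case False
    have "channel (mid_dim js p t * cur_mem \<theta> t j) (work_dim p (Suc t) * cur_mem \<theta> t j)
        (tens_id 1 (mid_dim js p t) (work_dim p (Suc t)) (cur_mem \<theta> t j) (step_link p t))"
      using channel_tens_id[OF L, of 1 "cur_mem \<theta> t j"] m absorb_mid[OF False] by simp
    moreover have "step_link p' t = tens_id 1 (mid_dim js p t) (work_dim p (Suc t)) (cur_mem \<theta> t j) (step_link p t)"
      using False by (simp add: absorb_def cur_mem_def)
    ultimately show ?thesis
      using v m False absorb_mid[OF False] by (auto simp: valid_at_def absorb_dims cur_mem_Suc)
  next
    case True
    define i r s s' where "i = count_upto c t j" and "r = ref_dim p t" and "s = comb_mem (\<theta> j) i" and "s' = comb_mem (\<theta> j) (Suc i)"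
    have cm: "cur_mem \<theta> t j = s" "cur_mem \<theta> (Suc t) j = s'"
      using True by (simp_all add: cur_mem_def s_def s'_def i_def)
    have w': "work_dim p t = b i * r" using v True by (simp add: valid_at_def i_def r_def)
    have n: "mid_dim (j # js) p t = a (Suc i) * r" using True by (simp add: mid_dim_def i_def r_def)
    have "open_comb (Suc i) a b (\<theta> j)"
      using valid_combs_le[OF vc, of "Suc t"] t True by (simp add: valid_combs_def i_def)
    then have N: "channel (s * b i) (s' * a (Suc i)) (comb_chan (\<theta> j) (Suc i))"
      by (simp add: open_comb_def s_def s'_def)
    have r: "0 < r" using w w' by simp
    have "channel (b i * r * s) (s * (b i * r)) (swap_op (b i * r) s)"
      using w m by (intro channel_swap_op) (simp_all add: w' cm)
    moreover have "channel (s * b i * r) (s' * a (Suc i) * r) (tens_id 1 (s * b i) (s' * a (Suc i)) r (comb_chan (\<theta> j) (Suc i)))"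
      using channel_tens_id[OF N, of 1 r] r by simp
    moreover have "channel (s' * (a (Suc i) * r)) (a (Suc i) * r * s') (swap_op s' (a (Suc i) * r))"
      using channel_pos(1)[OF L] m by (intro channel_swap_op) (simp_all add: n cm)
    moreover have "channel (a (Suc i) * r * s') (work_dim p (Suc t) * s') (tens_id 1 (a (Suc i) * r) (work_dim p (Suc t)) s' (step_link p t))"
      using channel_tens_id[OF L, of 1 s'] m by (simp add: n cm)
    ultimately have "channel (b i * r * s) (work_dim p (Suc t) * s')
      (tens_id 1 (a (Suc i) * r) (work_dim p (Suc t)) s' (step_link p t)
            \<circ> (swap_op s' (a (Suc i) * r) \<circ> (tens_id 1 (s * b i) (s' * a (Suc i)) r (comb_chan (\<theta> j) (Suc i))
            \<circ> swap_op (b i * r) s)))"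
      by (metis channel_comp mult.assoc)
    moreover have "c t \<notin> set js" using True dist by auto
    ultimately show ?thesis
      using w m True by (auto simp: valid_at_def mid_dim_def absorb_def Let_def w' cur_mem_def s_def s'_def i_def r_def)
  qed
qed

lemma valid_process_absorb: "valid_process js p' T"
  using vp valid_at_absorb cur_mem_head_pos[of 0] by (simp add: valid_process_def absorb_dims)

lemma tens_id_proc_step_absorb:
  assumes t: "t < T" "c t \<noteq> j"
  shows "tens_id 1 (mems \<theta> t js * work_dim p t) (mems \<theta> (Suc t) js * work_dim p (Suc t)) (cur_mem \<theta> t j)
    (proc_step \<theta> js p t) X = proc_step \<theta> js p' t X"
proof -
  let ?m = "cur_mem \<theta> t j"
  have lk: "step_link p' t = tens_id 1 (mid_dim js p t) (work_dim p (Suc t)) ?m (step_link p t)"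
    using t by (simp add: absorb_def cur_mem_def)
  have m': "cur_mem \<theta> (Suc t) j = ?m" using t by (simp add: cur_mem_Suc)
  have v: "valid_at js p t" using vp t valid_at_tl unfolding valid_process_def by blast
  show ?thesis
  proof (cases "c t \<in> set js")
    case False
    then have n: "mid_dim js p t = work_dim p t" by (simp add: mid_dim_def)
    have "proc_step \<theta> js p' t X = tens_id (mems \<theta> t js) (work_dim p t * ?m) (work_dim p (Suc t) * ?m) 1
       (tens_id 1 (work_dim p t) (work_dim p (Suc t)) ?m (step_link p t)) X"
      by (simp add: proc_step_idle[OF False] absorb_dims lk n m')
    also have "\<dots> = tens_id (1 * mems \<theta> t js) (work_dim p t) (work_dim p (Suc t)) ?m (step_link p t) X"
      by (rule tens_id_nest') auto
    finally show ?thesis unfolding tens_id_proc_step_idle[OF False] by simp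
  next
    case True
    then obtain ps qs where js: "js = ps @ c t # qs" by (auto dest: split_list)
    with dist have d: "c t \<notin> set ps" "c t \<notin> set qs" by auto
    have w: "work_dim p t = b (count_upto c t (c t)) * ref_dim p t"
      using v True by (simp add: valid_at_def)
    let ?n = "a (Suc (count_upto c t (c t))) * ref_dim p t"
    have n: "mid_dim js p t = ?n" using True by (simp add: mid_dim_def)
    have L: "tens_id k (?n * ?m) (work_dim p (Suc t) * ?m) 1 (tens_id 1 ?n (work_dim p (Suc t)) ?m (step_link p t)) Z =
      tens_id (1 * k) ?n (work_dim p (Suc t)) ?m (step_link p t) Z" for k Z
      by (rule tens_id_nest') auto
    show ?thesis
      unfolding tens_id_proc_step_active[OF js d w] proc_step_active[OF js d] absorb_dims lk n m'
      using L by (simp add: mult.assoc)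
  qed
qed

text \<open>The two runs describe the same process with the memory of \<open>j\<close> at opposite
  ends, so a swap relates them at every time. Steps of other copies commute with this swap by
  naturality; a step of \<open>j\<close> is compared through the hexagon identities.\<close>

lemma proc_run_absorb:
  assumes "t \<le> T" and X: "X \<in> carrier_mat (work_dim p 0) (work_dim p 0)"
  shows "proc_run \<theta> js p' t X =
    swap_op (cur_mem \<theta> t j) (mems \<theta> t js * work_dim p t) (proc_run \<theta> (j # js) p t X)"
  using assms(1)
proof (induction t)
  case 0
  have "valid_combs \<theta> js T" "cur_mem \<theta> 0 j = 1"
    using vc by (simp_all add: valid_combs_def cur_mem_def open_comb_def)
  then show ?case using X by (simp add: mems_0 swap_op_trivial[unfolded One_nat_def])
next
  case (Suc t)
  then have t: "t < T" by simp
  let ?Y = "proc_run \<theta> (j # js) p t X" and ?s = "cur_mem \<theta> t j"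
  have Y: "?Y \<in> carrier_mat (?s * (mems \<theta> t js * work_dim p t)) (?s * (mems \<theta> t js * work_dim p t))"
    using channelD(2)[OF channel_proc_run[OF valid_process_le[OF vp] valid_combs_le[OF vc] dist] X, of t] t
    by (simp add: mult.assoc)
  have Z: "proc_run \<theta> js p' t X = swap_op ?s (mems \<theta> t js * work_dim p t) ?Y"
    using Suc by simp
  show ?case
  proof (cases "c t = j")
    case False
    have v: "valid_at js p t" using vp t False valid_at_tl unfolding valid_process_def by blast
    have "proc_run \<theta> js p' (Suc t) X = tens_id 1 (mems \<theta> t js * work_dim p t) (mems \<theta> (Suc t) js * work_dim p (Suc t)) ?s
       (proc_step \<theta> js p t) (swap_op ?s (mems \<theta> t js * work_dim p t) ?Y)"
      by (simp add: tens_id_proc_step_absorb[OF t False, unfolded One_nat_def] Z)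
    also have "\<dots> = swap_op ?s (mems \<theta> (Suc t) js * work_dim p (Suc t)) (tens_id ?s (mems \<theta> t js * work_dim p t) (mems \<theta> (Suc t) js * work_dim p (Suc t)) 1
       (proc_step \<theta> js p t) ?Y)"
      by (rule swap_op_tens_id_right[symmetric])
    also have "tens_id ?s (mems \<theta> t js * work_dim p t) (mems \<theta> (Suc t) js * work_dim p (Suc t)) 1
       (proc_step \<theta> js p t) ?Y = proc_run \<theta> (j # js) p (Suc t) X"
      using proc_step_Cons[OF False v] dist by simp
    finally show ?thesis using False by (simp add: cur_mem_Suc)
  next
    case True
    define i Q r s s' w' where "i = count_upto c t j" and "Q = mems \<theta> t js" and "r = ref_dim p t"
      and "s = comb_mem (\<theta> j) i" and "s' = comb_mem (\<theta> j) (Suc i)" and "w' = work_dim p (Suc t)"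
    let ?A = "a (Suc i)" and ?B = "b i" and ?N = "comb_chan (\<theta> j) (Suc i)" and ?L = "step_link p t"
    have cm: "cur_mem \<theta> t j = s" "cur_mem \<theta> (Suc t) j = s'"
      using True by (simp_all add: cur_mem_def s_def s'_def i_def)
    have w: "work_dim p t = ?B * r" using vp t True by (simp add: valid_process_def valid_at_def i_def r_def)
    have idle: "c t \<notin> set js" using True dist by auto
    have Q': "mems \<theta> (Suc t) js = Q" using idle by (simp add: mems_Suc_idle Q_def)
    define Z where "Z = swap_op s (Q * (?B * r)) ?Y"
    define U where "U = tens_id 1 (s * Q) (Q * s) (?B * r) (swap_op s Q) ?Y"
    define V where "V = tens_id Q (s * ?B) (s' * ?A) r ?N U"
    define S where "S = tens_id 1 (Q * s') (s' * Q) (?A * r) (swap_op Q s') V"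
    have run: "proc_run \<theta> (j # js) p (Suc t) X = tens_id (s' * Q) (?A * r) w' 1 ?L S"
      using proc_step_active[of "j # js" "[]" t js \<theta> p ?Y] True dist
      by (simp add: Q_def r_def i_def s'_def s_def S_def V_def U_def w'_def)
    \<comment> \<open>In the absorbed process the memory stands behind \<open>W\<close>. Undoing its
      swap with \<open>W\<close> recovers the system order in which the component acts, and this is
      how the link of \<open>absorb\<close> begins.\<close>
    have "Z = tens_id Q (s * (?B * r)) ((?B * r) * s) 1 (swap_op s (?B * r)) U"
      unfolding Z_def U_def by (rule swap_op_hexagon_right)
    then have U: "U = tens_id Q ((?B * r) * s) (s * (?B * r)) 1 (swap_op (?B * r) s) Z"
      using tens_id_carrier[of 1 "s * Q" "Q * s" "?B * r"]
      by (simp only:) (intro tens_id_swap_swap[symmetric], simp add: U_def mult_ac)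
    have V': "V = tens_id Q (s * (?B * r)) (s' * (?A * r)) 1 (tens_id 1 (s * ?B) (s' * ?A) r ?N) U"
      unfolding V_def by (rule tens_id_nest'[symmetric]) auto
    have "swap_op s' (Q * (?A * r)) S = tens_id Q (s' * (?A * r)) ((?A * r) * s') 1 (swap_op s' (?A * r))
        (tens_id 1 (s' * Q) (Q * s') (?A * r) (swap_op s' Q) S)"
      by (rule swap_op_hexagon_right)
    also have "tens_id 1 (s' * Q) (Q * s') (?A * r) (swap_op s' Q) S = V"
      unfolding S_def using tens_id_carrier[of Q "s * ?B" "s' * ?A" r ?N U]
      by (intro tens_id_swap_swap) (simp add: V_def mult_ac)
    finally have S: "swap_op s' (Q * (?A * r)) S = tens_id Q (s' * (?A * r)) ((?A * r) * s') 1 (swap_op s' (?A * r)) V" .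
    have "swap_op s' (Q * w') (tens_id (s' * Q) (?A * r) w' 1 ?L S) =
      swap_op s' (Q * w') (tens_id s' (Q * (?A * r)) (Q * w') 1 (tens_id Q (?A * r) w' 1 ?L) S)"
      by (rule arg_cong[where f = "swap_op s' (Q * w')"], rule tens_id_nest'[symmetric]) auto
    also have "\<dots> = tens_id 1 (Q * (?A * r)) (Q * w') s' (tens_id Q (?A * r) w' 1 ?L) (swap_op s' (Q * (?A * r)) S)"
      by (rule swap_op_tens_id_right)
    also have "\<dots> = tens_id Q (?A * r) w' s' ?L (swap_op s' (Q * (?A * r)) S)"
      by (rule tens_id_nest') auto
    also have "\<dots> = tens_id Q ((?A * r) * s') (w' * s') 1 (tens_id 1 (?A * r) w' s' ?L) (swap_op s' (Q * (?A * r)) S)"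
      by (rule tens_id_nest'[symmetric]) auto
    also have "\<dots> = tens_id Q ((?A * r) * s') (w' * s') 1 (tens_id 1 (?A * r) w' s' ?L)
       (tens_id Q (s' * (?A * r)) ((?A * r) * s') 1 (swap_op s' (?A * r))
         (tens_id Q (s * (?B * r)) (s' * (?A * r)) 1 (tens_id 1 (s * ?B) (s' * ?A) r ?N)
           (tens_id Q ((?B * r) * s) (s * (?B * r)) 1 (swap_op (?B * r) s) Z)))"
      unfolding S V' U ..
    also have "\<dots> = tens_id Q ((?B * r) * s) (w' * s') 1 (tens_id 1 (?A * r) w' s' ?L \<circ> (swap_op s' (?A * r) \<circ>
       (tens_id 1 (s * ?B) (s' * ?A) r ?N \<circ> swap_op (?B * r) s))) Z"
    proof -
      have 1: "swap_op (?B * r) s X \<in> carrier_mat (s * (?B * r)) (s * (?B * r))" for X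
        by (rule swap_op_carrier)
      have 2: "(tens_id 1 (s * ?B) (s' * ?A) r ?N \<circ> swap_op (?B * r) s) X \<in> carrier_mat (s' * (?A * r)) (s' * (?A * r))" for X
        using tens_id_carrier[of 1 "s * ?B" "s' * ?A" r] by (simp add: mult.assoc)
      have 3: "(swap_op s' (?A * r) \<circ> (tens_id 1 (s * ?B) (s' * ?A) r ?N \<circ> swap_op (?B * r) s)) X
          \<in> carrier_mat ((?A * r) * s') ((?A * r) * s')" for X
        by (simp only: o_apply swap_op_carrier)
      show ?thesis
        by (simp only: tens_id_comp[OF 1, symmetric] tens_id_comp[OF 2, symmetric] tens_id_comp[OF 3, symmetric])
    qed
    also have "\<dots> = proc_step \<theta> js p' t Z"
      unfolding proc_step_idle[OF idle] absorb_dims cm w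
      using True by (simp add: absorb_def Q_def w'_def Let_def i_def r_def s_def s'_def)
    also have "\<dots> = proc_run \<theta> js p' (Suc t) X"
      using \<open>proc_run \<theta> js p' t X = _\<close> by (simp add: Z_def Q_def w cm)
    finally show ?thesis by (simp only: run Q' cm w'_def)
  qed
qed

end
end

section \<open>Amortized divergences of runs\<close>

lemma state_carrier: "state m \<rho> \<Longrightarrow> \<rho> \<in> carrier_mat m m"
  by (simp add: state_def psd_def)

lemma state_pos: "state m \<rho> \<Longrightarrow> 0 < m"
  by (cases m) (auto simp: state_def psd_def tr_def)

lemma gap_mono: "x \<le> x' \<Longrightarrow> gap x y \<le> gap x' y"
  by (simp add: gap_def ereal_minus_mono)

lemma amortized_cong:
  assumes "\<And>X. X \<in> carrier_mat m m \<Longrightarrow> \<N> X = \<N>' X" "\<And>X. X \<in> carrier_mat m m \<Longrightarrow> \<M> X = \<M>' X"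
  shows "amortized D m n \<N> \<M> = amortized D m n \<N>' \<M>'"
  unfolding amortized_def
  by (intro SUP_cong refl) (auto simp: tens_id_cong[of m \<N> \<N>'] tens_id_cong[of m \<M> \<M>'] assms)

lemma divergence_channel:
  assumes "generalized_divergence D" "state m \<rho>" "state m \<sigma>" "channel m n \<N>"
  shows "D (\<N> \<rho>) (\<N> \<sigma>) \<le> D \<rho> \<sigma>"
  using assms unfolding generalized_divergence_def by blast

text \<open>For each reference and each pair of inputs only the minuend changes, and it decreases by
  data processing.\<close>

lemma amortized_data_processing:
  assumes D: "generalized_divergence D" and ch: "channel x m \<N>" "channel x m \<M>" "channel m n \<G>"
  shows "amortized D x n (\<G> \<circ> \<N>) (\<G> \<circ> \<M>) \<le> amortized D x m \<N> \<M>"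
  unfolding amortized_def
proof (rule SUP_mono, clarify)
  fix d \<rho> \<tau> assume st: "state (x * d) \<rho>" "state (x * d) \<tau>"
  then have d: "0 < d" using state_pos by fastforce
  have "state (m * d) (tens_id 1 x m d \<N> \<rho>)" "state (m * d) (tens_id 1 x m d \<M> \<tau>)"
    using state_channel[OF channel_tens_id[OF ch(1), of 1 d]] state_channel[OF channel_tens_id[OF ch(2), of 1 d]]
      st d by simp_all
  moreover have "channel (m * d) (n * d) (tens_id 1 m n d \<G>)"
    using channel_tens_id[OF ch(3), of 1 d] d by simp
  ultimately have "D (tens_id 1 m n d \<G> (tens_id 1 x m d \<N> \<rho>)) (tens_id 1 m n d \<G> (tens_id 1 x m d \<M> \<tau>))
      \<le> D (tens_id 1 x m d \<N> \<rho>) (tens_id 1 x m d \<M> \<tau>)"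
    using divergence_channel[OF D] by blast
  then have "D (tens_id 1 x n d (\<G> \<circ> \<N>) \<rho>) (tens_id 1 x n d (\<G> \<circ> \<M>) \<tau>)
      \<le> D (tens_id 1 x m d \<N> \<rho>) (tens_id 1 x m d \<M> \<tau>)"
    by (simp only: tens_id_comp[OF channelD(2)[OF ch(1)]] tens_id_comp[OF channelD(2)[OF ch(2)]])
  then show "\<exists>q\<in>{(d, \<rho>, \<tau>). state (x * d) \<rho> \<and> state (x * d) \<tau>}.
     gap (D (tens_id 1 x n d (\<G> \<circ> \<N>) \<rho>) (tens_id 1 x n d (\<G> \<circ> \<M>) \<tau>)) (D \<rho> \<tau>)
     \<le> (case q of (d, \<rho>, \<tau>) \<Rightarrow> gap (D (tens_id 1 x m d \<N> \<rho>) (tens_id 1 x m d \<M> \<tau>)) (D \<rho> \<tau>))"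
    using st by (intro bexI[of _ "(d, \<rho>, \<tau>)"]) (auto intro: gap_mono)
qed

text \<open>By data processing every gap is at most 0: an infinite \<open>D \<rho> \<tau>\<close>
  gives \<open>-\<infinity>\<close> by the definition of \<open>gap\<close>, and the value
  \<open>-\<infinity>\<close>, whose subtraction would give \<infinity>, is excluded for a
  generalized divergence.\<close>

lemma amortized_self:
  assumes D: "generalized_divergence D" and ch: "channel m n \<N>"
  shows "amortized D m n \<N> \<N> \<le> 0"
  unfolding amortized_def
proof (rule SUP_least, clarify)
  fix d \<rho> \<tau> assume st: "state (m * d) \<rho>" "state (m * d) \<tau>"
  then have d: "0 < d" using state_pos by fastforce
  have "channel (m * d) (n * d) (tens_id 1 m n d \<N>)"
    using channel_tens_id[OF ch, of 1 d] d by simp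
  then have "D (tens_id 1 m n d \<N> \<rho>) (tens_id 1 m n d \<N> \<tau>) \<le> D \<rho> \<tau>"
    using divergence_channel[OF D] st by blast
  moreover have "D \<rho> \<tau> \<noteq> -\<infinity>" using D st by (auto simp: generalized_divergence_def)
  ultimately show "gap (D (tens_id 1 m n d \<N> \<rho>) (tens_id 1 m n d \<N> \<tau>)) (D \<rho> \<tau>) \<le> 0"
    by (cases "D \<rho> \<tau>"; cases "D (tens_id 1 m n d \<N> \<rho>) (tens_id 1 m n d \<N> \<tau>)") (auto simp: gap_def)
qed

text \<open>A trivial reference and equal inputs are admissible in the supremum, and subtracting
  \<open>D \<rho> \<rho> \<le> 0\<close> cannot decrease the value.\<close>

lemma divergence_le_amortized:
  assumes D: "generalized_divergence D" "\<And>m \<rho>. state m \<rho> \<Longrightarrow> D \<rho> \<rho> \<le> 0"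
    and ch: "channel m n \<N>" "channel m n \<M>" and \<rho>: "state m \<rho>"
  shows "D (\<N> \<rho>) (\<M> \<rho>) \<le> amortized D m n \<N> \<M>"
proof -
  have "D \<rho> \<rho> \<le> 0" "D \<rho> \<rho> \<noteq> -\<infinity>" using D \<rho> by (auto simp: generalized_divergence_def)
  then have "D (\<N> \<rho>) (\<M> \<rho>) \<le> gap (D (\<N> \<rho>) (\<M> \<rho>)) (D \<rho> \<rho>)"
    by (cases "D \<rho> \<rho>"; cases "D (\<N> \<rho>) (\<M> \<rho>)") (auto simp: gap_def)
  also have "\<dots> = (\<lambda>(d, \<rho>, \<tau>). gap (D (tens_id 1 m n d \<N> \<rho>) (tens_id 1 m n d \<M> \<tau>)) (D \<rho> \<tau>)) (1, \<rho>, \<rho>)"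
    using state_carrier[OF \<rho>] channelD(2)[OF ch(1)] channelD(2)[OF ch(2)]
    by (simp add: tens_id_trivial[unfolded One_nat_def])
  also have "\<dots> \<le> amortized D m n \<N> \<M>"
    unfolding amortized_def by (rule SUP_upper) (use \<rho> in simp)
  finally show ?thesis .
qed

lemma channel_comb_apply:
  assumes oc: "open_comb m a b \<Theta>" and sl: "slot_channels k a b x r A" and i: "Suc i \<le> m" "Suc i \<le> k"
  shows "channel x (comb_mem \<Theta> (Suc i) * (a (Suc i) * r i)) (comb_apply a b \<Theta> r A (Suc i) \<circ> A 0)"
  using i
proof (induction i)
  case 0
  have A: "channel x (b 0 * r 0) (A 0)" using sl by (simp add: slot_channels_def)
  have "channel (comb_mem \<Theta> 0 * b 0) (comb_mem \<Theta> 1 * a 1) (comb_chan \<Theta> 1)" "comb_mem \<Theta> 0 = 1"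
    using oc 0 by (auto simp: open_comb_def)
  then have "channel (b 0 * r 0) (comb_mem \<Theta> 1 * a 1 * r 0) (tens_id 1 (comb_mem \<Theta> 0 * b 0) (comb_mem \<Theta> 1 * a 1) (r 0) (comb_chan \<Theta> 1))"
    using channel_tens_id[of "comb_mem \<Theta> 0 * b 0" "comb_mem \<Theta> 1 * a 1" "comb_chan \<Theta> 1" 1 "r 0"] channel_pos(2)[OF A] by simp
  from channel_comp[OF A this] show ?case by (simp add: mult.assoc o_def)
next
  case (Suc i)
  let ?s = "comb_mem \<Theta> (Suc i)" and ?s' = "comb_mem \<Theta> (Suc (Suc i))"
  have IH: "channel x (?s * (a (Suc i) * r i)) (comb_apply a b \<Theta> r A (Suc i) \<circ> A 0)"
    by (rule Suc.IH) (use Suc.prems in simp_all)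
  have A: "channel (a (Suc i) * r i) (b (Suc i) * r (Suc i)) (A (Suc i))"
    using bspec[OF conjunct2[OF sl[unfolded slot_channels_def]], of "Suc i"] Suc.prems by simp
  have N: "channel (?s * b (Suc i)) (?s' * a (Suc (Suc i))) (comb_chan \<Theta> (Suc (Suc i)))"
    using oc Suc.prems by (auto simp: open_comb_def)
  have S: "channel (?s * (a (Suc i) * r i)) (?s * (b (Suc i) * r (Suc i))) (slot_apply a b \<Theta> r A (Suc i))"
    using channel_tens_id[OF A, of ?s 1] channel_pos(2)[OF IH] by (simp add: slot_apply_def)
  have C: "channel (?s * (b (Suc i) * r (Suc i))) (?s' * (a (Suc (Suc i)) * r (Suc i)))
     (tens_id 1 (?s * b (Suc i)) (?s' * a (Suc (Suc i))) (r (Suc i)) (comb_chan \<Theta> (Suc (Suc i))))"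
    using channel_tens_id[OF N, of 1 "r (Suc i)"] channel_pos(2)[OF A] by (simp add: mult.assoc)
  have "comb_apply a b \<Theta> r A (Suc (Suc i)) \<circ> A 0 =
     tens_id 1 (?s * b (Suc i)) (?s' * a (Suc (Suc i))) (r (Suc i)) (comb_chan \<Theta> (Suc (Suc i))) \<circ>
      (slot_apply a b \<Theta> r A (Suc i) \<circ> (comb_apply a b \<Theta> r A (Suc i) \<circ> A 0))"
    by (subst comb_apply.simps(2)) (simp add: o_assoc del: comb_apply.simps)
  then show ?case using channel_comp[OF channel_comp[OF IH S] C] by (simp only:)
qed

section \<open>Removal of the copies, one at a time\<close>

context interleaving
begin

lemma valid_process_set: "set js = set js' \<Longrightarrow> valid_process js p T \<longleftrightarrow> valid_process js' p T"
  by (simp add: valid_process_def valid_at_def mid_dim_def)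

text \<open>When the last copy \<open>j\<close> applies its last component, all other copies are finished.  Hence their
  memories are trivial, and the last reference is the same for both hypotheses.\<close>

lemma split_off_last_copy:
  fixes \<Theta> \<Omega> j js p t
  defines "r \<equiv> slot_ref (\<lambda>_. \<Theta>) j js p" and "A \<equiv> slot_chan (\<lambda>_. \<Theta>) j js p"
  assumes k: "2 \<le> k" and \<Theta>: "comb k a b \<Theta>"
    and vp: "valid_process (j # js) p (Suc t)" and dist: "distinct (j # js)"
    and cnt: "\<forall>x \<in> set (j # js). count_upto c (Suc t) x = k" and ct: "c t = j"
  shows "slot_channels k a b (work_dim p 0) r A"
    and "r (k - 1) = ref_dim p t" and "work_dim p t = b (k - 1) * ref_dim p t"
    and "channel (a k * ref_dim p t) (work_dim p (Suc t)) (step_link p t)"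
    and "channel (work_dim p 0) (a k * ref_dim p t) (comb_apply a b \<Theta> r A k \<circ> A 0)"
    and "\<And>X. X \<in> carrier_mat (work_dim p 0) (work_dim p 0) \<Longrightarrow>
      proc_run (\<lambda>_. \<Theta>) (j # js) p (Suc t) X = step_link p t (comb_apply a b \<Theta> r A k (A 0 X))"
    and "\<And>X \<Omega>. X \<in> carrier_mat (work_dim p 0) (work_dim p 0) \<Longrightarrow> open_comb (k - 1) a b \<Omega> \<Longrightarrow>
      slot_apply a b \<Omega> r A (k - 1) (comb_apply a b \<Omega> r A (k - 1) (A 0 X)) =
      swap_op (work_dim p t) (comb_mem \<Omega> (k - 1)) (proc_run (\<lambda>_. \<Theta>) js (absorb js j \<Omega> p) t X)"
    and "\<And>\<Omega>. open_comb (k - 1) a b \<Omega> \<Longrightarrow> valid_process js (absorb js j \<Omega> p) t"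
    and "\<And>x. x \<in> set js \<Longrightarrow> count_upto c t x = k"
proof -
  have ck: "count_upto c (Suc t) j = k" using cnt by simp
  then have ck': "count_upto c t j = k - 1" and Sk: "Suc (k - 1) = k" using ct k by auto
  have oc: "open_comb k a b \<Theta>" and last: "comb_mem \<Theta> k = 1" using \<Theta> by (auto simp: comb_def)
  show cnt': "count_upto c t x = k" if "x \<in> set js" for x
    using bspec[OF cnt, of x] that dist ct by (auto split: if_splits)
  have vc: "valid_combs (\<lambda>_. \<Theta>) js (Suc t)"
    using oc cnt by (auto simp: valid_combs_def)
  have st: "slot_time j (k - 1) = t" using slot_time_eq[OF ct] ck' by simp
  \<comment> \<open>Every other copy has applied its last component before time \<open>t\<close>,
    and \<open>comb_mem \<Theta> k = 1\<close>.\<close>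
  have m1: "mems (\<lambda>_. \<Theta>) t js = 1"
    using cnt' by (induction js) (auto simp: cur_mem_def last)
  show r: "r (k - 1) = ref_dim p t" by (simp add: r_def slot_ref_def st m1 del: One_nat_def)
  have v: "valid_at (j # js) p t" using vp by (simp add: valid_process_def)
  show w: "work_dim p t = b (k - 1) * ref_dim p t" using v ct ck' by (simp add: valid_at_def)
  have mid: "mid_dim (j # js) p t = a k * ref_dim p t" using ct ck' Sk by (simp add: mid_dim_def)
  show L: "channel (a k * ref_dim p t) (work_dim p (Suc t)) (step_link p t)"
    using v mid by (simp add: valid_at_def)
  show sl: "slot_channels k a b (work_dim p 0) r A"
    unfolding slot_channels_def
  proof (intro conjI ballI)
    show "channel (work_dim p 0) (b 0 * r 0) (A 0)"
      using channel_slot[OF vp vc dist, of 0] ck k by (simp add: source_dim_def r_def A_def del: count_upto.simps)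
    fix i assume "i \<in> {1..<k}"
    then show "channel (a i * r (i - 1)) (b i * r i) (A i)"
      using channel_slot[OF vp vc dist, of i] ck by (simp add: source_dim_def r_def A_def del: count_upto.simps)
  qed
  show C: "channel (work_dim p 0) (a k * ref_dim p t) (comb_apply a b \<Theta> r A k \<circ> A 0)"
    using channel_comb_apply[OF oc sl, of "k - 1"] Sk r last by simp
  have car: "comb_apply a b \<Theta> r A k (A 0 X) \<in> carrier_mat (a k * ref_dim p t) (a k * ref_dim p t)"
    if "X \<in> carrier_mat (work_dim p 0) (work_dim p 0)" for X
    using channelD(2)[OF C that] by simp
  have mem0: "comb_mem \<Theta> 0 = 1" using oc by (simp add: open_comb_def)
  show "proc_run (\<lambda>_. \<Theta>) (j # js) p (Suc t) X = step_link p t (comb_apply a b \<Theta> r A k (A 0 X))"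
    if X: "X \<in> carrier_mat (work_dim p 0) (work_dim p 0)" for X
  proof -
    let ?n = "a k * ref_dim p t" and ?Z = "comb_apply a b \<Theta> r A k (A 0 X)"
    have Z: "comb_stage (\<lambda>_. \<Theta>) j js p k X = ?Z" using k by (simp add: comb_stage_def[OF vp vc dist mem0] r_def A_def)
    have "proc_run (\<lambda>_. \<Theta>) (j # js) p (Suc t) X = tens_id (1 * 1) ?n (work_dim p (Suc t)) 1 (step_link p t)
       (tens_id 1 (?n * 1) (1 * ?n) 1 (swap_op ?n 1) ?Z)"
      using proc_step_stage[OF vp vc dist mem0 lessI ct X proc_run_stage[OF vp vc dist mem0 _ X]]
      by (simp only: ck' Sk last m1 Z le_SucI)
    also have "tens_id 1 (?n * 1) (1 * ?n) 1 (swap_op ?n 1) ?Z = swap_op ?n 1 ?Z"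
      by (rule tens_id_trivial) (use car[OF X] swap_op_carrier[of ?n 1] in simp_all)
    also have "\<dots> = ?Z" using car[OF X] by (rule swap_op_trivial)
    also have "tens_id (1 * 1) ?n (work_dim p (Suc t)) 1 (step_link p t) ?Z = step_link p t ?Z"
      using tens_id_trivial[where \<Phi> = "step_link p t", OF car[OF X] channelD(2)[OF L car[OF X]]] by simp
    finally show ?thesis .
  qed
  fix \<Omega> assume \<Omega>: "open_comb (k - 1) a b \<Omega>"
  \<comment> \<open>Only copy \<open>j\<close> becomes \<Omega>. Its slot channels still contain the
    other copies with their comb \<Theta>, so they remain \<open>r\<close> and
    \<open>A\<close>.\<close>
  define \<theta> where "\<theta> = (\<lambda>_. \<Theta>)(j := \<Omega>)"
  have \<theta>js: "\<theta> x = \<Theta>" if "x \<in> set js" for x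
    using that dist by (auto simp: \<theta>_def)
  have \<theta>j: "\<theta> j = \<Omega>" by (simp add: \<theta>_def)
  have vc\<theta>: "valid_combs \<theta> js (Suc t)" using vc \<theta>js by (simp add: valid_combs_def)
  have "valid_combs \<theta> js t" using valid_combs_le[OF vc\<theta>] by simp
  then have vc': "valid_combs \<theta> (j # js) t" using \<Omega> by (simp add: valid_combs_def ck' \<theta>j)
  have vp': "valid_process (j # js) p t" using vp by (rule valid_process_le) simp
  show "valid_process js (absorb js j \<Omega> p) t"
    using valid_process_absorb[OF vp' vc' dist] by (simp add: \<theta>j)
  fix X :: "complex mat" assume X: "X \<in> carrier_mat (work_dim p 0) (work_dim p 0)"
  let ?s = "comb_mem \<Omega> (k - 1)" and ?w = "work_dim p t"
  have cm: "cur_mem \<theta> t j = ?s" by (simp add: cur_mem_def \<theta>j ck')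
  have m1': "mems \<theta> t js = 1" using mems_cong[of js \<theta> "\<lambda>_. \<Theta>" t] \<theta>js m1 by simp
  have mem0': "comb_mem (\<theta> j) 0 = 1" using \<Omega> by (simp add: \<theta>j open_comb_def)
  have sl': "slot_ref \<theta> j js p = r" "slot_chan \<theta> j js p = A"
    using slot_cong[of js \<theta> "\<lambda>_. \<Theta>" j p] \<theta>js by (simp_all add: r_def A_def)
  let ?Y = "proc_run \<theta> (j # js) p t X"
  have Y: "?Y \<in> carrier_mat (?s * ?w) (?s * ?w)"
    using channelD(2)[OF channel_proc_run[OF vp' vc' dist] X] by (simp add: cm m1')
  have stage: "comb_stage \<theta> j js p (k - 1) X = comb_apply a b \<Omega> r A (k - 1) (A 0 X)"
    using k by (simp add: comb_stage_def[OF vp vc\<theta> dist mem0'] sl' \<theta>j)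
  \<comment> \<open>In the last slot the other memories are trivial, so the swap that completes the
    slot channel is the identity, and the subtracted comb expression is the run just before step
    \<open>t\<close>.\<close>
  have "tens_id ?s (1 * ?w) (?w * 1) 1 (swap_op 1 ?w) ?Y =
      slot_apply a b \<Omega> r A (k - 1) (comb_apply a b \<Omega> r A (k - 1) (A 0 X))"
    using slot_stage[OF vp vc\<theta> dist mem0' _ ct X proc_run_stage[OF vp vc\<theta> dist mem0' _ X]] k
    by (simp add: ck' cm m1' sl' \<theta>j stage[unfolded One_nat_def])
  moreover have "tens_id ?s (1 * ?w) (?w * 1) 1 (swap_op 1 ?w) ?Y = tens_id ?s ?w ?w 1 id ?Y"
  proof -
    have "tens_id ?s ?w ?w 1 (swap_op 1 ?w) ?Y = tens_id ?s ?w ?w 1 id ?Y"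
      by (rule tens_id_cong) (simp only: swap_op_trivial id_apply)
    then show ?thesis by simp
  qed
  ultimately have "slot_apply a b \<Omega> r A (k - 1) (comb_apply a b \<Omega> r A (k - 1) (A 0 X)) = ?Y"
    using tens_id_id[of ?Y ?s ?w 1] Y by simp
  also have "\<dots> = swap_op ?w ?s (swap_op ?s ?w ?Y)"
    using swap_op_swap_op[OF Y] by simp
  also have "swap_op ?s ?w ?Y = proc_run \<theta> js (absorb js j \<Omega> p) t X"
    using proc_run_absorb[OF vp' vc' dist _ X] by (simp add: cm m1' \<theta>j)
  also have "\<dots> = proc_run (\<lambda>_. \<Theta>) js (absorb js j \<Omega> p) t X"
    by (rule proc_run_cong) (rule \<theta>js)
  finally show "slot_apply a b \<Omega> r A (k - 1) (comb_apply a b \<Omega> r A (k - 1) (A 0 X)) =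
      swap_op (work_dim p t) (comb_mem \<Omega> (k - 1)) (proc_run (\<lambda>_. \<Theta>) js (absorb js j \<Omega> p) t X)" .
qed

text \<open>The process is generalized in the induction because absorption changes dimensions and
  links. After absorption the earlier steps of the removed copy are idle, so the hypothesis for the
  shorter time applies to the remaining copies.\<close>

lemma amortized_proc_run_le:
  assumes D: "generalized_divergence D" and k: "2 \<le> k"
    and \<Theta>: "comb k a b \<Theta>\<^sub>1" "comb k a b \<Theta>\<^sub>2"
    and "distinct js" "valid_process js p T" "\<And>j. j \<in> set js \<Longrightarrow> count_upto c T j = k"
  shows "amortized D (work_dim p 0) (work_dim p T) (proc_run (\<lambda>_. \<Theta>\<^sub>1) js p T) (proc_run (\<lambda>_. \<Theta>\<^sub>2) js p T)
    \<le> ereal (real (length js)) * network_divergence D k a b \<Theta>\<^sub>1 \<Theta>\<^sub>2"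
  using assms(5-)
proof (induction T arbitrary: js p)
  case 0
  \<comment> \<open>At time 0 all counts are 0, whereas each listed copy must have count
    \<open>k\<close>.\<close>
  then have "js = []" using k by (cases js) force+
  moreover have "channel (work_dim p 0) (work_dim p 0) id"
    using 0 by (intro channel_id) (simp add: valid_process_def)
  ultimately show ?case
    using amortized_self[OF D, of "work_dim p 0" "work_dim p 0" id] by (simp add: id_def zero_ereal_def[symmetric])
next
  case (Suc t)
  let ?N = "network_divergence D k a b \<Theta>\<^sub>1 \<Theta>\<^sub>2"
  have vc: "valid_combs (\<lambda>_. \<Theta>) l (Suc t)" if "comb k a b \<Theta>" "set l = set js" for \<Theta> l
    using that Suc.prems(3) by (auto simp: valid_combs_def comb_def)
  have triv: "cur_mem (\<lambda>_. \<Theta>) (Suc t) x = 1" if "comb k a b \<Theta>" "x \<in> set js" for \<Theta> x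
    using Suc.prems(3)[OF that(2)] that(1) by (simp add: cur_mem_def comb_def del: count_upto.simps)
  show ?case
  proof (cases "c t \<in> set js")
    case False
    have v: "valid_process js p t" using Suc.prems(2) by (rule valid_process_le) simp
    have cnt: "count_upto c t x = k" if "x \<in> set js" for x
      using Suc.prems(3)[OF that] False that by (auto split: if_splits)
    have m1: "mems (\<lambda>_. \<Theta>) t js = 1" if "comb k a b \<Theta>" for \<Theta>
    proof -
      have "cur_mem (\<lambda>_. \<Theta>) t x = 1" if "x \<in> set js" for x
        using cnt[OF that] \<open>comb k a b \<Theta>\<close> by (simp add: cur_mem_def comb_def)
      then show ?thesis by (induction js) auto
    qed
    have ch: "channel (work_dim p 0) (work_dim p t) (proc_run (\<lambda>_. \<Theta>) js p t)" if "comb k a b \<Theta>" for \<Theta>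
      using channel_proc_run[OF v valid_combs_le[OF vc[OF that]] Suc.prems(1)] m1[OF that] by simp
    have L: "channel (work_dim p t) (work_dim p (Suc t)) (step_link p t)"
    proof -
      have "valid_at js p t" using Suc.prems(2) by (simp add: valid_process_def)
      then show ?thesis using False by (simp add: valid_at_def mid_dim_def)
    qed
    have eq: "proc_run (\<lambda>_. \<Theta>) js p (Suc t) X = (step_link p t \<circ> proc_run (\<lambda>_. \<Theta>) js p t) X"
      if "comb k a b \<Theta>" "X \<in> carrier_mat (work_dim p 0) (work_dim p 0)" for \<Theta> X
    proof -
      have "proc_run (\<lambda>_. \<Theta>) js p t X \<in> carrier_mat (work_dim p t) (work_dim p t)"
        using channelD(2)[OF ch] that by blast
      then show ?thesis
        using tens_id_trivial[of _ _ "step_link p t"] channelD(2)[OF L]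
        by (simp add: proc_step_idle[OF False] m1[OF that(1)])
    qed
    have "amortized D (work_dim p 0) (work_dim p (Suc t)) (proc_run (\<lambda>_. \<Theta>\<^sub>1) js p (Suc t)) (proc_run (\<lambda>_. \<Theta>\<^sub>2) js p (Suc t)) =
      amortized D (work_dim p 0) (work_dim p (Suc t)) (step_link p t \<circ> proc_run (\<lambda>_. \<Theta>\<^sub>1) js p t) (step_link p t \<circ> proc_run (\<lambda>_. \<Theta>\<^sub>2) js p t)"
      by (rule amortized_cong) (rule eq, rule \<Theta>, assumption)+
    also have "\<dots> \<le> amortized D (work_dim p 0) (work_dim p t) (proc_run (\<lambda>_. \<Theta>\<^sub>1) js p t) (proc_run (\<lambda>_. \<Theta>\<^sub>2) js p t)"
      using D ch[OF \<Theta>(1)] ch[OF \<Theta>(2)] L by (rule amortized_data_processing)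
    also have "\<dots> \<le> ereal (real (length js)) * ?N"
      using Suc.prems(1) v cnt by (rule Suc.IH)
    finally show ?thesis .
  next
    case True
    \<comment> \<open>The copy acting in the last step is the one that finishes last. It is moved to
      the head of the list, which \<open>proc_run_permute\<close> allows because all memories are
      trivial at the end.\<close>
    define j js' where "j = c t" and "js' = remove1 (c t) js"
    have set: "set (j # js') = set js" and dist: "distinct (j # js')"
      using True Suc.prems(1) by (auto simp: j_def js'_def)
    have len: "length js = Suc (length js')"
      using True length_pos_if_in_set[OF True] by (simp add: js'_def length_remove1)
    have vp: "valid_process (j # js') p (Suc t)" using Suc.prems(2) valid_process_set[OF set] by simp
    have cnt: "\<forall>x \<in> set (j # js'). count_upto c (Suc t) x = k"
      using Suc.prems(3) set by blast
    have ct: "c t = j" by (simp add: j_def)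
    note P1 = split_off_last_copy[OF k \<Theta>(1) vp dist cnt ct] and P2 = split_off_last_copy[OF k \<Theta>(2) vp dist cnt ct]
    define x r1 r2 A1 A2 where "x = work_dim p 0" and "r1 = slot_ref (\<lambda>_. \<Theta>\<^sub>1) j js' p" and "r2 = slot_ref (\<lambda>_. \<Theta>\<^sub>2) j js' p"
      and "A1 = slot_chan (\<lambda>_. \<Theta>\<^sub>1) j js' p" and "A2 = slot_chan (\<lambda>_. \<Theta>\<^sub>2) j js' p"
    note fold = x_def[symmetric] r1_def[symmetric] r2_def[symmetric] A1_def[symmetric] A2_def[symmetric]
    define C1 C2 where "C1 = comb_apply a b \<Theta>\<^sub>1 r1 A1 k \<circ> A1 0" and "C2 = comb_apply a b \<Theta>\<^sub>2 r2 A2 k \<circ> A2 0"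
    let ?M = "ereal (real (length js')) * ?N"
    let ?X = "amortized D x (a k * r1 (k - 1)) C1 C2"
    let ?Y = "\<lambda>\<Omega>. amortized D x (comb_mem \<Omega> (k - 1) * (b (k - 1) * r1 (k - 1)))
             (slot_apply a b \<Omega> r1 A1 (k - 1) \<circ> comb_apply a b \<Omega> r1 A1 (k - 1) \<circ> A1 0)
             (slot_apply a b \<Omega> r2 A2 (k - 1) \<circ> comb_apply a b \<Omega> r2 A2 (k - 1) \<circ> A2 0)"
    have r: "r1 (k - 1) = ref_dim p t" "r2 (k - 1) = ref_dim p t"
      using P1(2) P2(2) by (simp_all add: fold)
    have w: "work_dim p t = b (k - 1) * ref_dim p t" by (rule P1(3))
    \<comment> \<open>Up to a swap, which data processing removes, the subtracted channels are the
      runs of the absorbed process. The induction hypothesis bounds them uniformly in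
      \<Omega>.\<close>
    have Y: "?Y \<Omega> \<le> ?M" if \<Omega>: "open_comb (k - 1) a b \<Omega>" for \<Omega>
    proof -
      let ?p = "absorb js' j \<Omega> p" and ?s = "comb_mem \<Omega> (k - 1)" and ?w = "work_dim p t"
      have cnt': "count_upto c t y = k" if "y \<in> set js'" for y using P1(9) that by blast
      have vp': "valid_process js' ?p t" using P1(8) \<Omega> by blast
      have "count_upto c t j = k - 1" using bspec[OF cnt, of j] ct by simp
      then have wd: "work_dim ?p t = ?w * ?s" "work_dim ?p 0 = x"
        using \<Omega> by (simp_all add: absorb_def open_comb_def x_def)
      have vc': "valid_combs (\<lambda>_. \<Theta>) js' t" if "comb k a b \<Theta>" for \<Theta>
        using that cnt' by (auto simp: valid_combs_def comb_def)
      have m1: "mems (\<lambda>_. \<Theta>) t js' = 1" if "comb k a b \<Theta>" for \<Theta>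
      proof -
        have "cur_mem (\<lambda>_. \<Theta>) t y = 1" if "y \<in> set js'" for y
          using cnt'[OF that] \<open>comb k a b \<Theta>\<close> by (simp add: cur_mem_def comb_def)
        then show ?thesis by (induction js') auto
      qed
      have ch: "channel x (?w * ?s) (proc_run (\<lambda>_. \<Theta>) js' ?p t)" if "comb k a b \<Theta>" for \<Theta>
        using channel_proc_run[OF vp' vc'[OF that]] dist m1[OF that] wd by simp
      then have "0 < ?w * ?s" using channel_pos(2) \<Theta>(1) by blast
      then have sw: "channel (?w * ?s) (?s * ?w) (swap_op ?w ?s)" by (intro channel_swap_op) auto
      have "?Y \<Omega> = amortized D x (?s * ?w) (swap_op ?w ?s \<circ> proc_run (\<lambda>_. \<Theta>\<^sub>1) js' ?p t) (swap_op ?w ?s \<circ> proc_run (\<lambda>_. \<Theta>\<^sub>2) js' ?p t)"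
        unfolding r w[symmetric]
        using P1(7)[OF _ \<Omega>] P2(7)[OF _ \<Omega>] by (intro amortized_cong) (simp_all add: fold)
      also have "\<dots> \<le> amortized D x (?w * ?s) (proc_run (\<lambda>_. \<Theta>\<^sub>1) js' ?p t) (proc_run (\<lambda>_. \<Theta>\<^sub>2) js' ?p t)"
        using D ch[OF \<Theta>(1)] ch[OF \<Theta>(2)] sw by (rule amortized_data_processing)
      also have "\<dots> \<le> ?M"
        using Suc.IH[of js' ?p] dist vp' cnt' by (simp add: wd)
      finally show ?thesis .
    qed
    \<comment> \<open>The slot channels under the two hypotheses are one choice in the supremum;
      their last references agree by \<open>r\<close>.\<close>
    have "(INF \<Omega>\<in>{\<Omega>. open_comb (k - 1) a b \<Omega>}. gap ?X (?Y \<Omega>)) \<le> ?N"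
      unfolding network_divergence_def C1_def C2_def
      using P1(1) P2(1) r by (intro SUP_upper2[where i = "(x, r1, A1, r2, A2)"]) (simp_all add: fold)
    \<comment> \<open>If \<open>?M\<close> were infinite, \<open>?Y \<Omega>\<close> could be
      infinite as well and the gap would be \<open>-\<infinity>\<close>; finiteness from above rules
      this out for all \<Omega> at once.\<close>
    moreover have "?X - ?M \<le> (INF \<Omega>\<in>{\<Omega>. open_comb (k - 1) a b \<Omega>}. gap ?X (?Y \<Omega>))" if "?M \<noteq> \<infinity>"
    proof (rule INF_greatest)
      fix \<Omega> assume "\<Omega> \<in> {\<Omega>. open_comb (k - 1) a b \<Omega>}"
      then have "?Y \<Omega> \<le> ?M" using Y by simp
      then show "?X - ?M \<le> gap ?X (?Y \<Omega>)" using that by (auto simp: gap_def intro: ereal_minus_mono)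
    qed
    ultimately have XN: "?X - ?M \<le> ?N" if "?M \<noteq> \<infinity>" using that by (meson order_trans)
    have len': "real (length js) = real (length js') + 1" by (simp add: len)
    \<comment> \<open>For \<open>?N = \<infinity>\<close> the right side is infinite, as
      \<open>js\<close> is nonempty. For \<open>?N = -\<infinity>\<close> and \<open>js'\<close>
      empty, \<open>?M\<close> is 0, so \<open>XN\<close> forces \<open>?X = -\<infinity>\<close>;
      for nonempty \<open>js'\<close>, \<open>?M\<close> is \<open>-\<infinity>\<close> and the
      difference in \<open>XN\<close> is \<infinity>, a contradiction.\<close>
    have "?X \<le> ereal (real (length js)) * ?N"
    proof (cases ?N)
      case (real y)
      then show ?thesis using XN len' by (cases ?X) (auto simp: algebra_simps)
    next
      case PInf
      then show ?thesis using len' by simp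
    next
      case MInf
      then show ?thesis using XN len' by (cases "js' = []"; cases ?X) auto
    qed
    moreover have "amortized D x (work_dim p (Suc t)) (proc_run (\<lambda>_. \<Theta>\<^sub>1) js p (Suc t)) (proc_run (\<lambda>_. \<Theta>\<^sub>2) js p (Suc t)) \<le> ?X"
    proof -
      have perm: "proc_run (\<lambda>_. \<Theta>) js p (Suc t) X = proc_run (\<lambda>_. \<Theta>) (j # js') p (Suc t) X"
        if "comb k a b \<Theta>" "X \<in> carrier_mat x x" for \<Theta> X
        using proc_run_permute[OF Suc.prems(2) vc[OF that(1) refl] Suc.prems(1) dist set triv[OF that(1)]] that
        by (simp add: x_def)
      have "amortized D x (work_dim p (Suc t)) (proc_run (\<lambda>_. \<Theta>\<^sub>1) js p (Suc t)) (proc_run (\<lambda>_. \<Theta>\<^sub>2) js p (Suc t)) =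
        amortized D x (work_dim p (Suc t)) (step_link p t \<circ> C1) (step_link p t \<circ> C2)"
      proof (rule amortized_cong)
        fix X :: "complex mat" assume X: "X \<in> carrier_mat x x"
        then have X': "X \<in> carrier_mat (work_dim p 0) (work_dim p 0)" by (simp add: x_def)
        show "proc_run (\<lambda>_. \<Theta>\<^sub>1) js p (Suc t) X = (step_link p t \<circ> C1) X"
          unfolding perm[OF \<Theta>(1) X] P1(6)[OF X'] by (simp add: C1_def fold)
        show "proc_run (\<lambda>_. \<Theta>\<^sub>2) js p (Suc t) X = (step_link p t \<circ> C2) X"
          unfolding perm[OF \<Theta>(2) X] P2(6)[OF X'] by (simp add: C2_def fold)
      qed
      also have "\<dots> \<le> ?X"
        using P1(5) P2(5) P1(4) by (intro amortized_data_processing[OF D]) (simp_all add: fold r[unfolded One_nat_def] C1_def C2_def)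
      finally show ?thesis .
    qed
    ultimately show ?thesis unfolding x_def by (rule order_trans[rotated])
  qed
qed

end

section \<open>Adaptive strategies as processes\<close>

lemma count_upto_eq_used: "t \<le> length (sched S) \<Longrightarrow> count_upto ((!) (sched S)) t j = used S t j"
  by (induction t) (auto simp: used_def take_Suc_conv_app_nth)

theorem theorem8p1:
  fixes D :: "complex mat \<Rightarrow> complex mat \<Rightarrow> ereal"
    and n k :: nat
    and a b :: "nat \<Rightarrow> nat"
    and \<Theta>\<^sub>1 \<Theta>\<^sub>2 :: qcomb
    and S :: qstrategy
  assumes "generalized_divergence D"
    and "\<And>m \<rho>. state m \<rho> \<Longrightarrow> D \<rho> \<rho> \<le> 0"
    and "2 \<le> k"
    and "comb k a b \<Theta>\<^sub>1"
    and "comb k a b \<Theta>\<^sub>2"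
    and "1 \<le> n"
    and "adaptive_strategy n k a b S"
  shows "D (decision n k a b \<Theta>\<^sub>1 S) (decision n k a b \<Theta>\<^sub>2 S)
           \<le> ereal (real n) * network_divergence D k a b \<Theta>\<^sub>1 \<Theta>\<^sub>2"
proof -
  interpret interleaving a b "(!) (sched S)" .
  note D = assms(1) and k = assms(3)
  define js N d where "js = [0..<n]" and "N = n * k" and "d = a k * rdim S (n * k - 1)"
  \<comment> \<open>A strategy ends with a component, a process with a link; the missing link is the
    identity. The dimension at time \<open>N\<close> is set separately because no step is scheduled
    then and \<open>pos S N\<close> has no meaning.\<close>
  define p where "p = \<lparr>work_dim = (\<lambda>t. if t = N then d else b (pos S t) * rdim S t), ref_dim = rdim S,
    step_link = (\<lambda>t. if Suc t < N then link S t else id)\<rparr>"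
  have len: "length (sched S) = N" and sub: "set (sched S) \<subseteq> {..<n}"
    and cnt: "\<And>j. j < n \<Longrightarrow> count_list (sched S) j = k"
    and input: "state (b 0 * rdim S 0) (input S)"
    and link: "\<And>t. Suc t < N \<Longrightarrow>
          channel (a (Suc (pos S t)) * rdim S t) (b (pos S (Suc t)) * rdim S (Suc t)) (link S t)"
    and E: "psd d (effect S 0)" "psd d (effect S 1)" "effect S 0 + effect S 1 = 1\<^sub>m d"
    using assms(7) by (auto simp: adaptive_strategy_def N_def d_def)
  have "2 * 1 \<le> k * n" using k assms(6) by (intro mult_le_mono) auto
  then have N: "2 \<le> N" by (simp add: N_def mult.commute)
  have used: "count_upto ((!) (sched S)) t j = used S t j" if "t \<le> N" for t j
    using count_upto_eq_used[of t S j] that by (simp add: len)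
  have cntN: "count_upto ((!) (sched S)) N j = k" if "j < n" for j
    using that by (simp add: used cnt used_def flip: len)
  have act: "sched S ! t < n" if "t < N" for t
    using that sub len nth_mem by fastforce
  have pos: "count_upto ((!) (sched S)) t (sched S ! t) = pos S t" if "t < N" for t
    using that by (simp add: used pos_def)
  have posN: "pos S (N - 1) = k - 1"
  proof -
    obtain t where t: "N = Suc t" using N by (cases N) auto
    then have "count_upto ((!) (sched S)) (Suc t) (sched S ! t) = k" using cntN[OF act[of t]] by simp
    then show ?thesis using pos[of t] t by simp
  qed
  have mid: "mid_dim js p t = a (Suc (pos S t)) * rdim S t" if "t < N" for t
    using act[OF that] pos[OF that] by (simp add: mid_dim_def js_def p_def)
  \<comment> \<open>The last reference is positive as an output factor of the preceding link, which
    exists since \<open>2 \<le> N\<close>; \<open>a k\<close> is positive as an output factor of the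
    last component.\<close>
  have d: "0 < d"
  proof -
    have "Suc (N - 2) < N" and N1: "Suc (N - 2) = N - 1" using N by auto
    then have "0 < rdim S (N - 1)" using channel_pos(2)[OF link[of "N - 2"]] N by (simp add: N1)
    moreover have "channel (comb_mem \<Theta>\<^sub>1 (k - 1) * b (k - 1)) (comb_mem \<Theta>\<^sub>1 k * a k) (comb_chan \<Theta>\<^sub>1 k)"
    proof -
      have "k - 1 < k" "Suc (k - 1) = k" using k by auto
      then show ?thesis using assms(4) unfolding comb_def open_comb_def by metis
    qed
    ultimately show ?thesis using channel_pos(2) by (fastforce simp: d_def N_def)
  qed
  have w0: "work_dim p 0 = b 0 * rdim S 0" using N by (simp add: p_def pos_def used_def)
  have wpos: "0 < work_dim p t" if "t < N" for t
  proof (cases t)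
    case 0
    then show ?thesis using state_pos[OF input] w0 by simp
  next
    case (Suc t')
    then show ?thesis using channel_pos(2)[OF link[of t']] that by (simp add: p_def)
  qed
  have vp: "valid_process js p N"
    unfolding valid_process_def
  proof (intro conjI allI impI)
    show "0 < work_dim p 0" using wpos N by simp
    fix t assume t: "t < N"
    have "channel (mid_dim js p t) (work_dim p (Suc t)) (step_link p t)"
    proof (cases "Suc t < N")
      case True
      then show ?thesis using link[OF True] mid[OF t] by (simp add: p_def)
    next
      case False
      then have "Suc t = N" "t = N - 1" using t by auto
      moreover have "mid_dim js p (N - 1) = d" using mid[of "N - 1"] posN N k by (simp add: d_def N_def)
      ultimately show ?thesis using d by (simp add: p_def channel_id)
    qed
    then show "valid_at js p t"
      using wpos[OF t] pos[OF t] t by (simp add: valid_at_def p_def)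
  qed
  have dist: "distinct js" and lenjs: "length js = n" by (simp_all add: js_def)
  have cntjs: "count_upto ((!) (sched S)) N j = k" if "j \<in> set js" for j
    using that cntN by (simp add: js_def)
  have md: "mems (\<lambda>_. \<Theta>) t l = mem_dim \<Theta> S t (set l)" if "t \<le> N" "distinct l" for \<Theta> t l
  proof -
    have "mems (\<lambda>_. \<Theta>) t l = (\<Prod>j\<in>set l. cur_mem (\<lambda>_. \<Theta>) t j)"
      using that(2) by (simp add: mems_def prod.distinct_set_conv_list)
    then show ?thesis using that(1) by (simp add: mem_dim_def cur_mem_def used)
  qed
  have step: "component_step n a b \<Theta> S t X = comp_step (\<lambda>_. \<Theta>) js (rdim S t) t X" if t: "t < N" for \<Theta> t X
  proof -
    let ?j = "sched S ! t"
    have js: "js = [0..<?j] @ ?j # [Suc ?j..<n]"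
      using act[OF t] upt_add_eq_append[of 0 ?j "n - ?j"] upt_conv_Cons[of ?j n] by (simp add: js_def)
    have "set [Suc ?j..<n] = {?j<..<n}" by auto
    then show ?thesis
      using t by (simp add: comp_step_split[OF _ js] component_step_def Let_def md pos atLeast0LessThan)
  qed
  have run: "run n a b \<Theta> S t = proc_run (\<lambda>_. \<Theta>) js p t (input S)" if "t < N" for \<Theta> t
    using that
  proof (induction t)
    case (Suc t)
    then have t: "t < N" by simp
    have "set js = {..<n}" by (auto simp: js_def)
    then show ?case
      using Suc act[OF t] md[of "Suc t" js \<Theta>] dist mid[OF t] step[OF t, of \<Theta>]
      by (simp add: proc_step_def p_def)
  qed simp
  let ?m = "\<lambda>X. mat_diag 2 (\<lambda>i. tr (effect S i * X))"
  have fin: "channel (work_dim p 0) d (proc_run (\<lambda>_. \<Theta>) js p N)"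
    "final_state n k a b \<Theta> S = proc_run (\<lambda>_. \<Theta>) js p N (input S)" if \<Theta>: "comb k a b \<Theta>" for \<Theta>
  proof -
    have "comb_mem \<Theta> k = 1" "open_comb k a b \<Theta>" using \<Theta> by (auto simp: comb_def)
    then have m1: "mems (\<lambda>_. \<Theta>) N l = 1" if "set l \<subseteq> set js" for l
      using that cntjs by (induction l) (auto simp: cur_mem_def)
    have vc: "valid_combs (\<lambda>_. \<Theta>) js N" using cntjs \<open>open_comb k a b \<Theta>\<close> by (simp add: valid_combs_def)
    show "channel (work_dim p 0) d (proc_run (\<lambda>_. \<Theta>) js p N)"
      using channel_proc_run[OF vp vc dist] m1 by (simp add: p_def)
    obtain t where t: "N = Suc t" using N by (cases N) auto
    let ?C = "component_step n a b \<Theta> S t (run n a b \<Theta> S t)"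
    \<comment> \<open>The identity link leaves only matrices of the right size unchanged. The size
      is \<open>d\<close> because the memories of the other copies are trivial in the last
      step.\<close>
    have "?C \<in> carrier_mat d d"
    proof -
      have Sp: "Suc (pos S t) = k" using posN k by (simp add: t)
      let ?j = "sched S ! t"
      have j: "?j < n" using act t by simp
      have "mem_dim \<Theta> S t {..<?j} = 1" "mem_dim \<Theta> S t {?j<..<n} = 1"
      proof -
        have "comb_mem \<Theta> (used S t x) = 1" if "x < n" "x \<noteq> ?j" for x
          using cntN[OF that(1)] that(2) used[of t x] \<open>comb_mem \<Theta> k = 1\<close> by (simp add: t)
        then show "mem_dim \<Theta> S t {..<?j} = 1" "mem_dim \<Theta> S t {?j<..<n} = 1"
          unfolding mem_dim_def using j by (auto intro!: prod.neutral)
      qed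
      then show ?thesis
        using tens_id_carrier[of 1 "1 * 1" "1 * 1" d] \<open>comb_mem \<Theta> k = 1\<close>
        by (simp add: component_step_def Let_def Sp d_def t flip: N_def)
    qed
    then have "tens_id 1 d d 1 id ?C = ?C" by (intro tens_id_id) simp
    moreover have "mid_dim js p t = d" using mid[of t] posN k by (simp add: t d_def flip: N_def)
    ultimately show "final_state n k a b \<Theta> S = proc_run (\<lambda>_. \<Theta>) js p N (input S)"
      using m1[of js] act[of t] step[of t \<Theta>] run[of t \<Theta>]
      by (simp add: final_state_def t proc_step_def p_def js_def flip: N_def)
  qed
  have "D (decision n k a b \<Theta>\<^sub>1 S) (decision n k a b \<Theta>\<^sub>2 S) =
      D (?m (proc_run (\<lambda>_. \<Theta>\<^sub>1) js p N (input S))) (?m (proc_run (\<lambda>_. \<Theta>\<^sub>2) js p N (input S)))"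
    using fin(2) assms(4,5) by (simp add: decision_def)
  also have "\<dots> \<le> D (proc_run (\<lambda>_. \<Theta>\<^sub>1) js p N (input S)) (proc_run (\<lambda>_. \<Theta>\<^sub>2) js p N (input S))"
    using D
  proof (rule divergence_channel)
    show "channel d 2 ?m" using E d by (rule channel_measurement)
  qed (use state_channel[OF fin(1)] assms(4,5) input w0 in auto)
  \<comment> \<open>Both hypotheses start from the same input state, so
    \<open>D \<rho> \<rho> \<le> 0\<close> can be used here.\<close>
  also have "\<dots> \<le> amortized D (work_dim p 0) d (proc_run (\<lambda>_. \<Theta>\<^sub>1) js p N) (proc_run (\<lambda>_. \<Theta>\<^sub>2) js p N)"
    using fin(1) assms(4,5) input w0 by (intro divergence_le_amortized[OF D assms(2)]) auto
  also have "\<dots> \<le> ereal (real n) * network_divergence D k a b \<Theta>\<^sub>1 \<Theta>\<^sub>2"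
    using amortized_proc_run_le[OF D k assms(4,5) dist vp cntjs] by (simp add: lenjs p_def)
  finally show ?thesis .
qed

end
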